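(* Suppose Assumptions (A3) and (A6) hold. Fix $\gamma_0\in(0,a_0)$ and suppose $\delta\in\big[0,\min\{a_0-\gamma_0,\frac{1-e^{-\omega}}{2M}\}\big)$. Let $\vartheta=\frac{1-2\sigma\gamma_0}{e^{-\omega}+2\delta\sigma}$. Then there exist $N_0\in\mathbb{N}$ and $C_1\in(0,\infty)$ such that for all $\varepsilon>0$: if $d>1$, $$P[\mathcal{W}_1(\mu_n^N,\mu_n)>\varepsilon]\le P[\mathcal{W}_1(\mu_0^N,\mu_0)>2\sigma\gamma_0\vartheta^n\varepsilon]+e^{-C_1\varepsilon N^{1/(d+2)}}$$ for all $n\ge0$ and $N\ge N_0\max\{(\frac1\varepsilon\log^+\frac1\varepsilon)^{d+2},\varepsilon^{(d+2)/(d-1)}\}$; and if $d=1$, $$P[\mathcal{W}_1(\mu_n^N,\mu_n)>\varepsilon]\le P[\mathcal{W}_1(\mu_0^N,\mu_0)>2\sigma\gamma_0\vartheta^n\varepsilon]+e^{-C_1(\varepsilon\wedge1)N^{1/(d+2)}}$$ for all $n\ge0$ and $N\ge N_0\max\{(\frac1\varepsilon\log^+\frac1\varepsilon)^{d+2},1\}$.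
   Context: Setting. Fix integers $d,m\ge1$, a real $d\times d$ matrix $A$ with operator norm $\|A\|$, $\delta\ge0$, a Borel probability measure $\theta$ on $\mathbb{R}^m$, and a measurable $f:\mathbb{R}^d\times\mathcal{P}_1(\mathbb{R}^d)\times\mathbb{R}^m\to\mathbb{R}^d$. $\mathcal{P}_1(\mathbb{R}^d)$: Borel probability measures on $\mathbb{R}^d$ with finite first moment, with the Wasserstein-1 distance $\mathcal{W}_1(\mu,\nu)=\inf E|X-Y|$ over couplings. Particle system: for each $N\ge1$, $\{X_0^{i,N}\}_{i=1}^N$ are exchangeable, each with law $\mu_0\in\mathcal{P}_1(\mathbb{R}^d)$; $\{\epsilon_n^i\}_{i,n\ge1}$ i.i.d. with law $\theta$, independent of the initial conditions; $X_{n+1}^{i,N}=AX_n^{i,N}+\delta f(X_n^{i,N},\mu_n^N,\epsilon_{n+1}^i)$, $\mu_n^N=\frac1N\sum_{i=1}^N\delta_{X_n^{i,N}}$. Nonlinear evolution: $\Psi(\mu)$ is the law of $AX+\delta f(X,\mu,\epsilon)$ with $(X,\epsilon)\sim\mu\otimes\theta$, and $\mu_{n+1}=\Psi(\mu_n)$. $D(z):=\sup\frac{|f(x_1,\mu_1,z)-f(x_2,\mu_2,z)|}{|x_1-x_2|+\mathcal{W}_1(\mu_1,\mu_2)}$ (supremum over $(x_1,\mu_1)\neq(x_2,\mu_2)$), $D_1(z):=|f(0,\delta_0,z)|$, $\sigma:=\int D\,d\theta$, $a_0:=\frac{1-e^{-\omega}}{2\sigma}$, $\log^+x=\max\{\log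 x,0\}$. (A3): $\|A\|\le e^{-\omega}$ for some $\omega>0$. (A6): (i) for some $M\in(1,\infty)$, $D(z)\le M$ for $\theta$-a.e. $z$; (ii) there is $\alpha>0$ with $\int e^{\alpha|x|}\mu_0(dx)<\infty$ and $\int e^{\alpha D_1(z)}\theta(dz)<\infty$. *)

theory Defs
  imports "HOL-Probability.Probability" "HOL-Combinatorics.Permutations"
begin

definition P1 :: "('a::euclidean_space) measure set" where
  "P1 = {\<mu>. prob_space \<mu> \<and> sets \<mu> = sets (borel :: 'a measure) \<and>
             (\<integral>\<^sup>+ x. ennreal (norm x) \<partial>\<mu>) < \<infinity>}"

definition couplings :: "('a::euclidean_space) measure \<Rightarrow> 'a measure \<Rightarrow> ('a \<times> 'a) measure set" where
  "couplings \<mu> \<nu> = {\<pi>. prob_space \<pi> \<and> sets \<pi> = sets (borel :: ('a \<times> 'a) measure) \<and>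
                        distr \<pi> borel fst = \<mu> \<and> distr \<pi> borel snd = \<nu>}"

text \<open>Wasserstein-1 distance (finite on P_1).\<close>
definition W1 :: "('a::euclidean_space) measure \<Rightarrow> 'a measure \<Rightarrow> real" where
  "W1 \<mu> \<nu> = enn2real (INF \<pi> \<in> couplings \<mu> \<nu>. \<integral>\<^sup>+ p. ennreal (dist (fst p) (snd p)) \<partial>\<pi>)"

definition empirical :: "nat \<Rightarrow> (nat \<Rightarrow> 'a::euclidean_space) \<Rightarrow> 'a measure" where
  "empirical N x = distr (uniform_count_measure {1..N}) borel x"

primrec particle ::
  "real^'d^'d \<Rightarrow> real \<Rightarrow> (real^'d \<Rightarrow> (real^'d) measure \<Rightarrow> real^'m \<Rightarrow> real^'d)
   \<Rightarrow> (nat \<Rightarrow> nat \<Rightarrow> 'w \<Rightarrow> real^'d) \<Rightarrow> (nat \<Rightarrow> nat \<Rightarrow> 'w \<Rightarrow> real^'m)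
   \<Rightarrow> nat \<Rightarrow> nat \<Rightarrow> 'w \<Rightarrow> nat \<Rightarrow> real^'d" where
  "particle A \<delta> f X0 eps 0 N w = (\<lambda>i. X0 N i w)"
| "particle A \<delta> f X0 eps (Suc n) N w =
     (\<lambda>i. A *v particle A \<delta> f X0 eps n N w i
          + \<delta> *\<^sub>R f (particle A \<delta> f X0 eps n N w i)
                     (empirical N (particle A \<delta> f X0 eps n N w)) (eps (Suc n) i w))"

definition Psi ::
  "real^'d^'d \<Rightarrow> real \<Rightarrow> (real^'d \<Rightarrow> (real^'d) measure \<Rightarrow> real^'m \<Rightarrow> real^'d)
   \<Rightarrow> (real^'m) measure \<Rightarrow> (real^'d) measure \<Rightarrow> (real^'d) measure" where
  "Psi A \<delta> f \<theta> \<mu> = distr (\<mu> \<Otimes>\<^sub>M \<theta>) borel (\<lambda>(x, z). A *v x + \<delta> *\<^sub>R f x \<mu> z)"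

definition Dlip :: "('a::euclidean_space \<Rightarrow> 'a measure \<Rightarrow> 'b \<Rightarrow> 'a) \<Rightarrow> 'b \<Rightarrow> ennreal" where
  "Dlip f z = (SUP p \<in> {((x1, \<mu>1), (x2, \<mu>2)). \<mu>1 \<in> P1 \<and> \<mu>2 \<in> P1 \<and> (x1, \<mu>1) \<noteq> (x2, \<mu>2)}.
      (case p of ((x1, \<mu>1), (x2, \<mu>2)) \<Rightarrow>
        ennreal (norm (f x1 \<mu>1 z - f x2 \<mu>2 z) / (dist x1 x2 + W1 \<mu>1 \<mu>2))))"

definition D1 :: "('a::euclidean_space \<Rightarrow> 'a measure \<Rightarrow> 'b \<Rightarrow> 'a) \<Rightarrow> 'b \<Rightarrow> real" where
  "D1 f z = norm (f 0 (return borel 0) z)"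

definition sigma :: "('a::euclidean_space \<Rightarrow> 'a measure \<Rightarrow> 'b \<Rightarrow> 'a) \<Rightarrow> 'b measure \<Rightarrow> real" where
  "sigma f \<theta> = enn2real (\<integral>\<^sup>+ z. Dlip f z \<partial>\<theta>)"

definition logp :: "real \<Rightarrow> real" where
  "logp x = max (ln x) 0"

end

theory Submission
  imports Defs
begin

text \<open>
  Since \<open>\<Psi>\<close> is Lipschitz with constant \<open>\<xi> = exp (- \<omega>) + 2 * \<delta> * sigma f \<theta> < 1\<close>, the error at time \<open>n\<close> is at most
  \<open>\<Sum>k<n. \<xi> ^ k * dev (n - 1 - k)\<close> plus \<open>\<xi> ^ n\<close> times the initial error, where \<open>dev k\<close> is the distance
  between the empirical measure at time \<open>k + 1\<close> and the \<open>\<Psi>\<close>-image of the empirical measure at time \<open>k\<close>.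
  Given the past, the particles at time \<open>k + 1\<close> are independent with averaged law exactly that image.
  A cube is cut into \<open>(2 * m) ^ d\<close> cells; moving mass between cells bounds \<open>dev\<close> by the cell diameter, the
  diameter of the cube times the total variation over the cells, and exponential tails. Hoeffding's
  inequality for each of the \<open>2 ^ ((2 * m) ^ d)\<close> unions of cells controls the total variation, and a uniform
  exponential moment controls the tails. With \<open>a\<close> the \<open>(d + 2)\<close>-th root of \<open>N\<close>, a number of cells
  per axis proportional to \<open>a\<close> balances entropy against Hoeffding, both being of order \<open>a ^ d\<close>, and leaves a tail
  of order \<open>exp (- b * \<epsilon> * a)\<close>. Discrepancies \<open>k\<close> steps back are discounted by \<open>\<xi> ^ k\<close>, so they are
  allowed geometrically growing thresholds, which makes the sum over \<open>k\<close> uniform in \<open>n\<close>.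
\<close>

section \<open>Couplings and the Wasserstein distance\<close>

text \<open>The mesh is proportional to the threshold \<open>r\<close>. With side
  \<open>r / (4 * d)\<close> and total variation at most \<open>1 / m\<close>, the cell diameter and
  the radius of the cube times the total variation cost \<open>r / 4\<close> each, so neither the
  entropy \<open>(2 * m) ^ d\<close> nor the Hoeffding exponent \<open>N / (2 * m\<^sup>2)\<close>
  involves \<open>r\<close>. Balancing these two produces the exponent \<open>1 / (d + 2)\<close>;
  only the tail beyond radius \<open>m * r / (4 * d)\<close> sees the threshold. The two upper
  bounds on \<delta> serve different ends. The average \<open>sigma f \<theta>\<close> controls the
  contraction in \<open>W1\<close>, since there the noise enters linearly. Exponential moments do
  not pass through an average, so their drift uses the essential bound \<open>M\<close>.
  Conditioning on the past avoids conditional expectations: the state is exhibited as a measurable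
  function of the initial data and the earlier noises, and Fubini freezes it while the next noise is
  integrated. Of the two lower bounds on \<open>N\<close>, the logarithmic one absorbs a prefactor
  \<open>Q / \<epsilon>\<close> left by Markov's inequality. For \<open>d > 1\<close> the other
  gives \<open>\<epsilon> * a \<le> a ^ d\<close>, where \<open>a\<close> is the root of
  \<open>N\<close>; for \<open>d = 1\<close> this would confine \<epsilon> to at most 1, whence the
  minimum in the rate.\<close>

lemma density_marginals:
  assumes "prob_space M1" "prob_space M2"
    and g[measurable]: "g \<in> borel_measurable (M1 \<Otimes>\<^sub>M M2)"
    and g1: "AE x in M1. (\<integral>\<^sup>+y. g (x, y) \<partial>M2) = 1"
    and g2: "AE y in M2. (\<integral>\<^sup>+x. g (x, y) \<partial>M1) = 1"
  shows "distr (density (M1 \<Otimes>\<^sub>M M2) g) M1 fst = M1"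
    and "distr (density (M1 \<Otimes>\<^sub>M M2) g) M2 snd = M2"
proof -
  interpret M1: prob_space M1 by fact
  interpret M2: prob_space M2 by fact
  interpret P: pair_prob_space M1 M2 ..
  show "distr (density (M1 \<Otimes>\<^sub>M M2) g) M1 fst = M1"
  proof (rule measure_eqI)
    fix A assume "A \<in> sets (distr (density (M1 \<Otimes>\<^sub>M M2) g) M1 fst)"
    then have A[measurable]: "A \<in> sets M1" by simp
    have "emeasure (distr (density (M1 \<Otimes>\<^sub>M M2) g) M1 fst) A
        = (\<integral>\<^sup>+p. indicator A (fst p) \<partial>(density (M1 \<Otimes>\<^sub>M M2) g))"
      by (subst nn_integral_indicator[symmetric], simp, subst nn_integral_distr, auto)
    also have "\<dots> = (\<integral>\<^sup>+p. g p * indicator A (fst p) \<partial>(M1 \<Otimes>\<^sub>M M2))"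
      by (subst nn_integral_density) auto
    also have "\<dots> = (\<integral>\<^sup>+x. (\<integral>\<^sup>+y. g (x, y) * indicator A x \<partial>M2) \<partial>M1)"
      by (subst M2.nn_integral_fst[symmetric]) auto
    also have "\<dots> = (\<integral>\<^sup>+x. (\<integral>\<^sup>+y. g (x, y) \<partial>M2) * indicator A x \<partial>M1)"
      by (intro nn_integral_cong nn_integral_multc) auto
    also have "\<dots> = (\<integral>\<^sup>+x. indicator A x \<partial>M1)"
      by (intro nn_integral_cong_AE) (use g1 in eventually_elim, auto)
    finally show "emeasure (distr (density (M1 \<Otimes>\<^sub>M M2) g) M1 fst) A = emeasure M1 A" by simp
  qed simp
  show "distr (density (M1 \<Otimes>\<^sub>M M2) g) M2 snd = M2"
  proof (rule measure_eqI)
    fix A assume "A \<in> sets (distr (density (M1 \<Otimes>\<^sub>M M2) g) M2 snd)"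
    then have A[measurable]: "A \<in> sets M2" by simp
    have "emeasure (distr (density (M1 \<Otimes>\<^sub>M M2) g) M2 snd) A
        = (\<integral>\<^sup>+p. indicator A (snd p) \<partial>(density (M1 \<Otimes>\<^sub>M M2) g))"
      by (subst nn_integral_indicator[symmetric], simp, subst nn_integral_distr, auto)
    also have "\<dots> = (\<integral>\<^sup>+p. g p * indicator A (snd p) \<partial>(M1 \<Otimes>\<^sub>M M2))"
      by (subst nn_integral_density) auto
    also have "\<dots> = (\<integral>\<^sup>+y. (\<integral>\<^sup>+x. g (x, y) * indicator A y \<partial>M1) \<partial>M2)"
      by (subst P.nn_integral_snd[symmetric]) auto
    also have "\<dots> = (\<integral>\<^sup>+y. (\<integral>\<^sup>+x. g (x, y) \<partial>M1) * indicator A y \<partial>M2)"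
      by (intro nn_integral_cong nn_integral_multc) auto
    also have "\<dots> = (\<integral>\<^sup>+y. indicator A y \<partial>M2)"
      by (intro nn_integral_cong_AE) (use g2 in eventually_elim, auto)
    finally show "emeasure (distr (density (M1 \<Otimes>\<^sub>M M2) g) M2 snd) A = emeasure M2 A" by simp
  qed simp
qed

lemma prob_space_of_distr:
  assumes "f \<in> M \<rightarrow>\<^sub>M N" "prob_space (distr M N f)"
  shows "prob_space M"
proof
  have "emeasure (distr M N f) (space N) = emeasure M (space M)"
    using assms(1) by (simp add: emeasure_distr) (metis measurable_space Int_absorb1 subsetI vimageI)
  then show "emeasure M (space M) = 1"
    using prob_space.emeasure_space_1[OF assms(2)] by simp
qed

lemma borel_measurable_fst_snd[measurable]:
  "fst \<in> (borel :: ('a::second_countable_topology \<times> 'b::second_countable_topology) measure) \<rightarrow>\<^sub>M borel"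
  "snd \<in> (borel :: ('a::second_countable_topology \<times> 'b::second_countable_topology) measure) \<rightarrow>\<^sub>M borel"
  unfolding borel_prod[symmetric] by measurable

lemma P1D:
  assumes "\<mu> \<in> P1"
  shows "prob_space \<mu>" "sets \<mu> = sets borel" "(\<integral>\<^sup>+ x. ennreal (norm x) \<partial>\<mu>) < \<infinity>"
  using assms by (auto simp: P1_def)

lemma couplingsD:
  assumes "\<pi> \<in> couplings \<mu> \<nu>"
  shows "prob_space \<pi>" "sets \<pi> = sets borel" "distr \<pi> borel fst = \<mu>" "distr \<pi> borel snd = \<nu>"
  using assms by (auto simp: couplings_def)

lemma couplings_measurable:
  fixes \<pi> :: "('a::euclidean_space \<times> 'a) measure"
  assumes "\<pi> \<in> couplings \<mu> \<nu>"
  shows "fst \<in> \<pi> \<rightarrow>\<^sub>M borel" "snd \<in> \<pi> \<rightarrow>\<^sub>M borel"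
proof -
  have *: "sets \<pi> = sets ((borel :: 'a measure) \<Otimes>\<^sub>M (borel :: 'a measure))" by (subst borel_prod) (rule couplingsD(2)[OF assms])
  show "fst \<in> \<pi> \<rightarrow>\<^sub>M borel" "snd \<in> \<pi> \<rightarrow>\<^sub>M borel"
    by (simp_all add: measurable_cong_sets[OF * refl])
qed

lemma couplings_nn_integral:
  fixes \<pi> :: "('a::euclidean_space \<times> 'a) measure"
  assumes "\<pi> \<in> couplings \<mu> \<nu>" and [measurable]: "h \<in> borel_measurable borel"
  shows "(\<integral>\<^sup>+p. h (fst p) \<partial>\<pi>) = (\<integral>\<^sup>+x. h x \<partial>\<mu>)" "(\<integral>\<^sup>+p. h (snd p) \<partial>\<pi>) = (\<integral>\<^sup>+x. h x \<partial>\<nu>)"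
  using couplings_measurable[OF assms(1)]
  by (simp_all add: couplingsD(3,4)[OF assms(1), symmetric] nn_integral_distr)

abbreviation cost :: "('a::euclidean_space \<times> 'a) measure \<Rightarrow> ennreal" where
  "cost \<pi> \<equiv> \<integral>\<^sup>+ p. ennreal (dist (fst p) (snd p)) \<partial>\<pi>"

text \<open>If the infimum is infinite, \<open>enn2real\<close> returns 0, so the bound holds there
  as well. The converse, \<open>coupling_approx\<close>, uses first moments to exclude that
  case.\<close>

lemma W1_le_cost:
  assumes "\<pi> \<in> couplings \<mu> \<nu>"
  shows "ennreal (W1 \<mu> \<nu>) \<le> cost \<pi>"
proof -
  let ?I = "INF \<pi> \<in> couplings \<mu> \<nu>. cost \<pi>"
  have "ennreal (W1 \<mu> \<nu>) \<le> ?I" unfolding W1_def by (cases ?I) auto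
  also have "\<dots> \<le> cost \<pi>" by (rule INF_lower) fact
  finally show ?thesis .
qed

lemma W1_nonneg[simp]: "0 \<le> W1 \<mu> \<nu>" by (simp add: W1_def)

lemma coupling_of_density:
  fixes \<mu> \<nu> :: "'a::euclidean_space measure"
  assumes "\<mu> \<in> P1" "\<nu> \<in> P1"
    and g[measurable]: "g \<in> borel_measurable (\<mu> \<Otimes>\<^sub>M \<nu>)"
    and g1: "AE x in \<mu>. (\<integral>\<^sup>+y. g (x, y) \<partial>\<nu>) = 1"
    and g2: "AE y in \<nu>. (\<integral>\<^sup>+x. g (x, y) \<partial>\<mu>) = 1"
  shows "density (\<mu> \<Otimes>\<^sub>M \<nu>) g \<in> couplings \<mu> \<nu>"
proof -
  note \<mu> = P1D[OF assms(1)] and \<nu> = P1D[OF assms(2)]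
  note m = density_marginals[OF \<mu>(1) \<nu>(1) g g1 g2]
  have 1: "distr (density (\<mu> \<Otimes>\<^sub>M \<nu>) g) borel fst = \<mu>"
    by (subst m(1)[symmetric], rule distr_cong) (simp_all add: \<mu>)
  have 2: "distr (density (\<mu> \<Otimes>\<^sub>M \<nu>) g) borel snd = \<nu>"
    by (subst m(2)[symmetric], rule distr_cong) (simp_all add: \<nu>)
  have "prob_space (density (\<mu> \<Otimes>\<^sub>M \<nu>) g)"
    by (rule prob_space_of_distr[of fst _ \<mu>]) (auto simp: m \<mu>)
  moreover have "sets (\<mu> \<Otimes>\<^sub>M \<nu>) = sets (borel :: ('a \<times> 'a) measure)"
    unfolding borel_prod[symmetric] by (rule sets_pair_measure_cong[OF \<mu>(2) \<nu>(2)])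
  ultimately show ?thesis using 1 2 by (simp add: couplings_def)
qed

lemma couplings_prod:
  fixes \<mu> \<nu> :: "'a::euclidean_space measure"
  assumes "\<mu> \<in> P1" "\<nu> \<in> P1"
  shows "\<mu> \<Otimes>\<^sub>M \<nu> \<in> couplings \<mu> \<nu>"
proof -
  have "density (\<mu> \<Otimes>\<^sub>M \<nu>) (\<lambda>_. 1) \<in> couplings \<mu> \<nu>"
    using prob_space.emeasure_space_1[OF P1D(1)[OF assms(1)]] prob_space.emeasure_space_1[OF P1D(1)[OF assms(2)]]
    by (intro coupling_of_density assms) auto
  then show ?thesis by (simp add: density_1)
qed

lemma coupling_cost_finite:
  fixes \<mu> \<nu> :: "'a::euclidean_space measure"
  assumes "\<mu> \<in> P1" "\<nu> \<in> P1" "\<pi> \<in> couplings \<mu> \<nu>"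
  shows "cost \<pi> < \<infinity>"
proof -
  note [measurable] = couplings_measurable[OF assms(3)]
  have "cost \<pi> \<le> (\<integral>\<^sup>+ p. ennreal (norm (fst p)) + ennreal (norm (snd p)) \<partial>\<pi>)"
    by (intro nn_integral_mono) (auto simp: ennreal_plus[symmetric] dist_norm norm_triangle_ineq4 simp del: ennreal_plus)
  also have "\<dots> = (\<integral>\<^sup>+ x. ennreal (norm x) \<partial>\<mu>) + (\<integral>\<^sup>+ x. ennreal (norm x) \<partial>\<nu>)"
    by (subst nn_integral_add) (auto simp: couplings_nn_integral[OF assms(3), of "\<lambda>x. ennreal (norm x)"])
  also have "\<dots> < \<infinity>" using assms by (auto simp: P1_def)
  finally show ?thesis .
qed

lemma coupling_approx:
  fixes \<mu> \<nu> :: "'a::euclidean_space measure"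
  assumes "\<mu> \<in> P1" "\<nu> \<in> P1" "e > 0"
  obtains \<pi> where "\<pi> \<in> couplings \<mu> \<nu>" "cost \<pi> \<le> ennreal (W1 \<mu> \<nu> + e)"
proof -
  let ?I = "INF \<pi> \<in> couplings \<mu> \<nu>. cost \<pi>"
  have "?I \<le> cost (\<mu> \<Otimes>\<^sub>M \<nu>)"
    by (intro INF_lower couplings_prod assms)
  also have "\<dots> < \<infinity>" by (intro coupling_cost_finite[OF assms(1,2)] couplings_prod assms)
  finally have fin: "?I < \<infinity>" .
  then have "?I = ennreal (W1 \<mu> \<nu>)" by (simp add: W1_def)
  also have "\<dots> < ennreal (W1 \<mu> \<nu> + e)" using assms(3) by (intro ennreal_lessI) (auto intro: add_nonneg_pos)
  finally obtain \<pi> where "\<pi> \<in> couplings \<mu> \<nu>" "cost \<pi> < ennreal (W1 \<mu> \<nu> + e)"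
    by (auto simp: INF_less_iff)
  then show ?thesis using that by auto
qed

lemma couplings_swap:
  fixes \<mu> \<nu> :: "'a::euclidean_space measure"
  assumes "\<pi> \<in> couplings \<mu> \<nu>"
  shows "distr \<pi> borel prod.swap \<in> couplings \<nu> \<mu>"
proof -
  note [measurable] = couplings_measurable[OF assms]
  have *: "prod.swap = (\<lambda>p::'a \<times> 'a. (snd p, fst p))" by (auto simp: fun_eq_iff)
  have [measurable]: "prod.swap \<in> \<pi> \<rightarrow>\<^sub>M (borel :: ('a \<times> 'a) measure)"
    unfolding borel_prod[symmetric] * by measurable
  show ?thesis using couplingsD[OF assms]
    by (auto simp: couplings_def prob_space.prob_space_distr distr_distr comp_def)
qed

lemma W1_commute_le:
  fixes \<mu> \<nu> :: "'a::euclidean_space measure"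
  assumes "\<mu> \<in> P1" "\<nu> \<in> P1"
  shows "W1 \<nu> \<mu> \<le> W1 \<mu> \<nu>"
proof (rule field_le_epsilon)
  fix e :: real assume "e > 0"
  from coupling_approx[OF assms this] obtain \<pi> where
    \<pi>: "\<pi> \<in> couplings \<mu> \<nu>" "cost \<pi> \<le> ennreal (W1 \<mu> \<nu> + e)" .
  note [measurable] = couplings_measurable[OF \<pi>(1)]
  have *: "prod.swap = (\<lambda>p::'a \<times> 'a. (snd p, fst p))" by (auto simp: fun_eq_iff)
  have [measurable]: "prod.swap \<in> \<pi> \<rightarrow>\<^sub>M (borel :: ('a \<times> 'a) measure)"
    unfolding borel_prod[symmetric] * by measurable
  note W1_le_cost[OF couplings_swap[OF \<pi>(1)]]
  also have "cost (distr \<pi> borel prod.swap) = cost \<pi>"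
    by (subst nn_integral_distr) (auto simp: dist_commute)
  also note \<pi>(2)
  finally show "W1 \<nu> \<mu> \<le> W1 \<mu> \<nu> + e" using \<open>e > 0\<close> by (simp add: ennreal_le_iff add_nonneg_nonneg del: ennreal_plus)
qed

lemma W1_commute:
  fixes \<mu> \<nu> :: "'a::euclidean_space measure"
  assumes "\<mu> \<in> P1" "\<nu> \<in> P1"
  shows "W1 \<nu> \<mu> = W1 \<mu> \<nu>"
  using W1_commute_le[OF assms] W1_commute_le[OF assms(2,1)] by simp

text \<open>A point is sent to the first member of a dense sequence within \<open>e / 2\<close>. The
  cells are countable, so that all cells of mass zero can be discarded at once in
  \<open>glue_couplings\<close>.\<close>

lemma small_cells:
  fixes e :: real assumes "e > 0"
  obtains c :: "'a::{metric_space, second_countable_topology} \<Rightarrow> nat"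
  where "c \<in> borel \<rightarrow>\<^sub>M count_space UNIV" "\<And>x y. c x = c y \<Longrightarrow> dist x y < e"
proof -
  obtain D :: "'a set" where D: "countable D" "\<And>X. open X \<Longrightarrow> X \<noteq> {} \<Longrightarrow> \<exists>d\<in>D. d \<in> X"
    using countable_dense_exists by blast
  from D(2)[of UNIV] have ne: "D \<noteq> {}" by auto
  define c where "c = (\<lambda>x. LEAST n. dist (from_nat_into D n) x < e / 2)"
  have ex: "\<exists>n. dist (from_nat_into D n) x < e / 2" for x
  proof -
    obtain d where d: "d \<in> D" "dist x d < e / 2" using D(2)[of "ball x (e/2)"] assms by auto
    from from_nat_into_surj[OF D(1) d(1)] d show ?thesis by (auto simp: dist_commute)
  qed
  have L: "dist (from_nat_into D (c x)) x < e / 2" for x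
    unfolding c_def by (rule LeastI_ex[OF ex])
  show ?thesis
  proof (rule that)
    show "c \<in> borel \<rightarrow>\<^sub>M count_space UNIV" unfolding c_def by measurable
    fix x y assume "c x = c y"
    then show "dist x y < e" using L[of x] L[of y] dist_triangle_half_r[of "from_nat_into D (c x)" x e y] by auto
  qed
qed

text \<open>The middle marginal is discretised into cells of diameter below \<open>e\<close>; given the cell, the outer
  variables are taken independent. This avoids disintegration at the price of an extra \<open>e\<close>.\<close>
lemma glue_couplings:
  fixes \<mu> \<nu> \<eta> :: "'a::euclidean_space measure"
  assumes \<pi>1: "\<pi>1 \<in> couplings \<mu> \<nu>" and \<pi>2: "\<pi>2 \<in> couplings \<nu> \<eta>" and "e > 0"
  obtains \<pi> where "\<pi> \<in> couplings \<mu> \<eta>"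
    "cost \<pi> \<le>
     cost \<pi>1 + ennreal e + cost \<pi>2"
proof -
  interpret A: prob_space \<pi>1 by (rule couplingsD[OF \<pi>1])
  interpret B: prob_space \<pi>2 by (rule couplingsD[OF \<pi>2])
  interpret P: pair_prob_space \<pi>1 \<pi>2 ..
  note [measurable] = couplings_measurable[OF \<pi>1] couplings_measurable[OF \<pi>2]
  interpret N: prob_space \<nu>
    using couplings_measurable[OF \<pi>1] couplingsD(4)[OF \<pi>1] A.prob_space_distr by metis
  have [measurable_cong]: "sets \<nu> = sets borel"
    using couplingsD(4)[OF \<pi>1] by auto
  obtain c :: "'a \<Rightarrow> nat" where c[measurable]: "c \<in> borel \<rightarrow>\<^sub>M count_space UNIV"
    and ce: "\<And>x y. c x = c y \<Longrightarrow> dist x y < e"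
    using small_cells[OF \<open>e > 0\<close>] by blast
  define w where "w n = emeasure \<nu> {y \<in> space \<nu>. c y = n}" for n
  have w2: "w n = emeasure \<pi>1 {p \<in> space \<pi>1. c (snd p) = n}" for n
    unfolding w_def couplingsD(4)[OF \<pi>1, symmetric]
    by (subst emeasure_distr) (auto intro!: arg_cong2[where f=emeasure])
  have w1: "w n = emeasure \<pi>2 {p \<in> space \<pi>2. c (fst p) = n}" for n
    unfolding w_def couplingsD(3)[OF \<pi>2, symmetric]
    by (subst emeasure_distr) (auto intro!: arg_cong2[where f=emeasure])
  have wtop: "w n \<noteq> \<top>" for n unfolding w_def by auto
  have wpos: "AE y in \<nu>. w (c y) \<noteq> 0"
  proof -
    have "AE y in \<nu>. \<forall>n. w n = 0 \<longrightarrow> c y \<noteq> n"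
      unfolding AE_all_countable
    proof
      fix n show "AE y in \<nu>. w n = 0 \<longrightarrow> c y \<noteq> n"
        by (cases "w n = 0") (auto simp: w_def AE_iff_measurable[OF _ refl])
    qed
    then show ?thesis by eventually_elim auto
  qed
  \<comment> \<open>The product of the two couplings is conditioned on both copies of the middle
    variable falling into the same cell. Dividing by the cell mass makes both partial integrals 1,
    so the two couplings survive as marginals.\<close>
  define g :: "('a \<times> 'a) \<times> ('a \<times> 'a) \<Rightarrow> ennreal" where
    "g = (\<lambda>(p, q). if c (fst q) = c (snd p) then inverse (w (c (snd p))) else 0)"
  have g[measurable]: "g \<in> borel_measurable (\<pi>1 \<Otimes>\<^sub>M \<pi>2)"
  proof -
    have [measurable]: "(\<lambda>r. snd (fst r)) \<in> \<pi>1 \<Otimes>\<^sub>M \<pi>2 \<rightarrow>\<^sub>M borel" "(\<lambda>r. fst (snd r)) \<in> \<pi>1 \<Otimes>\<^sub>M \<pi>2 \<rightarrow>\<^sub>M borel"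
      using couplings_measurable(2)[OF \<pi>1] couplings_measurable(1)[OF \<pi>2]
      by (auto intro: measurable_compose[OF measurable_fst] measurable_compose[OF measurable_snd])
    have *: "g = (\<lambda>r. if \<exists>n. c (fst (snd r)) = n \<and> c (snd (fst r)) = n then inverse (w (c (snd (fst r)))) else 0)"
      by (auto simp: g_def fun_eq_iff)
    show ?thesis unfolding * by measurable
  qed
  have g1: "AE p in \<pi>1. (\<integral>\<^sup>+q. g (p, q) \<partial>\<pi>2) = 1"
  proof -
    have "AE p in \<pi>1. w (c (snd p)) \<noteq> 0"
      using wpos[unfolded couplingsD(4)[OF \<pi>1, symmetric]] by (subst (asm) AE_distr_iff) auto
    then show ?thesis
    proof eventually_elim
      case (elim p)
      have "(\<integral>\<^sup>+q. g (p, q) \<partial>\<pi>2) = inverse (w (c (snd p))) * (\<integral>\<^sup>+q. indicator {q\<in>space \<pi>2. c (fst q) = c (snd p)} q \<partial>\<pi>2)"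
        unfolding g_def by (subst nn_integral_cmult[symmetric]) (auto intro!: nn_integral_cong split: split_indicator)
      also have "\<dots> = 1" using elim wtop
        by (subst nn_integral_indicator) (auto simp: w1[symmetric] ennreal_inverse_mult top.not_eq_extremum mult.commute ennreal_divide_self divide_ennreal_def[symmetric])
      finally show ?case .
    qed
  qed
  have g2: "AE q in \<pi>2. (\<integral>\<^sup>+p. g (p, q) \<partial>\<pi>1) = 1"
  proof -
    have "AE p in \<pi>2. w (c (fst p)) \<noteq> 0"
      using wpos[unfolded couplingsD(3)[OF \<pi>2, symmetric]] by (subst (asm) AE_distr_iff) auto
    then show ?thesis
    proof eventually_elim
      case (elim q)
      have "(\<integral>\<^sup>+p. g (p, q) \<partial>\<pi>1) = inverse (w (c (fst q))) * (\<integral>\<^sup>+p. indicator {p\<in>space \<pi>1. c (snd p) = c (fst q)} p \<partial>\<pi>1)"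
        unfolding g_def by (subst nn_integral_cmult[symmetric]) (auto intro!: nn_integral_cong split: split_indicator)
      also have "\<dots> = 1" using elim wtop
        by (subst nn_integral_indicator) (auto simp: w2[symmetric] top.not_eq_extremum mult.commute ennreal_divide_self divide_ennreal_def[symmetric])
      finally show ?case .
    qed
  qed
  define D where "D = density (\<pi>1 \<Otimes>\<^sub>M \<pi>2) g"
  have D1: "distr D \<pi>1 fst = \<pi>1" and D2: "distr D \<pi>2 snd = \<pi>2"
    unfolding D_def by (rule density_marginals[OF A.prob_space_axioms B.prob_space_axioms g g1 g2])+
  have Df[measurable]: "fst \<in> D \<rightarrow>\<^sub>M \<pi>1" "snd \<in> D \<rightarrow>\<^sub>M \<pi>2" unfolding D_def by auto
  interpret D: prob_space D by (rule prob_space_of_distr[OF Df(1)]) (simp add: D1 A.prob_space_axioms)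
  define h :: "('a \<times> 'a) \<times> ('a \<times> 'a) \<Rightarrow> 'a \<times> 'a" where "h = (\<lambda>r. (fst (fst r), snd (snd r)))"
  have h[measurable]: "h \<in> D \<rightarrow>\<^sub>M borel"
    unfolding borel_prod[symmetric] h_def by measurable
  have hc: "distr D borel h \<in> couplings \<mu> \<eta>"
  proof -
    have "distr (distr D borel h) borel fst = distr (distr D \<pi>1 fst) borel fst"
      by (simp add: distr_distr) (simp add: h_def comp_def)
    also have "\<dots> = \<mu>" by (simp add: D1 couplingsD[OF \<pi>1])
    finally have 1: "distr (distr D borel h) borel fst = \<mu>" .
    have "distr (distr D borel h) borel snd = distr (distr D \<pi>2 snd) borel snd"
      by (simp add: distr_distr) (simp add: h_def comp_def)
    also have "\<dots> = \<eta>" by (simp add: D2 couplingsD[OF \<pi>2])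
    finally show ?thesis using 1 by (auto simp: couplings_def D.prob_space_distr)
  qed
  show ?thesis
  proof (rule that[OF hc])
    have cell: "AE r in D. c (fst (snd r)) = c (snd (fst r))"
      unfolding D_def by (subst AE_density[OF g]) (auto simp: g_def split: if_splits intro!: AE_I2)
    have "cost (distr D borel h) = (\<integral>\<^sup>+ r. ennreal (dist (fst (fst r)) (snd (snd r))) \<partial>D)"
      by (subst nn_integral_distr) (auto simp: h_def)
    also have "\<dots> \<le> (\<integral>\<^sup>+ r. ennreal (dist (fst (fst r)) (snd (fst r))) + ennreal e + ennreal (dist (fst (snd r)) (snd (snd r))) \<partial>D)"
    proof (rule nn_integral_mono_AE, use cell in eventually_elim)
      case (elim r)
      have "dist (fst (fst r)) (snd (snd r)) \<le> dist (fst (fst r)) (snd (fst r)) + dist (snd (fst r)) (fst (snd r)) + dist (fst (snd r)) (snd (snd r))"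
        by metric
      also have "\<dots> \<le> dist (fst (fst r)) (snd (fst r)) + e + dist (fst (snd r)) (snd (snd r))"
        using ce[OF elim] by (simp add: dist_commute)
      finally show ?case using \<open>e > 0\<close> by (simp add: ennreal_plus[symmetric] del: ennreal_plus)
    qed
    also have "\<dots> = (\<integral>\<^sup>+ r. ennreal (dist (fst (fst r)) (snd (fst r))) \<partial>D) + ennreal e + (\<integral>\<^sup>+ r. ennreal (dist (fst (snd r)) (snd (snd r))) \<partial>D)"
      by (simp add: nn_integral_add D.emeasure_space_1)
    also have "(\<integral>\<^sup>+ r. ennreal (dist (fst (fst r)) (snd (fst r))) \<partial>D) = cost (distr D \<pi>1 fst)"
      by (subst nn_integral_distr) auto
    also have "(\<integral>\<^sup>+ r. ennreal (dist (fst (snd r)) (snd (snd r))) \<partial>D) = cost (distr D \<pi>2 snd)"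
      by (subst nn_integral_distr) auto
    finally show "cost (distr D borel h) \<le>
     cost \<pi>1 + ennreal e + cost \<pi>2"
      unfolding D1 D2 .
  qed
qed

lemma W1_triangle:
  fixes \<mu> \<nu> \<eta> :: "'a::euclidean_space measure"
  assumes "\<mu> \<in> P1" "\<nu> \<in> P1" "\<eta> \<in> P1"
  shows "W1 \<mu> \<eta> \<le> W1 \<mu> \<nu> + W1 \<nu> \<eta>"
proof (rule field_le_epsilon)
  fix e :: real assume "e > 0"
  then have e: "e / 3 > 0" by simp
  obtain \<pi>1 where 1: "\<pi>1 \<in> couplings \<mu> \<nu>" "cost \<pi>1 \<le> ennreal (W1 \<mu> \<nu> + e/3)"
    by (rule coupling_approx[OF assms(1,2) e])
  obtain \<pi>2 where 2: "\<pi>2 \<in> couplings \<nu> \<eta>" "cost \<pi>2 \<le> ennreal (W1 \<nu> \<eta> + e/3)"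
    by (rule coupling_approx[OF assms(2,3) e])
  obtain \<pi> where \<pi>: "\<pi> \<in> couplings \<mu> \<eta>"
    "cost \<pi> \<le>
     cost \<pi>1 + ennreal (e/3) + cost \<pi>2"
    by (rule glue_couplings[OF 1(1) 2(1) e])
  note W1_le_cost[OF \<pi>(1)]
  also note \<pi>(2)
  also have "cost \<pi>1 + ennreal (e/3) + cost \<pi>2
    \<le> ennreal (W1 \<mu> \<nu> + e/3) + ennreal (e/3) + ennreal (W1 \<nu> \<eta> + e/3)"
    using 1 2 by (intro add_mono) auto
  also have "\<dots> = ennreal (W1 \<mu> \<nu> + W1 \<nu> \<eta> + e)"
    using e by (simp add: ennreal_plus[symmetric] add_nonneg_nonneg del: ennreal_plus)
  finally show "W1 \<mu> \<eta> \<le> W1 \<mu> \<nu> + W1 \<nu> \<eta> + e" using \<open>e > 0\<close> by (simp add: ennreal_le_iff add_nonneg_nonneg del: ennreal_plus)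
qed

lemma W1_distr_le:
  fixes X Y :: "'b \<Rightarrow> 'a::euclidean_space"
  assumes "prob_space M" and [measurable]: "X \<in> borel_measurable M" "Y \<in> borel_measurable M"
  shows "ennreal (W1 (distr M borel X) (distr M borel Y)) \<le> (\<integral>\<^sup>+w. ennreal (dist (X w) (Y w)) \<partial>M)"
proof -
  have [measurable]: "(\<lambda>w. (X w, Y w)) \<in> M \<rightarrow>\<^sub>M borel" unfolding borel_prod[symmetric] by measurable
  have "distr M borel (\<lambda>w. (X w, Y w)) \<in> couplings (distr M borel X) (distr M borel Y)"
    using assms(1) by (auto simp: couplings_def prob_space.prob_space_distr distr_distr comp_def)
  from W1_le_cost[OF this] show ?thesis by (subst (asm) nn_integral_distr) auto
qed

section \<open>Empirical measures and definiteness of the Wasserstein distance\<close>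

lemma
  fixes x :: "nat \<Rightarrow> 'a::euclidean_space"
  assumes "1 \<le> N"
  shows prob_space_empirical: "prob_space (empirical N x)"
    and nn_integral_empirical: "g \<in> borel_measurable borel \<Longrightarrow>
      (\<integral>\<^sup>+y. g y \<partial>empirical N x) = (\<Sum>i=1..N. ennreal (1 / N) * g (x i))"
    and empirical_in_P1: "empirical N x \<in> P1"
proof -
  interpret U: prob_space "uniform_count_measure {1..N}"
    using assms by (intro prob_space_uniform_count_measure) auto
  have m: "x \<in> uniform_count_measure {1..N} \<rightarrow>\<^sub>M borel" by (simp add: uniform_count_measure_def)
  show 1: "prob_space (empirical N x)" unfolding empirical_def by (rule U.prob_space_distr[OF m])
  show 2: "(\<integral>\<^sup>+y. g y \<partial>empirical N x) = (\<Sum>i=1..N. ennreal (1 / N) * g (x i))"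
    if "g \<in> borel_measurable borel" for g
    unfolding empirical_def using that m
    by (subst nn_integral_distr) (auto simp: uniform_count_measure_def nn_integral_point_measure_finite)
  show "empirical N x \<in> P1" using 1 unfolding P1_def
    by (auto simp: 2) (auto simp: empirical_def ennreal_mult[symmetric] sum_ennreal)
qed

lemma sets_empirical[simp, measurable_cong]: "sets (empirical N x) = sets borel"
  by (simp add: empirical_def)

lemma empirical_cong: "(\<And>i. i \<in> {1..N} \<Longrightarrow> x i = y i) \<Longrightarrow> empirical N x = empirical N y"
  unfolding empirical_def by (intro distr_cong) (auto simp: space_uniform_count_measure)

lemma emeasure_empirical:
  fixes x :: "nat \<Rightarrow> 'a::euclidean_space"
  assumes "1 \<le> N" "B \<in> sets borel"
  shows "emeasure (empirical N x) B = ennreal ((\<Sum>i=1..N. indicator B (x i)) / N)"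
proof -
  have "emeasure (empirical N x) B = (\<integral>\<^sup>+y. indicator B y \<partial>empirical N x)"
    using assms(2) by (subst nn_integral_indicator) auto
  also have "\<dots> = (\<Sum>i=1..N. ennreal (1 / N) * indicator B (x i))"
    using assms by (subst nn_integral_empirical) auto
  also have "\<dots> = (\<Sum>i=1..N. ennreal (1 / N * indicator B (x i)))"
    by (intro sum.cong) (auto split: split_indicator)
  also have "\<dots> = ennreal ((\<Sum>i=1..N. indicator B (x i)) / N)"
    by (subst sum_ennreal) (auto simp: sum_divide_distrib)
  finally show ?thesis .
qed

lemma measure_empirical:
  fixes x :: "nat \<Rightarrow> 'a::euclidean_space"
  assumes "1 \<le> N" "B \<in> sets borel"
  shows "measure (empirical N x) B = (\<Sum>i=1..N. indicator B (x i)) / N"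
  unfolding measure_def emeasure_empirical[OF assms] by (simp add: sum_nonneg)

lemma return_in_P1: "return borel (0::'a::euclidean_space) \<in> P1"
  by (auto simp: P1_def prob_space_return nn_integral_return)

lemma W1_return_le:
  fixes \<mu> :: "'a::euclidean_space measure"
  assumes "\<mu> \<in> P1"
  shows "ennreal (W1 \<mu> (return borel 0)) \<le> (\<integral>\<^sup>+x. ennreal (norm x) \<partial>\<mu>)"
proof -
  note \<mu> = P1D[OF assms]
  interpret prob_space \<mu> by fact
  have 1: "distr \<mu> borel (\<lambda>x. x) = \<mu>" by (rule distr_id2) (simp add: \<mu>)
  have 2: "distr \<mu> borel (\<lambda>x. 0) = return borel 0"
    by (rule measure_eqI) (auto simp: emeasure_distr emeasure_space_1 split: split_indicator)
  have "ennreal (W1 (distr \<mu> borel (\<lambda>x. x)) (distr \<mu> borel (\<lambda>x. 0))) \<le> (\<integral>\<^sup>+w. ennreal (dist w 0) \<partial>\<mu>)"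
    by (rule W1_distr_le) (auto simp: measurable_cong_sets[OF \<mu>(2) refl] prob_space_axioms)
  then show ?thesis by (simp add: 1 2)
qed

lemma W1_empirical_return_le:
  fixes x :: "nat \<Rightarrow> 'a::euclidean_space"
  assumes "1 \<le> N"
  shows "W1 (empirical N x) (return borel 0) \<le> (\<Sum>i=1..N. norm (x i)) / N"
proof -
  have "ennreal (W1 (empirical N x) (return borel 0)) \<le> (\<Sum>i=1..N. ennreal (1 / N) * ennreal (norm (x i)))"
    using W1_return_le[OF empirical_in_P1[OF assms], of x] by (simp add: nn_integral_empirical[OF assms])
  also have "\<dots> = ennreal ((\<Sum>i=1..N. norm (x i)) / N)"
    by (simp add: ennreal_mult[symmetric] sum_divide_distrib)
  finally show ?thesis by (simp add: ennreal_le_iff sum_nonneg)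
qed

lemma W1_empirical_le:
  fixes x y :: "nat \<Rightarrow> 'a::euclidean_space"
  assumes "1 \<le> N"
  shows "W1 (empirical N x) (empirical N y) \<le> (\<Sum>i=1..N. dist (x i) (y i)) / N"
proof -
  have "ennreal (W1 (empirical N x) (empirical N y)) \<le> (\<integral>\<^sup>+i. ennreal (dist (x i) (y i)) \<partial>uniform_count_measure {1..N})"
    unfolding empirical_def
    by (rule W1_distr_le, rule prob_space_uniform_count_measure) (use assms in \<open>auto simp: uniform_count_measure_def\<close>)
  also have "\<dots> = ennreal ((\<Sum>i=1..N. dist (x i) (y i)) / N)"
    by (simp add: uniform_count_measure_def nn_integral_point_measure_finite ennreal_mult[symmetric] sum_divide_distrib)
  finally show ?thesis by (simp add: ennreal_le_iff sum_nonneg)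
qed

text \<open>The triangle inequality and \<open>W1_empirical_le\<close> make the distance continuous
  in the finitely many positions, hence Borel. It serves the event about the initial error.\<close>

lemma W1_empirical_measurable:
  fixes X :: "nat \<Rightarrow> 'w \<Rightarrow> 'a::euclidean_space"
  assumes N: "1 \<le> N" and \<mu>: "\<mu> \<in> P1" and X: "\<And>i. X i \<in> borel_measurable M"
  shows "(\<lambda>w. W1 (empirical N (\<lambda>i. X i w)) \<mu>) \<in> borel_measurable M"
proof -
  have "isCont (\<lambda>x. W1 (empirical N x) \<mu>) x" for x :: "nat \<Rightarrow> 'a"
    unfolding isCont_def
  proof (rule LIM_zero_cancel, rule Lim_null_comparison[where g="\<lambda>y. (\<Sum>i=1..N. dist (y i) (x i)) / N"])
    show "\<forall>\<^sub>F y in at x. norm (W1 (empirical N y) \<mu> - W1 (empirical N x) \<mu>) \<le> (\<Sum>i = 1..N. dist (y i) (x i)) / real N"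
    proof (rule always_eventually, rule allI)
      fix y :: "nat \<Rightarrow> 'a"
      note e = empirical_in_P1[OF N]
      show "norm (W1 (empirical N y) \<mu> - W1 (empirical N x) \<mu>) \<le> (\<Sum>i = 1..N. dist (y i) (x i)) / real N"
        using W1_triangle[OF e[of x] e[of y] \<mu>] W1_triangle[OF e[of y] e[of x] \<mu>]
          W1_empirical_le[OF N, of x y] W1_empirical_le[OF N, of y x] by (simp add: dist_commute)
    qed
    have "((\<lambda>y. y i) \<longlongrightarrow> x i) (at x)" for i
      using continuous_on_product_coordinates[of i] unfolding continuous_on_def by blast
    then have "((\<lambda>y. (\<Sum>i = 1..N. dist (y i) (x i)) / real N) \<longlongrightarrow> (\<Sum>i = 1..N. dist (x i) (x i)) / real N) (at x)"
      by (intro tendsto_intros) (use N in auto)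
    then show "((\<lambda>y. (\<Sum>i = 1..N. dist (y i) (x i)) / real N) \<longlongrightarrow> 0) (at x)" by simp
  qed
  then have "continuous_on UNIV (\<lambda>x. W1 (empirical N x) \<mu>)" by (simp add: continuous_at_imp_continuous_on)
  then have c: "(\<lambda>x. W1 (empirical N x) \<mu>) \<in> borel_measurable borel" by (rule borel_measurable_continuous_onI)
  have "(\<lambda>w i. X i w) \<in> M \<rightarrow>\<^sub>M borel" by (rule measurable_coordinatewise_then_product[OF X])
  from measurable_compose[OF this c] show ?thesis .
qed

text \<open>The cutoffs \<open>\<phi> k\<close> are \<open>k\<close>-Lipschitz and decrease to the
  indicator of \<open>F\<close>. A coupling of arbitrarily small cost moves the integral of each
  cutoff from \<mu> to \<nu> with arbitrarily small loss; then \<open>k\<close> tends to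
  infinity.\<close>

lemma W1_eq_0_emeasure_le:
  fixes \<mu> \<nu> :: "'a::euclidean_space measure"
  assumes "\<mu> \<in> P1" "\<nu> \<in> P1" "W1 \<mu> \<nu> = 0" and F: "closed F" "F \<noteq> {}"
  shows "emeasure \<mu> F \<le> emeasure \<nu> F"
proof -
  note \<mu> = P1D[OF assms(1)] and \<nu> = P1D[OF assms(2)]
  interpret V: prob_space \<nu> by fact
  note [measurable_cong] = \<mu>(2) \<nu>(2)
  have [measurable]: "F \<in> sets borel" using F by auto
  define \<phi> where "\<phi> k x = max 0 (1 - real k * infdist x F)" for k x
  have [measurable]: "\<phi> k \<in> borel_measurable borel" for k unfolding \<phi>_def
    by (intro borel_measurable_continuous_onI continuous_intros)
  have \<phi>0[simp]: "0 \<le> \<phi> k x" for k x by (simp add: \<phi>_def)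
  have lip: "\<phi> k x \<le> \<phi> k y + real k * dist x y" for k x y
  proof -
    have "infdist y F \<le> infdist x F + dist x y"
      using infdist_triangle[of y F x] by (simp add: dist_commute)
    then have "real k * infdist y F \<le> real k * infdist x F + real k * dist x y"
      by (metis distrib_left mult_left_mono of_nat_0_le_iff)
    then show ?thesis unfolding \<phi>_def by (smt (verit) mult_nonneg_nonneg of_nat_0_le_iff zero_le_dist)
  qed
  have "emeasure \<mu> F \<le> (\<integral>\<^sup>+x. ennreal (\<phi> k x) \<partial>\<nu>)" for k
  proof (rule ennreal_le_epsilon)
    fix e :: real assume "e > 0"
    \<comment> \<open>The added 1 covers \<open>k = 0\<close>; the loss \<open>k * e'\<close> stays
      below \<open>e\<close>.\<close>
    define e' where "e' = e / (real k + 1)"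
    have "e' > 0" using \<open>e > 0\<close> by (simp add: e'_def)
    then obtain \<pi> where \<pi>: "\<pi> \<in> couplings \<mu> \<nu>" "cost \<pi> \<le> ennreal (W1 \<mu> \<nu> + e')"
      using coupling_approx[OF assms(1,2)] by blast
    note [measurable] = couplings_measurable[OF \<pi>(1)]
    have "emeasure \<mu> F = (\<integral>\<^sup>+x. indicator F x \<partial>\<mu>)" by simp
    also have "\<dots> \<le> (\<integral>\<^sup>+x. ennreal (\<phi> k x) \<partial>\<mu>)"
      by (intro nn_integral_mono) (auto simp: \<phi>_def split: split_indicator)
    also have "\<dots> = (\<integral>\<^sup>+p. ennreal (\<phi> k (fst p)) \<partial>\<pi>)"
      by (rule couplings_nn_integral(1)[OF \<pi>(1), symmetric]) auto
    also have "\<dots> \<le> (\<integral>\<^sup>+p. ennreal (\<phi> k (snd p)) + ennreal (real k) * ennreal (dist (fst p) (snd p)) \<partial>\<pi>)"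
      using lip by (intro nn_integral_mono) (auto simp: ennreal_mult[symmetric] ennreal_plus[symmetric] simp del: ennreal_plus)
    also have "\<dots> = (\<integral>\<^sup>+p. ennreal (\<phi> k (snd p)) \<partial>\<pi>) + ennreal (real k) * cost \<pi>"
      by (subst nn_integral_add) (auto simp: nn_integral_cmult)
    also have "(\<integral>\<^sup>+p. ennreal (\<phi> k (snd p)) \<partial>\<pi>) = (\<integral>\<^sup>+x. ennreal (\<phi> k x) \<partial>\<nu>)"
      by (rule couplings_nn_integral(2)[OF \<pi>(1)]) auto
    also have "ennreal (real k) * cost \<pi> \<le> ennreal (real k) * ennreal e'"
      using \<pi>(2) assms(3) by (intro mult_left_mono) auto
    also have "ennreal (real k) * ennreal e' \<le> ennreal e"
      using \<open>e > 0\<close> by (auto simp: ennreal_mult[symmetric] e'_def field_simps)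
    finally show "emeasure \<mu> F \<le> (\<integral>\<^sup>+x. ennreal (\<phi> k x) \<partial>\<nu>) + ennreal e" by (simp add: add_left_mono)
  qed
  moreover have "(\<lambda>k. \<integral>\<^sup>+x. ennreal (\<phi> k x) \<partial>\<nu>) \<longlonglongrightarrow> (\<integral>\<^sup>+x. indicator F x \<partial>\<nu>)"
  proof (rule nn_integral_dominated_convergence[where w="\<lambda>_. 1"])
    show "AE x in \<nu>. (\<lambda>k. ennreal (\<phi> k x)) \<longlonglongrightarrow> indicator F x"
    proof (rule AE_I2)
      fix x
      show "(\<lambda>k. ennreal (\<phi> k x)) \<longlonglongrightarrow> indicator F x"
      proof (cases "x \<in> F")
        case True
        then show ?thesis by (simp add: \<phi>_def infdist_zero)
      next
        case False
        then have "infdist x F > 0" using F infdist_pos_not_in_closed by blast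
        then obtain k0 where k0: "1 < real k0 * infdist x F" using reals_Archimedean3 by blast
        have "\<forall>\<^sub>F k in sequentially. ennreal (\<phi> k x) = indicator F x"
          using eventually_ge_at_top[of k0]
        proof eventually_elim
          case (elim k)
          have "real k0 * infdist x F \<le> real k * infdist x F"
            using elim infdist_nonneg by (intro mult_right_mono) auto
          then show ?case using k0 False by (simp add: \<phi>_def)
        qed
        then show ?thesis by (rule tendsto_eventually)
      qed
    qed
    show "AE x in \<nu>. ennreal (\<phi> k x) \<le> 1" for k
      by (rule AE_I2) (simp add: \<phi>_def infdist_nonneg)
  qed (auto simp: V.emeasure_space_1)
  ultimately have "emeasure \<mu> F \<le> (\<integral>\<^sup>+x. indicator F x \<partial>\<nu>)"
    by (intro tendsto_lowerbound[of _ _ sequentially]) auto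
  then show ?thesis by simp
qed

lemma W1_eq_0:
  fixes \<mu> \<nu> :: "'a::euclidean_space measure"
  assumes "\<mu> \<in> P1" "\<nu> \<in> P1" "W1 \<mu> \<nu> = 0"
  shows "\<mu> = \<nu>"
proof (rule measure_eqI_generator_eq[where E="Collect closed" and \<Omega>=UNIV and A="\<lambda>_. UNIV"])
  show "Int_stable (Collect closed :: 'a set set)" by (auto simp: Int_stable_def)
  show "emeasure \<mu> F = emeasure \<nu> F" if "F \<in> Collect closed" for F
    using W1_eq_0_emeasure_le[OF assms, of F] W1_eq_0_emeasure_le[OF assms(2,1), of F]
      W1_commute[OF assms(1,2)] assms(3) that
    by (cases "F = {}") (auto intro!: antisym)
  show "emeasure \<mu> UNIV \<noteq> \<infinity>"
    using prob_space.emeasure_space_1[OF P1D(1)[OF assms(1)]] sets_eq_imp_space_eq[OF P1D(2)[OF assms(1)]] by simp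
qed (use assms in \<open>auto simp: P1D borel_eq_closed\<close>)

text \<open>The supremum in \<open>Dlip\<close> divides by the distance of the arguments, and a
  quotient by zero is 0. Definiteness of \<open>W1\<close> on \<open>P1\<close> rules out distinct
  arguments at distance zero, where the supremum would say nothing.\<close>

lemma norm_le_Dlip:
  fixes f :: "'a::euclidean_space \<Rightarrow> 'a measure \<Rightarrow> 'b \<Rightarrow> 'a"
  assumes "\<mu>1 \<in> P1" "\<mu>2 \<in> P1"
  shows "ennreal (norm (f x1 \<mu>1 z - f x2 \<mu>2 z)) \<le> Dlip f z * ennreal (dist x1 x2 + W1 \<mu>1 \<mu>2)"
proof (cases "(x1, \<mu>1) = (x2, \<mu>2)")
  case False
  define s where "s = dist x1 x2 + W1 \<mu>1 \<mu>2"
  have "s \<noteq> 0"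
  proof
    assume "s = 0"
    then have "dist x1 x2 = 0" "W1 \<mu>1 \<mu>2 = 0"
      unfolding s_def using zero_le_dist[of x1 x2] W1_nonneg[of \<mu>1 \<mu>2] by linarith+
    with W1_eq_0[OF assms] False show False by auto
  qed
  then have s: "s > 0" unfolding s_def using zero_le_dist[of x1 x2] W1_nonneg[of \<mu>1 \<mu>2] by linarith
  have "ennreal (norm (f x1 \<mu>1 z - f x2 \<mu>2 z) / s) \<le> Dlip f z"
    unfolding Dlip_def by (rule SUP_upper2[of "((x1, \<mu>1), (x2, \<mu>2))"]) (use False assms in \<open>auto simp: s_def\<close>)
  then have "ennreal (norm (f x1 \<mu>1 z - f x2 \<mu>2 z) / s) * ennreal s \<le> Dlip f z * ennreal s"
    by (rule mult_right_mono) simp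
  then show ?thesis using s 
    by (simp add: ennreal_mult[symmetric] s_def[symmetric] del: ennreal_plus)
qed auto

section \<open>Transport between two measures by cells\<close>

text \<open>On each cell the smaller of the two masses is transported within the cell; what is left over on
  either side is coupled independently and paid for through the origin.\<close>
lemma W1_le_cells:
  fixes \<mu> \<nu> :: "'a::euclidean_space measure"
  assumes P: "\<mu> \<in> P1" "\<nu> \<in> P1" and J: "finite J" "disjoint_family_on B J"
    and B: "\<And>j. j \<in> J \<Longrightarrow> B j \<in> sets borel"
    and h: "0 \<le> h" "\<And>j x y. j \<in> J \<Longrightarrow> x \<in> B j \<Longrightarrow> y \<in> B j \<Longrightarrow> dist x y \<le> h"
    and R: "0 \<le> R" "\<And>j x. j \<in> J \<Longrightarrow> x \<in> B j \<Longrightarrow> norm x \<le> R"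
  shows "ennreal (W1 \<mu> \<nu>) \<le> ennreal (h + R * (\<Sum>j\<in>J. \<bar>measure \<mu> (B j) - measure \<nu> (B j)\<bar>))
      + (\<integral>\<^sup>+x. ennreal (norm x) * indicator (- (\<Union>j\<in>J. B j)) x \<partial>\<mu>)
      + (\<integral>\<^sup>+x. ennreal (norm x) * indicator (- (\<Union>j\<in>J. B j)) x \<partial>\<nu>)"
proof -
  note \<mu> = P1D[OF P(1)] and \<nu> = P1D[OF P(2)]
  interpret M: prob_space \<mu> by fact
  interpret N: prob_space \<nu> by fact
  interpret MN: pair_prob_space \<mu> \<nu> ..
  note [measurable_cong] = \<mu>(2) \<nu>(2)
  note [measurable] = B
  define U where "U = - (\<Union>j\<in>J. B j)"
  have U[measurable]: "U \<in> sets borel"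
    unfolding U_def using J(1) B by (intro borel_comp sets.finite_UN) auto
  define m where "m j = min (measure \<mu> (B j)) (measure \<nu> (B j))" for j
  define \<kappa> where "\<kappa> = (\<Sum>j\<in>J. m j)"
  define kept where "kept = (\<lambda>\<mu> :: 'a measure. \<lambda>x. \<Sum>j\<in>J. m j / measure \<mu> (B j) * indicator (B j) x)"
  have m0: "0 \<le> m j" for j by (simp add: m_def)
  \<comment> \<open>A cell without mass has \<open>m j = 0\<close>, so the quotient by zero does no
    harm.\<close>
  have mp: "m j / measure \<mu> (B j) * measure \<mu> (B j) = m j" "m j / measure \<nu> (B j) * measure \<nu> (B j) = m j" for j
    by (auto simp: m_def min_def dest: measure_le_0_iff[THEN iffD1])
  have kept_on: "kept \<rho> x = m j / measure \<rho> (B j)" if "j \<in> J" "x \<in> B j" for \<rho> j x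
  proof -
    have eq: "i = j" if "i \<in> J" "x \<in> B i" for i
      using J(2) \<open>j \<in> J\<close> \<open>x \<in> B j\<close> that unfolding disjoint_family_on_def by blast
    have "kept \<rho> x = (\<Sum>i\<in>J. if i = j then m j / measure \<rho> (B j) else 0)"
      unfolding kept_def
    proof (rule sum.cong[OF refl])
      fix i assume "i \<in> J"
      then show "m i / measure \<rho> (B i) * indicator (B i) x = (if i = j then m j / measure \<rho> (B j) else 0)"
        using eq[of i] \<open>x \<in> B j\<close> by (cases "x \<in> B i") auto
    qed
    then show ?thesis using J(1) that by simp
  qed
  have kept_U: "kept \<rho> x = 0" if "x \<in> U" for \<rho> x
    unfolding kept_def using that by (intro sum.neutral) (auto simp: U_def)
  have kept0: "0 \<le> kept \<rho> x" for \<rho> x unfolding kept_def using m0 by (intro sum_nonneg mult_nonneg_nonneg) auto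
  have kept1: "kept \<rho> x \<le> 1" if \<rho>: "\<rho> = \<mu> \<or> \<rho> = \<nu>" for \<rho> x
  proof (cases "x \<in> U")
    case False
    then obtain j where j: "j \<in> J" "x \<in> B j" by (auto simp: U_def)
    have "m j / measure \<rho> (B j) \<le> 1" using \<rho> by (auto simp: m_def divide_le_eq_1 zero_less_measure_iff)
    then show ?thesis using kept_on[OF j] by simp
  qed (simp add: kept_U)
  have kept_meas[measurable]: "kept \<rho> \<in> borel_measurable borel" for \<rho> unfolding kept_def by measurable
  have kept_int: "integrable \<rho> (kept \<rho>')" "(\<integral>x. kept \<rho> x \<partial>\<rho>) = \<kappa>"
    if "\<rho> = \<mu> \<or> \<rho> = \<nu>" "\<rho>' = \<mu> \<or> \<rho>' = \<nu>" for \<rho> \<rho>'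
  proof -
    have r: "finite_measure \<rho>" "sets \<rho> = sets borel" using that \<mu>(2) \<nu>(2) by (auto intro: M.finite_measure_axioms N.finite_measure_axioms)
    have i: "integrable \<rho> (indicator (B j) :: 'a \<Rightarrow> real)" if "j \<in> J" for j
      using r B[OF that] finite_measure.emeasure_finite[OF r(1)] by (intro integrable_real_indicator) (auto simp: less_top[symmetric])
    show "integrable \<rho> (kept \<rho>')" unfolding kept_def using i by (intro Bochner_Integration.integrable_sum integrable_mult_right) auto
    have "(\<integral>x. kept \<rho> x \<partial>\<rho>) = (\<Sum>j\<in>J. m j / measure \<rho> (B j) * measure \<rho> (B j))"
      unfolding kept_def using i r(2) B sets_eq_imp_space_eq[OF r(2)]
      by (subst Bochner_Integration.integral_sum) (auto intro!: integrable_mult_right sum.cong)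
    then show "(\<integral>x. kept \<rho> x \<partial>\<rho>) = \<kappa>" using that(1) mp by (auto simp: \<kappa>_def)
  qed
  have \<kappa>1: "0 \<le> \<kappa>" "\<kappa> \<le> 1"
  proof -
    show "0 \<le> \<kappa>" unfolding \<kappa>_def by (intro sum_nonneg m0)
    have "(\<integral>x. kept \<mu> x \<partial>\<mu>) \<le> (\<integral>x. 1 \<partial>\<mu>)" by (rule integral_mono) (auto simp: kept_int kept1)
    then show "\<kappa> \<le> 1" using kept_int(2)[of \<mu> \<mu>] M.prob_space by simp
  qed
  define g1 :: "'a \<times> 'a \<Rightarrow> real" where
    "g1 = (\<lambda>(x, y). \<Sum>j\<in>J. m j / (measure \<mu> (B j) * measure \<nu> (B j)) * (indicator (B j) x * indicator (B j) y))"
  \<comment> \<open>Both leftovers have mass \<open>1 - \<kappa>\<close>, so their product is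
    divided by it once. Here \<kappa> is the total kept mass.\<close>
  define g2 :: "'a \<times> 'a \<Rightarrow> real" where "g2 = (\<lambda>(x, y). (1 - kept \<mu> x) * (1 - kept \<nu> y) / (1 - \<kappa>))"
  have g1_0: "0 \<le> g1 p" for p unfolding g1_def using m0
    by (cases p) (auto intro!: sum_nonneg mult_nonneg_nonneg divide_nonneg_nonneg)
  have g2_0: "0 \<le> g2 p" for p unfolding g2_def using kept1 \<kappa>1
    by (cases p) (auto intro!: divide_nonneg_nonneg mult_nonneg_nonneg)
  have [measurable]: "g1 \<in> borel_measurable (\<mu> \<Otimes>\<^sub>M \<nu>)" unfolding g1_def by measurable
  have [measurable]: "g2 \<in> borel_measurable (\<mu> \<Otimes>\<^sub>M \<nu>)" unfolding g2_def by measurable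
  have [measurable]: "(\<lambda>y. g1 (x, y)) \<in> borel_measurable borel" "(\<lambda>y. g2 (x, y)) \<in> borel_measurable borel"
    "(\<lambda>y. g1 (y, x)) \<in> borel_measurable borel" "(\<lambda>y. g2 (y, x)) \<in> borel_measurable borel" for x
    unfolding g1_def g2_def prod.case by measurable
  \<comment> \<open>If everything is kept, the quotient is 0 by convention. The identity survives
    because the nonnegative function \<open>1 - kept \<rho>\<close> then has integral 0 and vanishes
    almost everywhere.\<close>
  have full: "AE x in \<rho>. (1 - kept \<rho> x) / (1 - \<kappa>) * (1 - \<kappa>) = 1 - kept \<rho> x" if r: "\<rho> = \<mu> \<or> \<rho> = \<nu>" for \<rho>
  proof (cases "\<kappa> = 1")
    case True
    have p: "prob_space \<rho>" using r \<mu> \<nu> by auto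
    have "(\<integral>x. 1 - kept \<rho> x \<partial>\<rho>) = 0" using kept_int[OF r r] True p
      by (simp add: finite_measure.integrable_const prob_space.finite_measure prob_space.prob_space)
    then have "AE x in \<rho>. 1 - kept \<rho> x = 0" using kept_int[OF r r] kept1[OF r] p
      by (subst integral_nonneg_eq_0_iff_AE[symmetric]) (auto simp: finite_measure.integrable_const prob_space.finite_measure)
    then show ?thesis by eventually_elim simp
  qed simp
  have i1: "(\<integral>\<^sup>+y. ennreal (g1 (x, y)) \<partial>\<nu>) = ennreal (kept \<mu> x)"
    and i2: "(\<integral>\<^sup>+y. ennreal (g2 (x, y)) \<partial>\<nu>) = ennreal ((1 - kept \<mu> x) / (1 - \<kappa>) * (1 - \<kappa>))" for x
  proof -
    have i: "integrable \<nu> (indicator (B j) :: 'a \<Rightarrow> real)" if "j \<in> J" for j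
      using B[OF that] \<nu>(2) N.emeasure_finite by (intro integrable_real_indicator) (auto simp: less_top[symmetric])
    have "(\<integral>\<^sup>+y. ennreal (g1 (x, y)) \<partial>\<nu>) = ennreal (\<integral>y. g1 (x, y) \<partial>\<nu>)"
      using g1_0 i unfolding g1_def
      by (intro nn_integral_eq_integral) (auto intro!: Bochner_Integration.integrable_sum integrable_mult_right)
    also have "(\<integral>y. g1 (x, y) \<partial>\<nu>) = (\<Sum>j\<in>J. m j / (measure \<mu> (B j) * measure \<nu> (B j)) * (indicator (B j) x * measure \<nu> (B j)))"
      unfolding g1_def prod.case using i \<nu>(2) B sets_eq_imp_space_eq[OF \<nu>(2)]
      by (subst Bochner_Integration.integral_sum) (auto intro!: integrable_mult_right sum.cong)
    also have "\<dots> = kept \<mu> x" unfolding kept_def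
    proof (intro sum.cong refl)
      fix j
      have "m j / (measure \<mu> (B j) * measure \<nu> (B j)) * (indicator (B j) x * measure \<nu> (B j))
        = (m j / measure \<nu> (B j) * measure \<nu> (B j)) / measure \<mu> (B j) * indicator (B j) x" by simp
      then show "m j / (measure \<mu> (B j) * measure \<nu> (B j)) * (indicator (B j) x * measure \<nu> (B j)) = m j / measure \<mu> (B j) * indicator (B j) x"
        unfolding mp .
    qed
    finally show "(\<integral>\<^sup>+y. ennreal (g1 (x, y)) \<partial>\<nu>) = ennreal (kept \<mu> x)" .
    have "(\<integral>\<^sup>+y. ennreal (g2 (x, y)) \<partial>\<nu>) = ennreal (\<integral>y. (1 - kept \<mu> x) / (1 - \<kappa>) * (1 - kept \<nu> y) \<partial>\<nu>)"
      using g2_0 kept_int(1)[of \<nu> \<nu>] unfolding g2_def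
      by (subst nn_integral_eq_integral) (auto simp: field_simps)
    also have "(\<integral>y. (1 - kept \<mu> x) / (1 - \<kappa>) * (1 - kept \<nu> y) \<partial>\<nu>) = (1 - kept \<mu> x) / (1 - \<kappa>) * (1 - \<kappa>)"
      using kept_int[of \<nu> \<nu>] by (simp add: N.prob_space)
    finally show "(\<integral>\<^sup>+y. ennreal (g2 (x, y)) \<partial>\<nu>) = ennreal ((1 - kept \<mu> x) / (1 - \<kappa>) * (1 - \<kappa>))" .
  qed
  have j1: "(\<integral>\<^sup>+x. ennreal (g1 (x, y)) \<partial>\<mu>) = ennreal (kept \<nu> y)"
    and j2: "(\<integral>\<^sup>+x. ennreal (g2 (x, y)) \<partial>\<mu>) = ennreal ((1 - kept \<nu> y) / (1 - \<kappa>) * (1 - \<kappa>))" for y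
  proof -
    have i: "integrable \<mu> (indicator (B j) :: 'a \<Rightarrow> real)" if "j \<in> J" for j
      using B[OF that] \<mu>(2) M.emeasure_finite by (intro integrable_real_indicator) (auto simp: less_top[symmetric])
    have "(\<integral>\<^sup>+x. ennreal (g1 (x, y)) \<partial>\<mu>) = ennreal (\<integral>x. g1 (x, y) \<partial>\<mu>)"
      using g1_0 i unfolding g1_def
      by (intro nn_integral_eq_integral) (auto intro!: Bochner_Integration.integrable_sum integrable_mult_right)
    also have "(\<integral>x. g1 (x, y) \<partial>\<mu>) = (\<Sum>j\<in>J. m j / (measure \<mu> (B j) * measure \<nu> (B j)) * (measure \<mu> (B j) * indicator (B j) y))"
      unfolding g1_def prod.case using i \<mu>(2) B sets_eq_imp_space_eq[OF \<mu>(2)]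
      by (subst Bochner_Integration.integral_sum) (auto intro!: integrable_mult_right sum.cong)
    also have "\<dots> = kept \<nu> y" unfolding kept_def
    proof (intro sum.cong refl)
      fix j
      have "m j / (measure \<mu> (B j) * measure \<nu> (B j)) * (measure \<mu> (B j) * indicator (B j) y)
        = (m j / measure \<mu> (B j) * measure \<mu> (B j)) / measure \<nu> (B j) * indicator (B j) y" by simp
      then show "m j / (measure \<mu> (B j) * measure \<nu> (B j)) * (measure \<mu> (B j) * indicator (B j) y) = m j / measure \<nu> (B j) * indicator (B j) y"
        unfolding mp .
    qed
    finally show "(\<integral>\<^sup>+x. ennreal (g1 (x, y)) \<partial>\<mu>) = ennreal (kept \<nu> y)" .
    have "(\<integral>\<^sup>+x. ennreal (g2 (x, y)) \<partial>\<mu>) = ennreal (\<integral>x. (1 - kept \<nu> y) / (1 - \<kappa>) * (1 - kept \<mu> x) \<partial>\<mu>)"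
      using g2_0 kept_int(1)[of \<mu> \<mu>] unfolding g2_def
      by (subst nn_integral_eq_integral) (auto simp: field_simps)
    also have "(\<integral>x. (1 - kept \<nu> y) / (1 - \<kappa>) * (1 - kept \<mu> x) \<partial>\<mu>) = (1 - kept \<nu> y) / (1 - \<kappa>) * (1 - \<kappa>)"
      using kept_int[of \<mu> \<mu>] by (simp add: M.prob_space)
    finally show "(\<integral>\<^sup>+x. ennreal (g2 (x, y)) \<partial>\<mu>) = ennreal ((1 - kept \<nu> y) / (1 - \<kappa>) * (1 - \<kappa>))" .
  qed
  define D where "D = density (\<mu> \<Otimes>\<^sub>M \<nu>) (\<lambda>p. ennreal (g1 p) + ennreal (g2 p))"
  have "D \<in> couplings \<mu> \<nu>" unfolding D_def
  proof (rule coupling_of_density[OF P])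
    show "AE x in \<mu>. (\<integral>\<^sup>+ y. ennreal (g1 (x, y)) + ennreal (g2 (x, y)) \<partial>\<nu>) = 1"
      using full[of \<mu>, simplified]
    proof eventually_elim
      case (elim x)
      then show ?case using kept0[of \<mu> x] kept1[of \<mu> x]
        by (subst nn_integral_add) (auto simp: i1 i2 ennreal_plus[symmetric] simp del: ennreal_plus)
    qed
    show "AE y in \<nu>. (\<integral>\<^sup>+ x. ennreal (g1 (x, y)) + ennreal (g2 (x, y)) \<partial>\<mu>) = 1"
      using full[of \<nu>, simplified]
    proof eventually_elim
      case (elim y)
      then show ?case using kept0[of \<nu> y] kept1[of \<nu> y]
        by (subst nn_integral_add) (auto simp: j1 j2 ennreal_plus[symmetric] simp del: ennreal_plus)
    qed
  qed auto
  note W1_le_cost[OF this]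
  also have "cost D
      = (\<integral>\<^sup>+ p. (ennreal (g1 p) + ennreal (g2 p)) * ennreal (dist (fst p) (snd p)) \<partial>(\<mu> \<Otimes>\<^sub>M \<nu>))"
    unfolding D_def by (subst nn_integral_density) auto
  also have "\<dots> \<le> (\<integral>\<^sup>+ p. ennreal h * ennreal (g1 p) + (ennreal (norm (fst p)) * ennreal (g2 p) + ennreal (norm (snd p)) * ennreal (g2 p)) \<partial>(\<mu> \<Otimes>\<^sub>M \<nu>))"
  proof (rule nn_integral_mono)
    fix p :: "'a \<times> 'a"
    obtain x y where p: "p = (x, y)" by force
    have "g1 p * dist x y \<le> g1 p * h"
    proof (cases "g1 p = 0")
      case False
      then obtain j where "j \<in> J" "x \<in> B j" "y \<in> B j"
        unfolding g1_def p by (auto simp: indicator_def split: if_splits elim!: sum.not_neutral_contains_not_neutral)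
      then show ?thesis using h(2) g1_0 by (intro mult_left_mono) auto
    qed simp
    moreover have "g2 p * dist x y \<le> g2 p * (norm x + norm y)"
      using g2_0 norm_triangle_ineq4[of x y] by (intro mult_left_mono) (auto simp: dist_norm)
    ultimately have "(g1 p + g2 p) * dist x y \<le> h * g1 p + (norm x * g2 p + norm y * g2 p)"
      by (simp add: algebra_simps)
    then show "(ennreal (g1 p) + ennreal (g2 p)) * ennreal (dist (fst p) (snd p)) \<le> ennreal h * ennreal (g1 p) + (ennreal (norm (fst p)) * ennreal (g2 p) + ennreal (norm (snd p)) * ennreal (g2 p))"
      using g1_0 g2_0 h(1) by (simp add: p ennreal_plus[symmetric] ennreal_mult[symmetric] del: ennreal_plus)
  qed
  also have "\<dots> = ennreal h * (\<integral>\<^sup>+ p. ennreal (g1 p) \<partial>(\<mu> \<Otimes>\<^sub>M \<nu>))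
      + ((\<integral>\<^sup>+ p. ennreal (norm (fst p)) * ennreal (g2 p) \<partial>(\<mu> \<Otimes>\<^sub>M \<nu>)) + (\<integral>\<^sup>+ p. ennreal (norm (snd p)) * ennreal (g2 p) \<partial>(\<mu> \<Otimes>\<^sub>M \<nu>)))"
    by (simp add: nn_integral_add nn_integral_cmult)
  also have "(\<integral>\<^sup>+ p. ennreal (g1 p) \<partial>(\<mu> \<Otimes>\<^sub>M \<nu>)) = (\<integral>\<^sup>+ x. ennreal (kept \<mu> x) \<partial>\<mu>)"
    by (subst N.nn_integral_fst[symmetric]) (auto simp: i1)
  also have "(\<integral>\<^sup>+ x. ennreal (kept \<mu> x) \<partial>\<mu>) \<le> (\<integral>\<^sup>+ x. 1 \<partial>\<mu>)" by (intro nn_integral_mono) (simp add: kept1)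
  also have "(\<integral>\<^sup>+ x. 1 \<partial>\<mu>) = 1" by (simp add: M.emeasure_space_1)
  also have "(\<integral>\<^sup>+ p. ennreal (norm (fst p)) * ennreal (g2 p) \<partial>(\<mu> \<Otimes>\<^sub>M \<nu>)) = (\<integral>\<^sup>+ x. ennreal (norm x * (1 - kept \<mu> x)) \<partial>\<mu>)"
  proof -
    have "(\<integral>\<^sup>+ p. ennreal (norm (fst p)) * ennreal (g2 p) \<partial>(\<mu> \<Otimes>\<^sub>M \<nu>)) = (\<integral>\<^sup>+ x. ennreal (norm x) * ennreal ((1 - kept \<mu> x) / (1 - \<kappa>) * (1 - \<kappa>)) \<partial>\<mu>)"
      by (subst N.nn_integral_fst[symmetric]) (auto simp: i2 nn_integral_cmult)
    also have "\<dots> = (\<integral>\<^sup>+ x. ennreal (norm x * (1 - kept \<mu> x)) \<partial>\<mu>)"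
    proof (rule nn_integral_cong_AE)
      show "AE x in \<mu>. ennreal (norm x) * ennreal ((1 - kept \<mu> x) / (1 - \<kappa>) * (1 - \<kappa>)) = ennreal (norm x * (1 - kept \<mu> x))"
        using full[of \<mu>, simplified] by eventually_elim (use kept1 in \<open>simp add: ennreal_mult\<close>)
    qed
    finally show ?thesis .
  qed
  also have "(\<integral>\<^sup>+ p. ennreal (norm (snd p)) * ennreal (g2 p) \<partial>(\<mu> \<Otimes>\<^sub>M \<nu>)) = (\<integral>\<^sup>+ x. ennreal (norm x * (1 - kept \<nu> x)) \<partial>\<nu>)"
  proof -
    have "(\<integral>\<^sup>+ p. ennreal (norm (snd p)) * ennreal (g2 p) \<partial>(\<mu> \<Otimes>\<^sub>M \<nu>)) = (\<integral>\<^sup>+ x. ennreal (norm x) * ennreal ((1 - kept \<nu> x) / (1 - \<kappa>) * (1 - \<kappa>)) \<partial>\<nu>)"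
      by (subst MN.nn_integral_snd[symmetric]) (auto simp: j2 nn_integral_cmult)
    also have "\<dots> = (\<integral>\<^sup>+ x. ennreal (norm x * (1 - kept \<nu> x)) \<partial>\<nu>)"
    proof (rule nn_integral_cong_AE)
      show "AE x in \<nu>. ennreal (norm x) * ennreal ((1 - kept \<nu> x) / (1 - \<kappa>) * (1 - \<kappa>)) = ennreal (norm x * (1 - kept \<nu> x))"
        using full[of \<nu>, simplified] by eventually_elim (use kept1 in \<open>simp add: ennreal_mult\<close>)
    qed
    finally show ?thesis .
  qed
  finally have main: "ennreal (W1 \<mu> \<nu>) \<le> ennreal h + ((\<integral>\<^sup>+ x. ennreal (norm x * (1 - kept \<mu> x)) \<partial>\<mu>) + (\<integral>\<^sup>+ x. ennreal (norm x * (1 - kept \<nu> x)) \<partial>\<nu>))"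
    by (simp add: mult_left_mono add_right_mono)
  \<comment> \<open>Inside the cube the leftover travels at most \<open>R\<close> to the origin;
    outside nothing is kept and the whole tail is paid. The losses of \<mu> and \<nu> on a cell add
    up to the absolute difference, since \<open>m j\<close> is the smaller mass.\<close>
  have rest: "(\<integral>\<^sup>+ x. ennreal (norm x * (1 - kept \<rho> x)) \<partial>\<rho>) \<le> ennreal (R * (\<Sum>j\<in>J. measure \<rho> (B j) - m j)) + (\<integral>\<^sup>+x. ennreal (norm x) * indicator U x \<partial>\<rho>)"
    if r: "\<rho> = \<mu> \<or> \<rho> = \<nu>" for \<rho>
  proof -
    have rs: "sets \<rho> = sets borel" "finite_measure \<rho>" using r \<mu> \<nu> by (auto intro: prob_space.finite_measure)
    note [measurable_cong] = rs(1)
    have pointwise: "norm x * (1 - kept \<rho> x) \<le> (\<Sum>j\<in>J. R * (1 - m j / measure \<rho> (B j)) * indicator (B j) x) + norm x * indicator U x"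
      for x
    proof (cases "x \<in> U")
      case True
      then have "(\<Sum>j\<in>J. R * (1 - m j / measure \<rho> (B j)) * indicator (B j) x) = 0"
        by (intro sum.neutral) (auto simp: U_def)
      then show ?thesis using True kept_U by simp
    next
      case False
      then obtain j where j: "j \<in> J" "x \<in> B j" by (auto simp: U_def)
      have eq: "i = j" if "i \<in> J" "x \<in> B i" for i
        using J(2) j that unfolding disjoint_family_on_def by blast
      have "(\<Sum>i\<in>J. R * (1 - m i / measure \<rho> (B i)) * indicator (B i) x) = (\<Sum>i\<in>J. if i = j then R * (1 - m j / measure \<rho> (B j)) else 0)"
      proof (rule sum.cong[OF refl])
        fix i assume "i \<in> J"
        then show "R * (1 - m i / measure \<rho> (B i)) * indicator (B i) x = (if i = j then R * (1 - m j / measure \<rho> (B j)) else 0)"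
          using eq[of i] j by (cases "x \<in> B i") auto
      qed
      also have "\<dots> = R * (1 - kept \<rho> x)" using j J(1) kept_on[OF j] by simp
      finally show ?thesis using R(2)[OF j] kept1[OF r, of x] False by (simp add: mult_right_mono)
    qed
    have nn: "0 \<le> R * (1 - m j / measure \<rho> (B j))" for j
    proof -
      have "m j / measure \<rho> (B j) \<le> 1" using r by (auto simp: m_def divide_le_eq_1 zero_less_measure_iff)
      then show ?thesis using R(1) by simp
    qed
    have "(\<integral>\<^sup>+ x. ennreal (norm x * (1 - kept \<rho> x)) \<partial>\<rho>) \<le> (\<integral>\<^sup>+ x. (\<Sum>j\<in>J. ennreal (R * (1 - m j / measure \<rho> (B j))) * indicator (B j) x) + ennreal (norm x) * indicator U x \<partial>\<rho>)"
    proof (rule nn_integral_mono)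
      fix x
      have "ennreal (norm x * (1 - kept \<rho> x)) \<le> ennreal ((\<Sum>j\<in>J. R * (1 - m j / measure \<rho> (B j)) * indicator (B j) x) + norm x * indicator U x)"
        using pointwise by (rule ennreal_leI)
      also have "\<dots> = (\<Sum>j\<in>J. ennreal (R * (1 - m j / measure \<rho> (B j)) * indicator (B j) x)) + ennreal (norm x * indicator U x)"
      proof -
        have "0 \<le> R * (1 - m j / measure \<rho> (B j)) * indicator (B j) x" for j
          by (intro mult_nonneg_nonneg[OF nn]) simp
        then show ?thesis by (simp only: ennreal_plus sum_nonneg mult_nonneg_nonneg norm_ge_zero indicator_pos_le sum_ennreal)
      qed
      also have "\<dots> = (\<Sum>j\<in>J. ennreal (R * (1 - m j / measure \<rho> (B j))) * indicator (B j) x) + ennreal (norm x) * indicator U x"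
        by (intro arg_cong2[where f="(+)"] sum.cong) (auto split: split_indicator)
      finally show "ennreal (norm x * (1 - kept \<rho> x)) \<le> (\<Sum>j\<in>J. ennreal (R * (1 - m j / measure \<rho> (B j))) * indicator (B j) x) + ennreal (norm x) * indicator U x" .
    qed
    also have "\<dots> = (\<Sum>j\<in>J. ennreal (R * (1 - m j / measure \<rho> (B j))) * emeasure \<rho> (B j)) + (\<integral>\<^sup>+x. ennreal (norm x) * indicator U x \<partial>\<rho>)"
      by (subst nn_integral_add, measurable, subst nn_integral_sum, measurable) (auto simp: nn_integral_cmult_indicator rs B cong: sum.cong)
    also have "(\<Sum>j\<in>J. ennreal (R * (1 - m j / measure \<rho> (B j))) * emeasure \<rho> (B j)) = (\<Sum>j\<in>J. ennreal (R * (measure \<rho> (B j) - m j)))"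
    proof (intro sum.cong refl)
      fix j
      have "R * (1 - m j / measure \<rho> (B j)) * measure \<rho> (B j) = R * (measure \<rho> (B j) - m j / measure \<rho> (B j) * measure \<rho> (B j))"
        by (simp add: algebra_simps)
      also have "m j / measure \<rho> (B j) * measure \<rho> (B j) = m j" using r mp[of j] by metis
      finally show "ennreal (R * (1 - m j / measure \<rho> (B j))) * emeasure \<rho> (B j) = ennreal (R * (measure \<rho> (B j) - m j))"
        by (simp only: finite_measure.emeasure_eq_measure[OF rs(2)] ennreal_mult[OF nn measure_nonneg, symmetric])
    qed
    also have "\<dots> = ennreal (R * (\<Sum>j\<in>J. measure \<rho> (B j) - m j))"
      using r R(1) by (subst sum_ennreal) (auto simp: m_def sum_distrib_left intro!: mult_nonneg_nonneg)
    finally show ?thesis .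
  qed
  have nnR: "0 \<le> R * (\<Sum>j\<in>J. measure \<rho> (B j) - m j)" if "\<rho> = \<mu> \<or> \<rho> = \<nu>" for \<rho>
    using that R(1) by (auto simp: m_def intro!: mult_nonneg_nonneg sum_nonneg)
  have "(\<Sum>j\<in>J. measure \<mu> (B j) - m j) + (\<Sum>j\<in>J. measure \<nu> (B j) - m j) = (\<Sum>j\<in>J. \<bar>measure \<mu> (B j) - measure \<nu> (B j)\<bar>)"
    unfolding sum.distrib[symmetric] by (intro sum.cong) (auto simp: m_def)
  then have eq: "ennreal h + (ennreal (R * (\<Sum>j\<in>J. measure \<mu> (B j) - m j)) + ennreal (R * (\<Sum>j\<in>J. measure \<nu> (B j) - m j)))
    = ennreal (h + R * (\<Sum>j\<in>J. \<bar>measure \<mu> (B j) - measure \<nu> (B j)\<bar>))"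
    using h(1) nnR mult_nonneg_nonneg[OF R(1) sum_nonneg[of J "\<lambda>j. \<bar>measure \<mu> (B j) - measure \<nu> (B j)\<bar>"]]
    by (simp add: ennreal_plus[symmetric] distrib_left[symmetric] del: ennreal_plus)
  show ?thesis
    unfolding U_def[symmetric] eq[symmetric]
    using order_trans[OF main add_left_mono[OF add_mono[OF rest[of \<mu>] rest[of \<nu>]]]]
    by (simp add: ac_simps)
qed

text \<open>Splitting \<open>J\<close> by the sign of the difference turns the sum into two
  discrepancies, each of a single union of cells. This is why unions of cells are controlled later
  and not single cells.\<close>

lemma sum_abs_diff_le:
  fixes \<mu> \<nu> :: "'a measure"
  assumes fin: "finite_measure \<mu>" "finite_measure \<nu>" and J: "finite J" "disjoint_family_on B J"
    and B: "\<And>j. j \<in> J \<Longrightarrow> B j \<in> sets \<mu>" "\<And>j. j \<in> J \<Longrightarrow> B j \<in> sets \<nu>"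
    and t: "\<And>S. S \<subseteq> J \<Longrightarrow> \<bar>measure \<mu> (\<Union>j\<in>S. B j) - measure \<nu> (\<Union>j\<in>S. B j)\<bar> \<le> t"
  shows "(\<Sum>j\<in>J. \<bar>measure \<mu> (B j) - measure \<nu> (B j)\<bar>) \<le> 2 * t"
proof -
  let ?d = "\<lambda>j. measure \<mu> (B j) - measure \<nu> (B j)"
  have U: "measure \<mu> (\<Union>j\<in>S. B j) - measure \<nu> (\<Union>j\<in>S. B j) = (\<Sum>j\<in>S. ?d j)" if "S \<subseteq> J" for S
  proof -
    have "finite S" "disjoint_family_on B S" using J that finite_subset disjoint_family_on_mono by blast+
    then show ?thesis using B that fin
      by (simp add: finite_measure.finite_measure_finite_Union subset_eq image_subset_iff sum_subtractf)
  qed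
  define S where "S = {j\<in>J. ?d j \<ge> 0}"
  have "(\<Sum>j\<in>J. \<bar>?d j\<bar>) = (\<Sum>j\<in>S. \<bar>?d j\<bar>) + (\<Sum>j\<in>J - S. \<bar>?d j\<bar>)"
    using J(1) by (simp add: S_def sum.subset_diff[of S J] add.commute)
  also have "(\<Sum>j\<in>S. \<bar>?d j\<bar>) = (\<Sum>j\<in>S. ?d j)" by (intro sum.cong) (auto simp: S_def)
  also have "\<dots> \<le> t" using t[of S] U[of S] by (auto simp: S_def)
  also have "(\<Sum>j\<in>J - S. \<bar>?d j\<bar>) = - (\<Sum>j\<in>J - S. ?d j)" unfolding sum_negf[symmetric] by (intro sum.cong) (auto simp: S_def)
  also have "\<dots> \<le> t" using t[of "J - S"] U[of "J - S"] by auto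
  finally show ?thesis by simp
qed

section \<open>Choice of the constants\<close>

text \<open>In \<open>dev_tail\<close>, \<open>B\<close> is \<open>a ^ d\<close>, a bound for the
  entropy, and \<open>L\<close> is the ratio of \<open>m\<close> to \<open>a\<close> at lag 0, which
  gives the Hoeffding exponent \<open>B / (2 * L\<^sup>2)\<close>. A small \<open>L\<close> lets
  Hoeffding win at every lag with room for the sum. The bound \<open>L \<le> 1/2\<close> keeps the
  \<open>2 * m\<close> cells per axis below \<open>a\<close>.\<close>

lemma exp_sum_le:
  fixes y :: real assumes y: "1 < y"
  obtains L where "0 < L" "L \<le> 1/2"
    "\<And>B n. 1 \<le> B \<Longrightarrow> (\<Sum>k<n. 2 * exp (B - B * (1 / (2 * L\<^sup>2)) * y ^ k)) \<le> exp (- B) / 2"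
proof -
  define \<eta> where "\<eta> = y - 1"
  have \<eta>: "\<eta> > 0" using y by (simp add: \<eta>_def)
  \<comment> \<open>In \<open>H - 1 = 4 + 1 / \<eta>\<close> the 4 provides the factor
    \<open>exp (- 4 * B)\<close>, while \<open>1 / \<eta>\<close> and Bernoulli's inequality for
    \<open>y ^ k\<close> provide the summable factor \<open>exp (- k)\<close>.\<close>
  define H where "H = 5 + 1 / \<eta>"
  have H: "H \<ge> 5" using \<eta> by (simp add: H_def)
  define L where "L = 1 / sqrt (2 * H)"
  have L0: "0 < L" using H by (simp add: L_def)
  have L2: "1 / (2 * L\<^sup>2) = H" using H by (simp add: L_def power_divide)
  have "2 \<le> sqrt (2 * H)" using H by (intro real_le_rsqrt) simp
  then have L1: "L \<le> 1/2" unfolding L_def using frac_le[of 1 1 2 "sqrt (2 * H)"] by simp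
  show thesis
  proof (rule that[OF L0 L1])
    fix B :: real and n :: nat assume B: "1 \<le> B"
    have tm: "2 * exp (B - B * H * y ^ k) \<le> 2 * exp (- 4 * B) * exp (- 1) ^ k" for k
    proof -
      have yk: "1 + real k * \<eta> \<le> y ^ k"
        using Bernoulli_inequality[of \<eta> k] \<eta> by (simp add: \<eta>_def)
      have "4 + real k \<le> (H - 1) * (1 + real k * \<eta>)"
      proof -
        have "(H - 1) * (1 + real k * \<eta>) = 4 + real k + (1 / \<eta> + 4 * (real k * \<eta>))"
          using \<eta> by (simp add: H_def field_simps)
        then show ?thesis using \<eta> by simp
      qed
      also have "\<dots> \<le> (H - 1) * y ^ k" using yk H by (intro mult_left_mono) auto
      also have "\<dots> \<le> H * y ^ k - 1"
        using one_le_power[of y k] y by (simp add: algebra_simps)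
      finally have "B * (4 + real k) \<le> B * (H * y ^ k - 1)" using B by (intro mult_left_mono) auto
      moreover have "real k \<le> B * real k" using B mult_right_mono[of 1 B "real k"] by simp
      ultimately have "B - B * H * y ^ k \<le> - 4 * B + real k * (- 1)" by (simp add: algebra_simps)
      then have "exp (B - B * H * y ^ k) \<le> exp (- 4 * B + real k * (- 1))" by simp
      also have "\<dots> = exp (- 4 * B) * exp (- 1) ^ k" unfolding exp_add exp_of_nat_mult ..
      finally show ?thesis by simp
    qed
    have e1: "exp (- 1) \<le> (1/2 :: real)" using exp_ge_add_one_self[of "1::real"] by (simp add: exp_minus field_simps)
    have "(\<Sum>k<n. 2 * exp (B - B * H * y ^ k)) \<le> (\<Sum>k<n. 2 * exp (- 4 * B) * (1/2) ^ k)"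
      by (intro sum_mono order_trans[OF tm] mult_left_mono power_mono e1) auto
    also have "\<dots> = 2 * exp (- 4 * B) * (\<Sum>k<n. (1/2) ^ k)" by (simp add: sum_distrib_left)
    also have "(\<Sum>k<n. (1/2) ^ k) = 2 - 2 * (1/2 :: real) ^ n" by (induction n) (auto simp: field_simps)
    then have "(\<Sum>k<n. (1/2) ^ k) \<le> (2 :: real)" by simp
    then have "2 * exp (- 4 * B) * (\<Sum>k<n. (1/2) ^ k) \<le> 2 * exp (- 4 * B) * 2" by (intro mult_left_mono) auto
    also have "\<dots> \<le> exp (- B) / 2"
    proof -
      have "exp (3 * B) = exp B ^ 3" by (simp add: exp_of_nat_mult[symmetric])
      moreover have "2 \<le> exp B" using exp_ge_add_one_self[of B] B by linarith
      then have "2 ^ 3 \<le> exp B ^ 3" by (intro power_mono) auto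
      ultimately have "8 \<le> exp (3 * B)" by simp
      then have "8 * exp (- 4 * B) \<le> exp (3 * B) * exp (- 4 * B)" by (intro mult_right_mono) auto
      also have "\<dots> = exp (- B)" by (simp add: exp_add[symmetric])
      finally show ?thesis by simp
    qed
    finally show "(\<Sum>k<n. 2 * exp (B - B * (1 / (2 * L\<^sup>2)) * y ^ k)) \<le> exp (- B) / 2"
      unfolding L2 .
  qed
qed

text \<open>Half of the exponent pays for the prefactor: a quarter of \<open>b * (e * a)\<close>
  dominates \<open>ln (1 / e)\<close>, by the logarithmic condition, and another quarter dominates
  \<open>ln (2 * Q)\<close>, by the lower bound on \<open>e * a\<close>.\<close>

lemma exp_absorb:
  fixes b Q e a \<nu> :: real
  assumes b: "0 < b" and Q: "0 < Q" and e: "0 < e" and \<nu>: "4 / b \<le> \<nu>" "16 * ln (2 * Q) / b \<le> \<nu>"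
    and 1: "\<nu> * logp (1 / e) \<le> e * a" and 2: "\<nu> / 4 \<le> e * a"
  shows "Q / e * exp (- b * (e * a)) \<le> exp (- (b / 2) * (e * a)) / 2"
proof -
  have "logp (1 / e) = b / 4 * (4 / b * logp (1 / e))" using b by simp
  also have "\<dots> \<le> b / 4 * (\<nu> * logp (1 / e))"
    using b \<nu>(1) by (intro mult_left_mono mult_right_mono) (auto simp: logp_def)
  also have "\<dots> \<le> b / 4 * (e * a)" using b 1 by (intro mult_left_mono) auto
  finally have A: "ln (1 / e) \<le> b / 4 * (e * a)" by (simp add: logp_def)
  have "ln (2 * Q) = b / 16 * (16 * ln (2 * Q) / b)" using b by simp
  also have "\<dots> \<le> b / 16 * \<nu>" using b \<nu>(2) by (intro mult_left_mono) auto
  also have "\<dots> \<le> b / 4 * (e * a)" using b mult_left_mono[OF 2, of "b / 4"] by simp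
  finally have "ln (2 * Q) + ln (1 / e) \<le> b / 2 * (e * a)" using A by simp
  then have "exp (ln (2 * Q) + ln (1 / e)) \<le> exp (b / 2 * (e * a))" by simp
  then have "2 * Q / e \<le> exp (b / 2 * (e * a))" using Q e by (simp add: exp_add)
  then have "2 * Q / e * exp (- b * (e * a)) \<le> exp (b / 2 * (e * a)) * exp (- b * (e * a))"
    by (intro mult_right_mono) auto
  also have "\<dots> = exp (- (b / 2) * (e * a))" by (simp add: exp_add[symmetric])
  finally show ?thesis by (simp add: mult_ac)
qed

text \<open>With \<open>a\<close> the root of \<open>N\<close>, the first term of the maximum says
  \<open>\<nu> * logp (1 / e) \<le> e * a\<close>, which feeds \<open>exp_absorb\<close>. For
  \<open>d > 1\<close> the second gives \<open>e \<le> a ^ (d - 1)\<close>, so that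
  \<open>exp (- (a ^ d))\<close> is below the claimed rate. For \<open>d = 1\<close> it gives
  \<open>a \<ge> \<nu>\<close>, and \<open>exp (- a)\<close> is compared with the rate capped at
  \<open>e = 1\<close>.\<close>

lemma rate_choice:
  fixes b Q :: real and d :: nat
  assumes b: "0 < b" and Q: "0 < Q"
  obtains N0 :: nat and C1 :: real where "0 < C1"
    "\<forall>e>0. \<forall>N\<ge>1. 1 < d \<longrightarrow>
       real N \<ge> real N0 * max ((1 / e * logp (1 / e)) ^ (d + 2)) (e powr (real (d + 2) / real (d - 1))) \<longrightarrow>
       exp (- ((real N powr (1 / real (d + 2))) ^ d)) / 2 + Q / e * exp (- b * (e * real N powr (1 / real (d + 2))))
         \<le> exp (- C1 * e * real N powr (1 / real (d + 2)))"
    "\<forall>e>0. \<forall>N\<ge>1. d = 1 \<longrightarrow>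
       real N \<ge> real N0 * max ((1 / e * logp (1 / e)) ^ (d + 2)) 1 \<longrightarrow>
       exp (- ((real N powr (1 / real (d + 2))) ^ d)) / 2 + Q / e * exp (- b * (e * real N powr (1 / real (d + 2))))
         \<le> exp (- C1 * min e 1 * real N powr (1 / real (d + 2)))"
proof -
  define \<nu> where "\<nu> = max 1 (max (4 / b) (16 * ln (2 * Q) / b))"
  have \<nu>: "1 \<le> \<nu>" "4 / b \<le> \<nu>" "16 * ln (2 * Q) / b \<le> \<nu>" by (auto simp: \<nu>_def)
  define N0 where "N0 = nat \<lceil>\<nu> ^ (d + 2)\<rceil>"
  have N0: "\<nu> ^ (d + 2) \<le> real N0" unfolding N0_def by linarith
  define C1 where "C1 = min 1 (b / 2)"
  have C1: "0 < C1" "C1 \<le> 1" "C1 \<le> b / 2" using b by (auto simp: C1_def)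
  \<comment> \<open>\<open>N0\<close> is at least \<open>\<nu> ^ (d + 2)\<close>, so extracting the
    root of the lower bound on \<open>N\<close> gains a factor \<nu>.\<close>
  have root: "\<nu> * x \<le> real N powr (1 / real (d + 2))" if "0 \<le> x" "real N0 * x ^ (d + 2) \<le> real N" "1 \<le> N" for x N
  proof (rule power_le_imp_le_base)
    have "(\<nu> * x) ^ Suc (d + 1) = \<nu> ^ (d + 2) * x ^ (d + 2)" by (simp add: power_mult_distrib)
    also have "\<dots> \<le> real N0 * x ^ (d + 2)" using N0 that(1) by (intro mult_right_mono) auto
    also have "\<dots> \<le> real N" by fact
    also have "\<dots> = (real N powr (1 / real (d + 2))) ^ Suc (d + 1)"
    proof -
      have "(real N powr (1 / real (d + 2))) ^ Suc (d + 1) = real N powr (real (Suc (d + 1)) * (1 / real (d + 2)))"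
        using that(3) by (intro powr_power) simp
      also have "real (Suc (d + 1)) * (1 / real (d + 2)) = 1" by simp
      finally show ?thesis by simp
    qed
    finally show "(\<nu> * x) ^ Suc (d + 1) \<le> (real N powr (1 / real (d + 2))) ^ Suc (d + 1)" .
  qed simp
  have logp0: "0 \<le> logp x" for x by (simp add: logp_def)
  \<comment> \<open>For \<open>e \<le> 1/2\<close> the logarithm is bounded below. For larger
    \<open>e\<close> it may vanish, and the lower bound on \<open>e * a\<close> has to come from the
    other term of the maximum.\<close>
  have small: "\<nu> / 4 \<le> e * a" if "0 < e" "e \<le> 1/2" "\<nu> * logp (1 / e) \<le> e * a" for e a
  proof -
    have "1/2 \<le> ln (2::real)" using ln_le_minus_one[of "1/2::real"] by (simp add: ln_div)
    also have "ln 2 \<le> ln (1 / e)" using that by (simp add: field_simps)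
    finally have "1/4 \<le> logp (1 / e)" by (simp add: logp_def)
    then have "\<nu> * (1/4) \<le> \<nu> * logp (1 / e)" using \<nu> by (intro mult_left_mono) auto
    then show ?thesis using that(3) by simp
  qed
  show thesis
  proof (rule that[OF C1(1)]; intro allI impI)
    fix e :: real and N :: nat
    assume e: "0 < e" and N: "1 \<le> N" and d1: "1 < d"
      and le: "real N \<ge> real N0 * max ((1 / e * logp (1 / e)) ^ (d + 2)) (e powr (real (d + 2) / real (d - 1)))"
    define a where "a = real N powr (1 / real (d + 2))"
    have a1: "1 \<le> a" using N by (simp add: a_def ge_one_powr_ge_zero)
    have "real N0 * (1 / e * logp (1 / e)) ^ (d + 2) \<le> real N"
      by (rule order_trans[OF _ le]) (intro mult_left_mono, auto)
    then have "\<nu> * (1 / e * logp (1 / e)) \<le> a" unfolding a_def using e logp0 N by (intro root) auto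
    then have l: "\<nu> * logp (1 / e) \<le> e * a" using e by (simp add: field_simps)
    define z where "z = e powr (1 / real (d - 1))"
    have z0: "0 < z" using e by (simp add: z_def)
    have "z ^ (d + 2) = e powr (real (d + 2) / real (d - 1))"
    proof -
      have "z ^ (d + 2) = e powr (real (d + 2) * (1 / real (d - 1)))" unfolding z_def using e by (intro powr_power) simp
      then show ?thesis by simp
    qed
    then have "real N0 * z ^ (d + 2) \<le> real N"
      by (intro order_trans[OF _ le]) (intro mult_left_mono, auto)
    then have za: "\<nu> * z \<le> a" unfolding a_def using z0 N by (intro root) auto
    have "z \<le> a" using za \<nu>(1) z0 mult_right_mono[of 1 \<nu> z] by linarith
    then have "z ^ (d - 1) \<le> a ^ (d - 1)" using z0 by (intro power_mono) auto
    moreover have "z ^ (d - 1) = e"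
    proof -
      have "z ^ (d - 1) = e powr (real (d - 1) * (1 / real (d - 1)))" unfolding z_def using e by (intro powr_power) simp
      then show ?thesis using e d1 by simp
    qed
    ultimately have "e * a \<le> a ^ (d - 1) * a" using a1 by (intro mult_right_mono) auto
    also have "\<dots> = a ^ d" using d1 by (simp add: power_Suc2[symmetric] del: power_Suc)
    finally have ea: "e * a \<le> a ^ d" .
    have "\<nu> / 4 \<le> e * a"
    proof (cases "e \<le> 1/2")
      case True
      then show ?thesis using small e l by blast
    next
      case False
      have "1/2 \<le> z"
      proof (cases "1 \<le> e")
        case True
        then show ?thesis using ge_one_powr_ge_zero[OF True, of "1 / real (d - 1)"] by (simp add: z_def)
      next
        case f: False
        have "e powr 1 \<le> e powr (1 / real (d - 1))" using f e d1 by (intro powr_mono') auto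
        then show ?thesis using False e by (simp add: z_def)
      qed
      then have "(1/2) * (\<nu> * (1/2)) \<le> e * (\<nu> * z)" using False \<nu>(1) by (intro mult_mono) auto
      also have "\<dots> \<le> e * a" using za e by (intro mult_left_mono) auto
      finally show ?thesis by simp
    qed
    from exp_absorb[OF b Q e \<nu>(2,3) l this]
    have t2: "Q / e * exp (- b * (e * a)) \<le> exp (- (b / 2) * (e * a)) / 2" .
    have "C1 * (e * a) \<le> b / 2 * (e * a)" "C1 * (e * a) \<le> 1 * (e * a)" using C1 e a1 by (intro mult_right_mono; simp)+
    then have "exp (- (b / 2) * (e * a)) \<le> exp (- C1 * e * a)" "exp (- (a ^ d)) \<le> exp (- C1 * e * a)"
      using ea by (auto simp: algebra_simps)
    then show "exp (- ((real N powr (1 / real (d + 2))) ^ d)) / 2 + Q / e * exp (- b * (e * real N powr (1 / real (d + 2))))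
         \<le> exp (- C1 * e * real N powr (1 / real (d + 2)))"
      using t2 unfolding a_def by linarith
  next
    fix e :: real and N :: nat
    assume e: "0 < e" and N: "1 \<le> N" and d1: "d = 1"
      and le: "real N \<ge> real N0 * max ((1 / e * logp (1 / e)) ^ (d + 2)) 1"
    define a where "a = real N powr (1 / real (d + 2))"
    have a1: "1 \<le> a" using N by (simp add: a_def ge_one_powr_ge_zero)
    have "real N0 * (1 / e * logp (1 / e)) ^ (d + 2) \<le> real N"
      by (rule order_trans[OF _ le]) (intro mult_left_mono, auto)
    then have "\<nu> * (1 / e * logp (1 / e)) \<le> a" unfolding a_def using e logp0 N by (intro root) auto
    then have l: "\<nu> * logp (1 / e) \<le> e * a" using e by (simp add: field_simps)
    have "real N0 * 1 ^ (d + 2) \<le> real N"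
      by (rule order_trans[OF _ le]) (intro mult_left_mono, auto)
    then have \<nu>a: "\<nu> * 1 \<le> a" unfolding a_def using N by (intro root) auto
    have "\<nu> / 4 \<le> e * a"
    proof (cases "e \<le> 1/2")
      case True
      then show ?thesis using small e l by blast
    next
      case False
      then have "(1/2) * \<nu> \<le> e * a" using \<nu>a \<nu>(1) by (intro mult_mono) auto
      then show ?thesis using \<nu>(1) by linarith
    qed
    from exp_absorb[OF b Q e \<nu>(2,3) l this]
    have t2: "Q / e * exp (- b * (e * a)) \<le> exp (- (b / 2) * (e * a)) / 2" .
    have "C1 * (min e 1 * a) \<le> b / 2 * (e * a)" "C1 * (min e 1 * a) \<le> 1 * (1 * a)"
      using C1 e a1 b by (intro mult_mono; simp)+
    then have "exp (- (b / 2) * (e * a)) \<le> exp (- C1 * min e 1 * a)" "exp (- (a ^ d)) \<le> exp (- C1 * min e 1 * a)"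
      using d1 by (auto simp: algebra_simps)
    then show "exp (- ((real N powr (1 / real (d + 2))) ^ d)) / 2 + Q / e * exp (- b * (e * real N powr (1 / real (d + 2))))
         \<le> exp (- C1 * min e 1 * real N powr (1 / real (d + 2)))"
      using t2 unfolding a_def by linarith
  qed
qed

text \<open>When \<open>p = 0\<close> the weights of the initial error vanish and \<open>q\<close> is chosen freely in between.\<close>
lemma weights:
  fixes p \<xi> :: real
  assumes p: "0 \<le> p" "\<xi> < 1 - p" and \<xi>: "0 < \<xi>"
  obtains c q where "0 < c" "\<xi> < q" "q < 1" "\<And>n. c * (\<Sum>k<n. q ^ k) + p * (1 - p) ^ n \<le> 1"
proof (cases "p = 0")
  case True
  define q where "q = (1 + \<xi>) / 2"
  have q: "0 < q" "q < 1" "\<xi> < q" using p \<xi> True by (auto simp: q_def)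
  show thesis
  proof (rule that[of "1 - q" q])
    fix n
    have "(1 - q) * (\<Sum>k<n. q ^ k) = 1 - q ^ n" by (simp add: one_diff_power_eq)
    then show "(1 - q) * (\<Sum>k<n. q ^ k) + p * (1 - p) ^ n \<le> 1" using q True by simp
  qed (use q in auto)
next
  case False
  \<comment> \<open>The geometric sum telescopes to \<open>1 - (1 - p) ^ n\<close>; the missing
    \<open>(1 - p) ^ n\<close> leaves room for the weight \<open>p * (1 - p) ^ n\<close> of the
    initial error.\<close>
  show thesis
  proof (rule that[of p "1 - p"])
    fix n
    have "p * (\<Sum>k<n. (1 - p) ^ k) = 1 - (1 - p) ^ n" by (simp add: one_diff_power_eq[of "1 - p"])
    moreover have "p * (1 - p) ^ n \<le> 1 * (1 - p) ^ n" using p \<xi> by (intro mult_right_mono) auto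
    ultimately show "p * (\<Sum>k<n. (1 - p) ^ k) + p * (1 - p) ^ n \<le> 1" by simp
  qed (use False p in auto)
qed

section \<open>The mean field map\<close>

text \<open>Evaluations on Borel sets generate the sigma-algebra on \<open>P1\<close> for which
  \<open>f\<close> is jointly measurable, and the evaluations of an empirical measure are finite
  averages of indicators.\<close>

lemma empirical_measurable:
  fixes X :: "nat \<Rightarrow> 'w \<Rightarrow> 'a::euclidean_space"
  assumes N: "1 \<le> N" and [measurable]: "\<And>i. i \<in> {1..N} \<Longrightarrow> X i \<in> borel_measurable K"
  shows "(\<lambda>w. empirical N (\<lambda>i. X i w)) \<in> K \<rightarrow>\<^sub>M restrict_space (subprob_algebra borel) P1"
proof (rule measurable_restrict_space2)
  show "(\<lambda>w. empirical N (\<lambda>i. X i w)) \<in> K \<rightarrow>\<^sub>M subprob_algebra borel"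
  proof (rule measurable_subprob_algebra)
    show "subprob_space (empirical N (\<lambda>i. X i w))" for w
      by (rule prob_space_imp_subprob_space[OF prob_space_empirical[OF N]])
    fix B :: "'a set" assume B[measurable]: "B \<in> sets borel"
    show "(\<lambda>w. emeasure (empirical N (\<lambda>i. X i w)) B) \<in> borel_measurable K"
      unfolding emeasure_empirical[OF N B] by measurable
  qed simp
qed (use empirical_in_P1[OF N] in auto)

locale mean_field =
  fixes A :: "real^'d^'d" and \<delta> \<omega> M \<alpha> :: real
    and \<theta> :: "(real^'m) measure"
    and f :: "real^'d \<Rightarrow> (real^'d) measure \<Rightarrow> real^'m \<Rightarrow> real^'d"
  assumes theta: "prob_space \<theta>" "sets \<theta> = sets (borel :: (real^'m) measure)"
    and f_meas: "(\<lambda>(x, \<mu>, z). f x \<mu> z) \<in>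
        borel \<Otimes>\<^sub>M (restrict_space (subprob_algebra borel) P1 \<Otimes>\<^sub>M borel) \<rightarrow>\<^sub>M borel"
    and delta_nonneg: "0 \<le> \<delta>"
    and A3: "0 < \<omega>" "onorm (\<lambda>x. A *v x) \<le> exp (- \<omega>)"
    and A6i: "1 < M" "AE z in \<theta>. Dlip f z \<le> ennreal M"
    and A6ii: "0 < \<alpha>" "(\<integral>\<^sup>+ z. ennreal (exp (\<alpha> * D1 f z)) \<partial>\<theta>) < \<infinity>"
    and delta_small: "\<delta> < (1 - exp (- \<omega>)) / (2 * M)"
begin

abbreviation \<Psi> :: "(real^'d) measure \<Rightarrow> (real^'d) measure" where "\<Psi> \<equiv> Psi A \<delta> f \<theta>"
abbreviation \<sigma> :: real where "\<sigma> \<equiv> sigma f \<theta>"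
abbreviation jump :: "real^'d \<Rightarrow> (real^'d) measure \<Rightarrow> real^'m \<Rightarrow> real^'d" where
  "jump x \<mu> z \<equiv> A *v x + \<delta> *\<^sub>R f x \<mu> z"

sublocale \<theta>: prob_space \<theta> by (rule theta)

lemmas [measurable_cong] = theta(2)

lemma norm_A: "norm (A *v x) \<le> exp (- \<omega>) * norm x"
proof -
  have "norm (A *v x) \<le> onorm (\<lambda>x. A *v x) * norm x"
    by (rule onorm) (rule matrix_vector_mul_bounded_linear)
  also have "\<dots> \<le> exp (- \<omega>) * norm x" using A3 by (intro mult_right_mono) auto
  finally show ?thesis .
qed

lemma A_measurable[measurable]: "(\<lambda>x. A *v x) \<in> borel_measurable borel"
  by (intro borel_measurable_continuous_onI linear_continuous_on matrix_vector_mul_bounded_linear)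

lemma f_measurable:
  assumes "X \<in> borel_measurable K" "L \<in> K \<rightarrow>\<^sub>M restrict_space (subprob_algebra borel) P1" "Z \<in> borel_measurable K"
  shows "(\<lambda>w. f (X w) (L w) (Z w)) \<in> borel_measurable K"
  using measurable_compose[OF measurable_Pair[OF assms(1) measurable_Pair[OF assms(2,3)]] f_meas] by simp

lemma f_measurable_const:
  assumes "\<mu> \<in> P1" "X \<in> borel_measurable K" "Z \<in> borel_measurable K"
  shows "(\<lambda>w. f (X w) \<mu> (Z w)) \<in> borel_measurable K"
proof (rule f_measurable[OF assms(2) _ assms(3)])
  show "(\<lambda>w. \<mu>) \<in> K \<rightarrow>\<^sub>M restrict_space (subprob_algebra borel) P1"
    using assms(1) P1D[OF assms(1)]
    by (intro measurable_const) (auto simp: space_restrict_space space_subprob_algebra prob_space_imp_subprob_space)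
qed

lemma D1_measurable[measurable]: "D1 f \<in> borel_measurable borel"
  unfolding D1_def[abs_def] using f_measurable_const[OF return_in_P1, of "\<lambda>_. 0" borel "\<lambda>z. z"] by measurable

lemma Dlip_finite: "(\<integral>\<^sup>+z. Dlip f z \<partial>\<theta>) = ennreal \<sigma>"
proof -
  have "(\<integral>\<^sup>+z. Dlip f z \<partial>\<theta>) \<le> (\<integral>\<^sup>+z. ennreal M \<partial>\<theta>)" by (rule nn_integral_mono_AE) (rule A6i)
  also have "\<dots> < \<infinity>" by (simp add: \<theta>.emeasure_space_1)
  finally show ?thesis unfolding sigma_def by simp
qed

lemma sigma_nonneg: "0 \<le> \<sigma>" by (simp add: sigma_def)

lemma nn_integral_f_diff:
  assumes "\<mu>1 \<in> P1" "\<mu>2 \<in> P1"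
  shows "(\<integral>\<^sup>+z. ennreal (norm (f x1 \<mu>1 z - f x2 \<mu>2 z)) \<partial>\<theta>) \<le> ennreal (\<sigma> * (dist x1 x2 + W1 \<mu>1 \<mu>2))"
proof -
  define s where "s = dist x1 x2 + W1 \<mu>1 \<mu>2"
  have s0: "0 \<le> s" by (simp add: s_def)
  note [measurable] = f_measurable_const[OF assms(1), of "\<lambda>_. x1" \<theta> "\<lambda>z. z"] f_measurable_const[OF assms(2), of "\<lambda>_. x2" \<theta> "\<lambda>z. z"]
  have le: "ennreal (norm (f x1 \<mu>1 z - f x2 \<mu>2 z)) \<le> Dlip f z * ennreal s" for z
    unfolding s_def by (rule norm_le_Dlip[OF assms])
  show ?thesis
  proof (cases "s = 0")
    case True
    then have "(\<integral>\<^sup>+z. ennreal (norm (f x1 \<mu>1 z - f x2 \<mu>2 z)) \<partial>\<theta>) \<le> (\<integral>\<^sup>+z. 0 \<partial>\<theta>)"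
      using le by (intro nn_integral_mono) auto
    then show ?thesis by simp
  next
    case False
    then have s: "s > 0" using s0 by simp
    have "(\<integral>\<^sup>+z. ennreal (norm (f x1 \<mu>1 z - f x2 \<mu>2 z)) \<partial>\<theta>)
        = (\<integral>\<^sup>+z. ennreal s * ennreal (norm (f x1 \<mu>1 z - f x2 \<mu>2 z) / s) \<partial>\<theta>)"
      using s by (intro nn_integral_cong) (simp add: ennreal_mult[symmetric])
    also have "\<dots> = ennreal s * (\<integral>\<^sup>+z. ennreal (norm (f x1 \<mu>1 z - f x2 \<mu>2 z) / s) \<partial>\<theta>)"
      by (rule nn_integral_cmult) measurable
    also have "(\<integral>\<^sup>+z. ennreal (norm (f x1 \<mu>1 z - f x2 \<mu>2 z) / s) \<partial>\<theta>) \<le> (\<integral>\<^sup>+z. Dlip f z \<partial>\<theta>)"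
    proof (rule nn_integral_mono)
      fix z
      have "ennreal (norm (f x1 \<mu>1 z - f x2 \<mu>2 z)) / ennreal s \<le> Dlip f z"
        using le[of z] s by (intro divide_le_posI_ennreal) (auto simp: mult.commute)
      then show "ennreal (norm (f x1 \<mu>1 z - f x2 \<mu>2 z) / s) \<le> Dlip f z"
        using s by (simp add: divide_ennreal)
    qed
    also have "ennreal s * (\<integral>\<^sup>+z. Dlip f z \<partial>\<theta>) = ennreal (\<sigma> * s)"
      using s0 sigma_nonneg by (simp add: Dlip_finite ennreal_mult mult.commute)
    finally show ?thesis by (simp add: s_def mult_left_mono)
  qed
qed

text \<open>\<open>Dlip\<close> already takes the supremum over all arguments, so a single null set
  of \<open>z\<close> serves every \<open>x\<close> and \<open>\<mu>\<close>. The reference point is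
  the origin with the Dirac mass there, as in \<open>D1\<close>.\<close>

lemma f_growth:
  "AE z in \<theta>. \<forall>x. \<forall>\<mu>\<in>P1. norm (f x \<mu> z) \<le> D1 f z + M * (norm x + W1 \<mu> (return borel 0))"
  using A6i(2)
proof eventually_elim
  case (elim z)
  show ?case
  proof (intro allI ballI)
    fix x :: "real^'d" and \<mu> :: "(real^'d) measure" assume \<mu>: "\<mu> \<in> P1"
    define s where "s = norm x + W1 \<mu> (return borel 0)"
    have s0: "0 \<le> s" by (simp add: s_def)
    have "ennreal (norm (f x \<mu> z - f 0 (return borel 0) z)) \<le> Dlip f z * ennreal s"
      using norm_le_Dlip[OF \<mu> return_in_P1, of f x z 0] by (simp add: s_def)
    also have "\<dots> \<le> ennreal M * ennreal s" using elim by (intro mult_right_mono) auto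
    also have "\<dots> = ennreal (M * s)" using A6i(1) s0 by (simp add: ennreal_mult)
    finally have "norm (f x \<mu> z - f 0 (return borel 0) z) \<le> M * s"
      using A6i(1) s0 by (simp add: ennreal_le_iff)
    then show "norm (f x \<mu> z) \<le> D1 f z + M * (norm x + W1 \<mu> (return borel 0))"
      unfolding D1_def s_def using norm_triangle_sub[of "f x \<mu> z" "f 0 (return borel 0) z"] by linarith
  qed
qed

text \<open>Chosen so that both \<open>\<beta> \<le> \<alpha>\<close>, for the moment of the initial
  law, and \<open>\<beta> * \<delta> \<le> \<alpha>\<close>, for the noise term scaled by
  \<delta>.\<close>

definition \<beta> where "\<beta> = \<alpha> / (1 + \<delta>)"
text \<open>The drift factor of the exponential moment. It is below 1 exactly by
  \<open>delta_small\<close>; the 2 counts the dependence of \<open>f\<close> on the position and on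
  the measure.\<close>

definition \<kappa> where "\<kappa> = exp (- \<omega>) + 2 * \<delta> * M"

lemma \<beta>_pos: "0 < \<beta>" using A6ii(1) delta_nonneg by (simp add: \<beta>_def)

lemma \<beta>_le: "\<beta> \<le> \<alpha>" "\<beta> * \<delta> \<le> \<alpha>"
  using A6ii(1) delta_nonneg by (auto simp: \<beta>_def field_simps)

lemma \<kappa>: "0 < \<kappa>" "\<kappa> < 1"
proof -
  show "0 < \<kappa>" using A6i(1) delta_nonneg by (auto simp: \<kappa>_def intro!: add_pos_nonneg)
  show "\<kappa> < 1" using delta_small A6i(1) by (simp add: \<kappa>_def field_simps)
qed

lemma nn_integral_D1: "(\<integral>\<^sup>+z. ennreal (D1 f z) \<partial>\<theta>) < \<infinity>"
proof -
  have "(\<integral>\<^sup>+z. ennreal (D1 f z) \<partial>\<theta>) \<le> (\<integral>\<^sup>+z. ennreal (1 / \<alpha>) * ennreal (exp (\<alpha> * D1 f z)) \<partial>\<theta>)"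
  proof (rule nn_integral_mono)
    fix z
    have "\<alpha> * D1 f z \<le> exp (\<alpha> * D1 f z)" using exp_ge_add_one_self[of "\<alpha> * D1 f z"] by linarith
    then have "D1 f z \<le> 1 / \<alpha> * exp (\<alpha> * D1 f z)" using A6ii(1) by (simp add: field_simps)
    then show "ennreal (D1 f z) \<le> ennreal (1 / \<alpha>) * ennreal (exp (\<alpha> * D1 f z))"
      using A6ii(1) by (simp add: ennreal_mult[symmetric] del: ennreal_1)
  qed
  also have "\<dots> = ennreal (1 / \<alpha>) * (\<integral>\<^sup>+z. ennreal (exp (\<alpha> * D1 f z)) \<partial>\<theta>)"
    by (rule nn_integral_cmult) measurable
  also have "\<dots> < \<infinity>" using A6ii(2) by (simp add: ennreal_mult_less_top)
  finally show ?thesis .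
qed

lemma Psi_map_measurable:
  assumes "\<mu> \<in> P1" "sets \<rho> = sets borel"
  shows "(\<lambda>(x, z). jump x \<mu> z) \<in> borel_measurable (\<rho> \<Otimes>\<^sub>M \<theta>)"
proof -
  note [measurable_cong] = assms(2)
  note [measurable] = f_measurable_const[OF assms(1), of fst "\<rho> \<Otimes>\<^sub>M \<theta>" snd]
  show ?thesis by (simp add: split_beta')
qed

lemma Psi_in_P1:
  assumes "\<mu> \<in> P1"
  shows "\<Psi> \<mu> \<in> P1"
proof -
  note \<mu> = P1D[OF assms]
  interpret \<mu>: prob_space \<mu> by fact
  interpret P: pair_prob_space \<mu> \<theta> ..
  note [measurable_cong] = \<mu>(2)
  note m = Psi_map_measurable[OF assms \<mu>(2)]
  note [measurable] = f_measurable_const[OF assms(1), of "\<lambda>_. _" \<theta> "\<lambda>z. z"] f_measurable_const[OF assms(1), of fst "\<mu> \<Otimes>\<^sub>M \<theta>" snd]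
  define w where "w = W1 \<mu> (return borel 0)"
  have "(\<integral>\<^sup>+ x. ennreal (norm x) \<partial>\<Psi> \<mu>) = (\<integral>\<^sup>+ p. ennreal (norm (A *v fst p + \<delta> *\<^sub>R f (fst p) \<mu> (snd p))) \<partial>(\<mu> \<Otimes>\<^sub>M \<theta>))"
    unfolding Psi_def using m by (subst nn_integral_distr) (auto simp: split_beta')
  also have "\<dots> = (\<integral>\<^sup>+ x. \<integral>\<^sup>+ z. ennreal (norm (jump x \<mu> z)) \<partial>\<theta> \<partial>\<mu>)"
    by (subst \<theta>.nn_integral_fst[symmetric]) auto
  also have "\<dots> \<le> (\<integral>\<^sup>+ x. \<integral>\<^sup>+ z. ennreal (1 + \<delta> * M) * ennreal (norm x) + ennreal (\<delta> * M * w) + ennreal \<delta> * ennreal (D1 f z) \<partial>\<theta> \<partial>\<mu>)"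
  proof (rule nn_integral_mono, rule nn_integral_mono_AE)
    fix x
    show "AE z in \<theta>. ennreal (norm (jump x \<mu> z)) \<le> ennreal (1 + \<delta> * M) * ennreal (norm x) + ennreal (\<delta> * M * w) + ennreal \<delta> * ennreal (D1 f z)"
      using f_growth
    proof eventually_elim
      case (elim z)
      then have g: "norm (f x \<mu> z) \<le> D1 f z + M * (norm x + w)" using assms by (auto simp: w_def)
      have "exp (-\<omega>) * norm x \<le> 1 * norm x" using A3(1) by (intro mult_right_mono) auto
      then have "norm (A *v x) \<le> norm x" using norm_A[of x] by linarith
      then have "norm (jump x \<mu> z) \<le> norm x + \<delta> * (D1 f z + M * (norm x + w))"
        using delta_nonneg g by (intro norm_triangle_le) (auto intro!: add_mono mult_left_mono)
      also have "\<dots> = (1 + \<delta> * M) * norm x + \<delta> * M * w + \<delta> * D1 f z" by (simp add: algebra_simps)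
      finally show ?case using delta_nonneg A6i(1)
        by (simp add: ennreal_mult[symmetric] ennreal_plus[symmetric] w_def D1_def del: ennreal_plus)
    qed
  qed
  also have "\<dots> = ennreal (1 + \<delta> * M) * (\<integral>\<^sup>+ x. ennreal (norm x) \<partial>\<mu>) + ennreal (\<delta> * M * w) + ennreal \<delta> * (\<integral>\<^sup>+ z. ennreal (D1 f z) \<partial>\<theta>)"
    by (simp add: nn_integral_add nn_integral_cmult \<theta>.emeasure_space_1 \<mu>.emeasure_space_1)
  also have "\<dots> < \<infinity>" using \<mu>(3) nn_integral_D1 by (simp add: ennreal_mult_less_top)
  finally show ?thesis using P.prob_space_distr[OF m] unfolding P1_def Psi_def by auto
qed

lemma Psi_iterate_in_P1: "\<mu> \<in> P1 \<Longrightarrow> (\<Psi> ^^ n) \<mu> \<in> P1"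
  by (induction n) (auto simp: Psi_in_P1)

text \<open>Both images are realised on one space by a nearly optimal coupling of the inputs
  together with a common noise. The constant \<sigma> enters twice, once through the positions and
  once through the measure argument of \<open>f\<close>.\<close>

lemma Psi_lipschitz:
  assumes P: "\<mu> \<in> P1" "\<nu> \<in> P1"
  shows "W1 (\<Psi> \<mu>) (\<Psi> \<nu>) \<le> (exp (- \<omega>) + 2 * \<delta> * \<sigma>) * W1 \<mu> \<nu>"
proof (rule field_le_epsilon)
  define w where "w = W1 \<mu> \<nu>"
  note \<sigma>0 = sigma_nonneg
  \<comment> \<open>The coefficient of the transport cost. The slack \<open>e / c\<close> of the
    coupling therefore costs \<open>e\<close>; the remaining \<open>\<delta> * \<sigma>\<close>
    multiplies the exact distance of the measure arguments.\<close>
  define c where "c = exp (- \<omega>) + \<delta> * \<sigma>"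
  have c: "c > 0" using \<sigma>0 delta_nonneg by (auto simp: c_def intro!: add_pos_nonneg)
  fix e :: real assume "e > 0"
  then have "e / c > 0" using c by simp
  then obtain \<pi> where \<pi>: "\<pi> \<in> couplings \<mu> \<nu>" "cost \<pi> \<le> ennreal (W1 \<mu> \<nu> + e / c)"
    using coupling_approx[OF P] by blast
  interpret \<pi>: prob_space \<pi> by (rule couplingsD[OF \<pi>(1)])
  interpret P: pair_prob_space \<pi> \<theta> ..
  note \<pi>m[measurable] = couplings_measurable[OF \<pi>(1)]
  have law: "distr (\<pi> \<Otimes>\<^sub>M \<theta>) borel (\<lambda>(p, z). jump (g p) \<rho> z) = \<Psi> \<rho>"
    if \<rho>: "\<rho> \<in> P1" and g[measurable]: "g \<in> \<pi> \<rightarrow>\<^sub>M borel" and d: "distr \<pi> borel g = \<rho>" for \<rho> g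
  proof -
    have s: "sigma_finite_measure (distr \<theta> \<theta> (\<lambda>z. z))" by (simp add: distr_id2 \<theta>.sigma_finite_measure_axioms)
    have "\<rho> \<Otimes>\<^sub>M \<theta> = distr \<pi> borel g \<Otimes>\<^sub>M distr \<theta> \<theta> (\<lambda>z. z)" by (simp add: d distr_id2)
    also have "\<dots> = distr (\<pi> \<Otimes>\<^sub>M \<theta>) (borel \<Otimes>\<^sub>M \<theta>) (\<lambda>(p, z). (g p, z))"
      by (subst pair_measure_distr[OF g _ s]) auto
    finally have "\<Psi> \<rho> = distr (distr (\<pi> \<Otimes>\<^sub>M \<theta>) (borel \<Otimes>\<^sub>M \<theta>) (\<lambda>(p, z). (g p, z))) borel (\<lambda>(x, z). jump x \<rho> z)"
      unfolding Psi_def by simp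
    also have "\<dots> = distr (\<pi> \<Otimes>\<^sub>M \<theta>) borel (\<lambda>(p, z). jump (g p) \<rho> z)"
      by (subst distr_distr) (use Psi_map_measurable[OF \<rho>, of borel] in \<open>auto simp: comp_def split_beta'\<close>)
    finally show ?thesis by simp
  qed
  note l\<mu> = law[OF P(1) \<pi>m(1) couplingsD(3)[OF \<pi>(1)]] and l\<nu> = law[OF P(2) \<pi>m(2) couplingsD(4)[OF \<pi>(1)]]
  note [measurable] = f_measurable_const[OF P(1), of "\<lambda>r. fst (fst r)" "\<pi> \<Otimes>\<^sub>M \<theta>" snd] f_measurable_const[OF P(2), of "\<lambda>r. snd (fst r)" "\<pi> \<Otimes>\<^sub>M \<theta>" snd]
    f_measurable_const[OF P(1), of "\<lambda>_. _" \<theta> "\<lambda>z. z"] f_measurable_const[OF P(2), of "\<lambda>_. _" \<theta> "\<lambda>z. z"]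
  have "ennreal (W1 (\<Psi> \<mu>) (\<Psi> \<nu>)) \<le>
    (\<integral>\<^sup>+r. ennreal (dist (jump (fst (fst r)) \<mu> (snd r)) (jump (snd (fst r)) \<nu> (snd r))) \<partial>(\<pi> \<Otimes>\<^sub>M \<theta>))"
    unfolding l\<mu>[symmetric] l\<nu>[symmetric] split_beta' by (rule W1_distr_le[OF P.prob_space_axioms]) auto
  also have "\<dots> = (\<integral>\<^sup>+p. \<integral>\<^sup>+z. ennreal (dist (jump (fst p) \<mu> z) (jump (snd p) \<nu> z)) \<partial>\<theta> \<partial>\<pi>)"
    by (subst \<theta>.nn_integral_fst[symmetric]) auto
  also have "\<dots> \<le> (\<integral>\<^sup>+p. ennreal c * ennreal (dist (fst p) (snd p)) + ennreal (\<delta> * \<sigma> * w) \<partial>\<pi>)"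
  proof (rule nn_integral_mono)
    fix p :: "(real^'d) \<times> (real^'d)"
    obtain x y where p: "p = (x, y)" by force
    have "(\<integral>\<^sup>+z. ennreal (dist (jump (fst p) \<mu> z) (jump (snd p) \<nu> z)) \<partial>\<theta>)
      \<le> (\<integral>\<^sup>+z. ennreal (exp (-\<omega>) * dist x y) + ennreal \<delta> * ennreal (norm (f x \<mu> z - f y \<nu> z)) \<partial>\<theta>)"
    proof (rule nn_integral_mono)
      fix z
      have "dist (jump x \<mu> z) (jump y \<nu> z) = norm (A *v (x - y) + \<delta> *\<^sub>R (f x \<mu> z - f y \<nu> z))"
        by (simp add: dist_norm matrix_vector_mult_diff_distrib scaleR_diff_right algebra_simps)
      also have "\<dots> \<le> exp (-\<omega>) * dist x y + \<delta> * norm (f x \<mu> z - f y \<nu> z)"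
        using norm_A[of "x - y"] delta_nonneg by (intro norm_triangle_le add_mono) (auto simp: dist_norm)
      finally show "ennreal (dist (jump (fst p) \<mu> z) (jump (snd p) \<nu> z))
        \<le> ennreal (exp (-\<omega>) * dist x y) + ennreal \<delta> * ennreal (norm (f x \<mu> z - f y \<nu> z))"
        using delta_nonneg by (simp add: p ennreal_mult[symmetric] ennreal_plus[symmetric] del: ennreal_plus)
    qed
    also have "\<dots> = ennreal (exp (-\<omega>) * dist x y) + ennreal \<delta> * (\<integral>\<^sup>+z. ennreal (norm (f x \<mu> z - f y \<nu> z)) \<partial>\<theta>)"
      by (simp add: nn_integral_add nn_integral_cmult \<theta>.emeasure_space_1)
    also have "\<dots> \<le> ennreal (exp (-\<omega>) * dist x y) + ennreal \<delta> * ennreal (\<sigma> * (dist x y + w))"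
      using nn_integral_f_diff[OF P] by (intro add_mono mult_left_mono) (auto simp: w_def)
    also have "\<dots> = ennreal (exp (-\<omega>) * dist x y + \<delta> * (\<sigma> * (dist x y + w)))"
      using delta_nonneg \<sigma>0 by (simp add: ennreal_mult[symmetric] ennreal_plus[symmetric] w_def del: ennreal_plus)
    also have "exp (-\<omega>) * dist x y + \<delta> * (\<sigma> * (dist x y + w)) = c * dist x y + \<delta> * \<sigma> * w"
      by (simp add: c_def algebra_simps)
    also have "ennreal \<dots> = ennreal c * ennreal (dist (fst p) (snd p)) + ennreal (\<delta> * \<sigma> * w)"
      using delta_nonneg \<sigma>0 c by (simp add: p ennreal_mult[symmetric] ennreal_plus[symmetric] w_def del: ennreal_plus)
    finally show "(\<integral>\<^sup>+z. ennreal (dist (jump (fst p) \<mu> z) (jump (snd p) \<nu> z)) \<partial>\<theta>)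
      \<le> ennreal c * ennreal (dist (fst p) (snd p)) + ennreal (\<delta> * \<sigma> * w)" .
  qed
  also have "\<dots> = ennreal c * cost \<pi> + ennreal (\<delta> * \<sigma> * w)"
    by (simp add: nn_integral_add nn_integral_cmult \<pi>.emeasure_space_1)
  also have "\<dots> \<le> ennreal c * ennreal (w + e / c) + ennreal (\<delta> * \<sigma> * w)"
    using \<pi>(2) by (intro add_mono mult_left_mono) (auto simp: w_def)
  also have "\<dots> = ennreal (c * (w + e / c) + \<delta> * \<sigma> * w)"
    using delta_nonneg \<sigma>0 c \<open>e > 0\<close> by (simp add: ennreal_mult[symmetric] ennreal_plus[symmetric] w_def del: ennreal_plus)
  also have "c * (w + e / c) + \<delta> * \<sigma> * w = (exp (- \<omega>) + 2 * \<delta> * \<sigma>) * w + e"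
    using c by (simp add: field_simps) (simp add: c_def algebra_simps)
  finally show "W1 (\<Psi> \<mu>) (\<Psi> \<nu>) \<le> (exp (- \<omega>) + 2 * \<delta> * \<sigma>) * W1 \<mu> \<nu> + e"
    using \<open>e > 0\<close> delta_nonneg \<sigma>0 unfolding w_def[symmetric]
    by (subst (asm) ennreal_le_iff) (auto simp: w_def)
qed

end

section \<open>Exponential moments along one step\<close>

lemma exp_mean_le:
  fixes u :: "nat \<Rightarrow> real" assumes "1 \<le> N"
  shows "exp ((\<Sum>i=1..N. u i) / N) \<le> (\<Sum>i=1..N. exp (u i)) / N"
proof -
  have "exp (\<Sum>i\<in>{1..N}. (1 / real N) *\<^sub>R u i) \<le> (\<Sum>i\<in>{1..N}. 1 / real N * exp (u i))"
    using assms by (intro convex_on_sum[OF _ _ exp_convex]) auto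
  then show ?thesis by (simp add: sum_divide_distrib)
qed

text \<open>The tangent of \<open>exp\<close> at the weighted mean lies below \<open>exp\<close>;
  the tangent inequalities at the three points are averaged.\<close>

lemma exp_convex3:
  fixes a b c u v w :: real
  assumes "0 \<le> a" "0 \<le> b" "0 \<le> c" "a + b + c = 1"
  shows "exp (a * u + b * v + c * w) \<le> a * exp u + b * exp v + c * exp w"
proof -
  define t where "t = a * u + b * v + c * w"
  have tangent: "exp t * (1 + (x - t)) \<le> exp x" for x
  proof -
    have "exp t * (1 + (x - t)) \<le> exp t * exp (x - t)" by (intro mult_left_mono) (auto simp: exp_ge_add_one_self)
    then show ?thesis by (simp add: exp_add[symmetric])
  qed
  have "exp t = exp t * ((a + b + c) + (t - (a + b + c) * t))" using assms(4) by simp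
  also have "\<dots> = a * (exp t * (1 + (u - t))) + b * (exp t * (1 + (v - t))) + c * (exp t * (1 + (w - t)))"
    by (simp add: t_def algebra_simps)
  also have "\<dots> \<le> a * exp u + b * exp v + c * exp w"
    using assms by (intro add_mono mult_left_mono tangent)
  finally show ?thesis by (simp add: t_def)
qed

text \<open>Half of the exponent absorbs the linear factor \<open>r\<close>; the other half, since
  \<open>r \<ge> R\<close>, supplies the decay in \<open>R\<close>.\<close>

lemma tail_le_exp:
  fixes r b R :: real
  assumes "0 < b" "R \<le> r" "0 \<le> r"
  shows "r \<le> 2 / b * exp (- b * R / 2) * exp (b * r)"
proof -
  have "b * r / 2 \<le> exp (b * r / 2)" using exp_ge_add_one_self[of "b * r / 2"] by linarith
  then have "r \<le> 2 / b * exp (b * r / 2)" using assms(1) by (simp add: field_simps)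
  also have "\<dots> \<le> 2 / b * (exp (- b * R / 2) * exp (b * r))"
    using assms by (intro mult_left_mono) (auto simp: exp_add[symmetric] field_simps)
  finally show ?thesis by (simp only: mult.assoc)
qed

context mean_field
begin

text \<open>State and noise are separate arguments, so that the state can be frozen while the noise
  is integrated.\<close>

definition step :: "nat \<Rightarrow> (nat \<Rightarrow> real^'d) \<Rightarrow> (nat \<Rightarrow> real^'m) \<Rightarrow> nat \<Rightarrow> real^'d" where
  "step N x e i = jump (x i) (empirical N x) (e i)"

lemma particle_Suc_step:
  "particle A \<delta> f X0 eps (Suc n) N w = step N (particle A \<delta> f X0 eps n N w) (\<lambda>i. eps (Suc n) i w)"
  by (simp add: step_def fun_eq_iff)

definition noise :: "nat \<Rightarrow> (nat \<Rightarrow> real^'m) measure" where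
  "noise N = PiM {1..N} (\<lambda>_. \<theta>)"

lemma prob_space_noise: "prob_space (noise N)"
  unfolding noise_def by (intro prob_space_PiM theta)

lemma sets_noise[measurable_cong]: "sets (noise N) = sets (PiM {1..N} (\<lambda>_. borel))"
  unfolding noise_def by (intro sets_PiM_cong) (auto simp: theta)

lemma noise_component: "i \<in> {1..N} \<Longrightarrow> distr (noise N) \<theta> (\<lambda>e. e i) = \<theta>"
proof -
  interpret product_prob_space "\<lambda>_. \<theta>" "{1..N}" ..
  show "i \<in> {1..N} \<Longrightarrow> distr (noise N) \<theta> (\<lambda>e. e i) = \<theta>" unfolding noise_def by (rule PiM_component)
qed

lemma indep_noise: "1 \<le> N \<Longrightarrow> prob_space.indep_vars (noise N) (\<lambda>_. \<theta>) (\<lambda>i e. e i) {1..N}"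
proof -
  assume N: "1 \<le> N"
  interpret P: prob_space "noise N" by (rule prob_space_noise)
  have "distr (noise N) (PiM {1..N} (\<lambda>_. \<theta>)) (\<lambda>x. \<lambda>i\<in>{1..N}. x i) = distr (noise N) (noise N) (\<lambda>x. x)"
    by (rule distr_cong) (auto simp: noise_def space_PiM PiE_restrict)
  also have "\<dots> = noise N" by (rule distr_id)
  also have "\<dots> = PiM {1..N} (\<lambda>i. distr (noise N) \<theta> (\<lambda>e. e i))"
    unfolding noise_def[of N] by (intro PiM_cong refl) (rule noise_component[symmetric, unfolded noise_def])
  finally show ?thesis using N
    by (subst P.indep_vars_iff_distr_eq_PiM') (auto simp: noise_def)
qed

lemma step_measurable_pair:
  assumes "1 \<le> N" "i \<in> {1..N}"
  shows "(\<lambda>(x, e). step N x e i) \<in> borel_measurable (PiM {1..N} (\<lambda>_. borel) \<Otimes>\<^sub>M noise N)"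
proof -
  have coord: "(\<lambda>r. fst r j) \<in> borel_measurable (PiM {1..N} (\<lambda>_. borel) \<Otimes>\<^sub>M noise N)" 
    "(\<lambda>r. snd r j) \<in> borel_measurable (PiM {1..N} (\<lambda>_. borel) \<Otimes>\<^sub>M noise N)"
    if "j \<in> {1..N}" for j using that by measurable
  have "(\<lambda>r. empirical N (fst r)) \<in> PiM {1..N} (\<lambda>_. borel) \<Otimes>\<^sub>M noise N \<rightarrow>\<^sub>M restrict_space (subprob_algebra borel) P1"
    by (rule empirical_measurable[OF assms(1), of "\<lambda>i r. fst r i"]) (rule coord)
  then have [measurable]: "(\<lambda>r. f (fst r i) (empirical N (fst r)) (snd r i)) \<in> borel_measurable (PiM {1..N} (\<lambda>_. borel) \<Otimes>\<^sub>M noise N)"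
    by (intro f_measurable coord assms(2))
  note [measurable] = coord[OF assms(2)]
  show ?thesis unfolding step_def split_beta' by measurable
qed

lemma f_step_measurable:
  assumes "1 \<le> N"
  shows "(\<lambda>z. jump (x i) (empirical N x) z) \<in> borel_measurable \<theta>"
proof -
  note [measurable] = f_measurable_const[OF empirical_in_P1[OF assms], of "\<lambda>_. x i" \<theta> "\<lambda>z. z" x]
  show ?thesis by measurable
qed

lemma step_measurable:
  assumes "1 \<le> N" "i \<in> {1..N}"
  shows "(\<lambda>e. step N x e i) \<in> borel_measurable (noise N)"
proof -
  have "(\<lambda>e. e i) \<in> noise N \<rightarrow>\<^sub>M \<theta>" using assms(2) unfolding noise_def by measurable
  from measurable_compose[OF this f_step_measurable[OF assms(1)]] show ?thesis by (simp add: step_def)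
qed

lemma nn_integral_step:
  assumes "1 \<le> N" "i \<in> {1..N}" and [measurable]: "g \<in> borel_measurable borel"
  shows "(\<integral>\<^sup>+e. g (step N x e i) \<partial>noise N) = (\<integral>\<^sup>+z. g (jump (x i) (empirical N x) z) \<partial>\<theta>)"
proof -
  note [measurable] = f_step_measurable[OF assms(1)]
  have [measurable]: "(\<lambda>e. e i) \<in> noise N \<rightarrow>\<^sub>M \<theta>" using assms(2) unfolding noise_def by measurable
  have "(\<integral>\<^sup>+z. g (jump (x i) (empirical N x) z) \<partial>\<theta>) = (\<integral>\<^sup>+z. g (jump (x i) (empirical N x) z) \<partial>distr (noise N) \<theta> (\<lambda>e. e i))"
    by (simp add: noise_component[OF assms(2)])
  also have "\<dots> = (\<integral>\<^sup>+e. g (step N x e i) \<partial>noise N)" by (subst nn_integral_distr) (auto simp: step_def)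
  finally show ?thesis by simp
qed

lemma nn_integral_noise_sum:
  assumes "1 \<le> N" and [measurable]: "g \<in> borel_measurable borel"
  shows "(\<integral>\<^sup>+e. (\<Sum>i=1..N. c * g (step N x e i)) \<partial>noise N) = (\<Sum>i=1..N. c * (\<integral>\<^sup>+e. g (step N x e i) \<partial>noise N))"
proof -
  have m: "(\<lambda>e. g (step N x e i)) \<in> borel_measurable (noise N)" if "i \<in> {1..N}" for i
    by (rule measurable_compose[OF step_measurable[OF assms(1) that] assms(2)])
  show ?thesis
    by (subst nn_integral_sum) (use m in \<open>auto intro!: borel_measurable_times sum.cong nn_integral_cmult\<close>)
qed

text \<open>Integrating against the empirical measure is averaging over the particles, and each of
  them is driven by a noise of law \<theta>. This identifies the centring in Hoeffding's inequality
  and transfers \<open>Z_drift\<close> to the tails of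
  \<open>\<Psi> (empirical N x)\<close>.\<close>

lemma nn_integral_Psi_empirical:
  assumes N: "1 \<le> N" and g[measurable]: "g \<in> borel_measurable borel"
  shows "(\<integral>\<^sup>+y. g y \<partial>\<Psi> (empirical N x)) = (\<Sum>i=1..N. ennreal (1 / N) * (\<integral>\<^sup>+e. g (step N x e i) \<partial>noise N))"
proof -
  note P = empirical_in_P1[OF N, of x]
  interpret E: prob_space "empirical N x" by (rule prob_space_empirical[OF N])
  note m = Psi_map_measurable[OF P, of "empirical N x"]
  note [measurable] = f_measurable_const[OF P, of fst "borel \<Otimes>\<^sub>M \<theta>" snd]
  have "(\<integral>\<^sup>+y. g y \<partial>\<Psi> (empirical N x)) = (\<integral>\<^sup>+r. g (A *v fst r + \<delta> *\<^sub>R f (fst r) (empirical N x) (snd r)) \<partial>(empirical N x \<Otimes>\<^sub>M \<theta>))"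
    unfolding Psi_def using m by (subst nn_integral_distr) (auto simp: split_beta')
  also have "\<dots> = (\<integral>\<^sup>+y. \<integral>\<^sup>+z. g (jump y (empirical N x) z) \<partial>\<theta> \<partial>empirical N x)"
    by (subst \<theta>.nn_integral_fst[symmetric]) auto
  also have "\<dots> = (\<Sum>i=1..N. ennreal (1 / N) * (\<integral>\<^sup>+z. g (jump (x i) (empirical N x) z) \<partial>\<theta>))"
    by (rule nn_integral_empirical[OF N]) measurable
  also have "\<dots> = (\<Sum>i=1..N. ennreal (1 / N) * (\<integral>\<^sup>+e. g (step N x e i) \<partial>noise N))"
    by (intro sum.cong refl arg_cong2[where f="(*)"] nn_integral_step[symmetric, OF N]) auto
  finally show ?thesis .
qed

definition Z :: "nat \<Rightarrow> (nat \<Rightarrow> real^'d) \<Rightarrow> real" where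
  "Z N x = (\<Sum>i=1..N. exp (\<beta> * norm (x i))) / N"

lemma Z_nonneg[simp]: "0 \<le> Z N x" unfolding Z_def by (intro divide_nonneg_nonneg sum_nonneg) auto

definition CD where "CD = enn2real (\<integral>\<^sup>+z. ennreal (exp (\<beta> * \<delta> * D1 f z)) \<partial>\<theta>)"
text \<open>The value for which the factor \<open>CD\<close> equals
  \<open>exp ((1 - \<kappa>) * ln Cst)\<close>: it becomes a third point, of weight
  \<open>1 - \<kappa>\<close>, in a convex combination.\<close>

definition Cst where "Cst = exp (ln CD / (1 - \<kappa>))"

lemma CD: "(\<integral>\<^sup>+z. ennreal (exp (\<beta> * \<delta> * D1 f z)) \<partial>\<theta>) = ennreal CD" "1 \<le> CD"
proof -
  have "(\<integral>\<^sup>+z. ennreal (exp (\<beta> * \<delta> * D1 f z)) \<partial>\<theta>) \<le> (\<integral>\<^sup>+z. ennreal (exp (\<alpha> * D1 f z)) \<partial>\<theta>)"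
    using \<beta>_le(2) by (intro nn_integral_mono ennreal_leI) (auto simp: D1_def intro!: mult_right_mono)
  also have "\<dots> < \<infinity>" by (rule A6ii)
  finally show *: "(\<integral>\<^sup>+z. ennreal (exp (\<beta> * \<delta> * D1 f z)) \<partial>\<theta>) = ennreal CD"
    unfolding CD_def by simp
  have "1 = (\<integral>\<^sup>+z. 1 \<partial>\<theta>)" by (simp add: \<theta>.emeasure_space_1)
  also have "\<dots> \<le> (\<integral>\<^sup>+z. ennreal (exp (\<beta> * \<delta> * D1 f z)) \<partial>\<theta>)"
    using \<beta>_pos delta_nonneg by (intro nn_integral_mono) (auto simp: D1_def)
  finally show "1 \<le> CD" unfolding * by (simp add: ennreal_le_iff2 ennreal_1[symmetric] del: ennreal_1)
qed

text \<open>Estimating directly would leave the factor \<open>CD \<ge> 1\<close> in front and could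
  destroy the contraction. Since \<open>a + b = \<kappa> < 1\<close>, there is weight left to absorb
  \<open>CD\<close> by convexity, which turns it into an additive constant. The mean field term is
  handled by Jensen: \<open>exp (\<beta> * S) \<le> Z N x\<close>.\<close>

lemma Z_drift:
  assumes N: "1 \<le> N"
  shows "(\<integral>\<^sup>+e. ennreal (Z N (step N x e)) \<partial>noise N) \<le> ennreal (\<kappa> * Z N x + (1 - \<kappa>) * Cst)"
proof -
  define S where "S = (\<Sum>i=1..N. norm (x i)) / N"
  define a where "a = exp (-\<omega>) + \<delta> * M"
  define b where "b = \<delta> * M"
  have ab: "0 \<le> a" "0 \<le> b" "a + b = \<kappa>" using delta_nonneg A6i(1) by (auto simp: a_def b_def \<kappa>_def)
  have one: "(\<integral>\<^sup>+e. ennreal (exp (\<beta> * norm (step N x e i))) \<partial>noise N) \<le> ennreal (a * exp (\<beta> * norm (x i)) + b * exp (\<beta> * S) + (1 - \<kappa>) * Cst)"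
    if i: "i \<in> {1..N}" for i
  proof -
    have "(\<integral>\<^sup>+e. ennreal (exp (\<beta> * norm (step N x e i))) \<partial>noise N) = (\<integral>\<^sup>+z. ennreal (exp (\<beta> * norm (jump (x i) (empirical N x) z))) \<partial>\<theta>)"
      by (rule nn_integral_step[OF N i]) measurable
    also have "\<dots> \<le> (\<integral>\<^sup>+z. ennreal (exp (a * (\<beta> * norm (x i)) + b * (\<beta> * S))) * ennreal (exp (\<beta> * \<delta> * D1 f z)) \<partial>\<theta>)"
    proof (rule nn_integral_mono_AE, use f_growth in eventually_elim)
      case (elim z)
      have "norm (f (x i) (empirical N x) z) \<le> D1 f z + M * (norm (x i) + W1 (empirical N x) (return borel 0))"
        using elim empirical_in_P1[OF N] by auto
      also have "\<dots> \<le> D1 f z + M * (norm (x i) + S)"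
        using W1_empirical_return_le[OF N, of x] A6i(1) by (auto simp: S_def)
      finally have "norm (jump (x i) (empirical N x) z) \<le> exp (-\<omega>) * norm (x i) + \<delta> * (D1 f z + M * (norm (x i) + S))"
        using norm_A delta_nonneg by (intro norm_triangle_le add_mono) (auto intro!: mult_left_mono)
      then have "\<beta> * norm (jump (x i) (empirical N x) z) \<le> \<beta> * (exp (-\<omega>) * norm (x i) + \<delta> * (D1 f z + M * (norm (x i) + S)))"
        using \<beta>_pos by (intro mult_left_mono) auto
      also have "\<dots> = (a * (\<beta> * norm (x i)) + b * (\<beta> * S)) + \<beta> * \<delta> * D1 f z"
        by (simp add: a_def b_def algebra_simps)
      finally show ?case by (simp add: ennreal_mult[symmetric] exp_add[symmetric])
    qed
    also have "\<dots> = ennreal (exp (a * (\<beta> * norm (x i)) + b * (\<beta> * S)) * CD)"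
      using CD by (subst nn_integral_cmult) (auto simp: ennreal_mult)
    also have "exp (a * (\<beta> * norm (x i)) + b * (\<beta> * S)) * CD = exp (a * (\<beta> * norm (x i)) + b * (\<beta> * S) + (1 - \<kappa>) * (ln CD / (1 - \<kappa>)))"
      using CD(2) \<kappa> by (simp add: exp_add)
    also have "\<dots> \<le> a * exp (\<beta> * norm (x i)) + b * exp (\<beta> * S) + (1 - \<kappa>) * Cst"
      unfolding Cst_def using ab \<kappa> by (intro exp_convex3) auto
    finally show ?thesis by (simp add: ennreal_leI)
  qed
  have "(\<integral>\<^sup>+e. ennreal (Z N (step N x e)) \<partial>noise N) = (\<integral>\<^sup>+e. (\<Sum>i=1..N. ennreal (1 / N) * ennreal (exp (\<beta> * norm (step N x e i)))) \<partial>noise N)"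
    unfolding Z_def by (simp add: ennreal_mult[symmetric] sum_divide_distrib)
  also have "\<dots> = (\<Sum>i=1..N. ennreal (1 / N) * (\<integral>\<^sup>+e. ennreal (exp (\<beta> * norm (step N x e i))) \<partial>noise N))"
    by (rule nn_integral_noise_sum[OF N]) measurable
  also have "\<dots> \<le> (\<Sum>i=1..N. ennreal (1 / N) * ennreal (a * exp (\<beta> * norm (x i)) + b * exp (\<beta> * S) + (1 - \<kappa>) * Cst))"
    by (intro sum_mono mult_left_mono one) auto
  also have "\<dots> = ennreal (\<Sum>i=1..N. (a * exp (\<beta> * norm (x i)) + b * exp (\<beta> * S) + (1 - \<kappa>) * Cst) / N)"
  proof -
    have nn: "0 \<le> a * exp (\<beta> * norm (x i)) + b * exp (\<beta> * S) + (1 - \<kappa>) * Cst" for i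
      using ab \<kappa> by (auto simp: Cst_def intro!: add_nonneg_nonneg mult_nonneg_nonneg)
    show ?thesis
      by (simp only: ennreal_mult[symmetric] sum_ennreal divide_nonneg_nonneg nn of_nat_0_le_iff zero_le_one mult_nonneg_nonneg mult_1 times_divide_eq_left)
  qed
  also have "(\<Sum>i=1..N. (a * exp (\<beta> * norm (x i)) + b * exp (\<beta> * S) + (1 - \<kappa>) * Cst) / N) = a * Z N x + b * exp (\<beta> * S) + (1 - \<kappa>) * Cst"
    using N by (simp add: Z_def add_divide_distrib sum.distrib sum_distrib_left sum_divide_distrib)
  also have "exp (\<beta> * S) \<le> Z N x"
    using exp_mean_le[OF N, of "\<lambda>i. \<beta> * norm (x i)"] by (simp add: Z_def S_def sum_distrib_left)
  then have "a * Z N x + b * exp (\<beta> * S) + (1 - \<kappa>) * Cst \<le> a * Z N x + b * Z N x + (1 - \<kappa>) * Cst"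
    using ab by (intro add_right_mono add_left_mono mult_left_mono) auto
  also have "\<dots> = \<kappa> * Z N x + (1 - \<kappa>) * Cst" unfolding ab(3)[symmetric] by (simp add: algebra_simps)
  finally show ?thesis by (simp add: ennreal_leI)
qed

definition tail_const :: "real \<Rightarrow> real" where "tail_const R = 2 / \<beta> * exp (- \<beta> * R / 2)"

lemma tail_const_pos: "0 < tail_const R" using \<beta>_pos by (simp add: tail_const_def)

lemma tail_pointwise:
  assumes "U \<subseteq> {x. R \<le> norm x}"
  shows "ennreal (norm x) * indicator U x \<le> ennreal (tail_const R) * ennreal (exp (\<beta> * norm x))"
  using tail_le_exp[OF \<beta>_pos, of R "norm x"] assms tail_const_pos[of R]
  by (auto simp: tail_const_def ennreal_mult[symmetric] split: split_indicator intro!: ennreal_leI)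

lemma tail_empirical:
  assumes "1 \<le> N" "U \<subseteq> {x. R \<le> norm x}" and [measurable]: "U \<in> sets borel"
  shows "(\<integral>\<^sup>+y. ennreal (norm y) * indicator U y \<partial>empirical N x) \<le> ennreal (tail_const R * Z N x)"
proof -
  have "(\<integral>\<^sup>+y. ennreal (norm y) * indicator U y \<partial>empirical N x) \<le> (\<integral>\<^sup>+y. ennreal (tail_const R) * ennreal (exp (\<beta> * norm y)) \<partial>empirical N x)"
    by (intro nn_integral_mono tail_pointwise assms)
  also have "\<dots> = ennreal (tail_const R) * (\<Sum>i=1..N. ennreal (1 / N) * ennreal (exp (\<beta> * norm (x i))))"
    by (subst nn_integral_cmult, measurable) (simp add: nn_integral_empirical[OF assms(1)])
  also have "\<dots> = ennreal (tail_const R * Z N x)"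
    using tail_const_pos[of R] by (simp add: ennreal_mult[symmetric] Z_def sum_divide_distrib sum_nonneg)
  finally show ?thesis .
qed

lemma tail_Psi:
  assumes N: "1 \<le> N" and "U \<subseteq> {x. R \<le> norm x}" and [measurable]: "U \<in> sets borel"
  shows "(\<integral>\<^sup>+y. ennreal (norm y) * indicator U y \<partial>\<Psi> (empirical N x)) \<le> ennreal (tail_const R * (\<kappa> * Z N x + (1 - \<kappa>) * Cst))"
proof -
  have [measurable_cong]: "sets (\<Psi> (empirical N x)) = sets borel" by (simp add: Psi_def)
  have "(\<integral>\<^sup>+y. ennreal (norm y) * indicator U y \<partial>\<Psi> (empirical N x)) \<le> (\<integral>\<^sup>+y. ennreal (tail_const R) * ennreal (exp (\<beta> * norm y)) \<partial>\<Psi> (empirical N x))"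
    by (intro nn_integral_mono tail_pointwise assms)
  also have "\<dots> = ennreal (tail_const R) * (\<integral>\<^sup>+y. ennreal (exp (\<beta> * norm y)) \<partial>\<Psi> (empirical N x))"
    by (rule nn_integral_cmult) measurable
  also have "(\<integral>\<^sup>+y. ennreal (exp (\<beta> * norm y)) \<partial>\<Psi> (empirical N x)) = (\<Sum>i=1..N. ennreal (1 / N) * (\<integral>\<^sup>+e. ennreal (exp (\<beta> * norm (step N x e i))) \<partial>noise N))"
    by (rule nn_integral_Psi_empirical[OF N]) measurable
  also have "\<dots> = (\<integral>\<^sup>+e. (\<Sum>i=1..N. ennreal (1 / N) * ennreal (exp (\<beta> * norm (step N x e i)))) \<partial>noise N)"
    by (rule nn_integral_noise_sum[OF N, symmetric]) measurable
  also have "\<dots> = (\<integral>\<^sup>+e. ennreal (Z N (step N x e)) \<partial>noise N)"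
    unfolding Z_def by (simp add: ennreal_mult[symmetric] sum_divide_distrib)
  also have "\<dots> \<le> ennreal (\<kappa> * Z N x + (1 - \<kappa>) * Cst)" by (rule Z_drift[OF N])
  finally show ?thesis using tail_const_pos[of R] \<kappa> by (simp add: ennreal_mult mult_left_mono Cst_def)
qed

end

section \<open>Concentration of one step given the past\<close>

definition cells :: "nat \<Rightarrow> ('d::finite \<Rightarrow> int) set" where
  "cells m = (UNIV \<rightarrow>\<^sub>E {- int m..<int m})"

text \<open>Indexing half-open cubes by floors makes disjointness immediate and places every point
  in exactly one cube. A point missed by \<open>cells m\<close> therefore has a coordinate of
  modulus at least \<open>m * s\<close>.\<close>

definition cell :: "real \<Rightarrow> ('d::finite \<Rightarrow> int) \<Rightarrow> (real^'d) set" where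
  "cell s j = {x. \<forall>i. \<lfloor>x $ i / s\<rfloor> = j i}"

lemma finite_cells: "finite (cells m :: ('d::finite \<Rightarrow> int) set)"
  unfolding cells_def by (intro finite_PiE) auto

lemma card_cells: "card (cells m :: ('d::finite \<Rightarrow> int) set) = (2 * m) ^ CARD('d)"
proof -
  have "card {- int m..<int m} = 2 * m" by (simp add: nat_mult_distrib)
  then show ?thesis unfolding cells_def by (simp only: card_PiE finite prod_constant)
qed

lemma disjoint_cell: "disjoint_family_on (cell s) J"
  by (auto simp: disjoint_family_on_def cell_def fun_eq_iff)

lemma cell_borel[measurable]: "cell s j \<in> sets borel"
proof -
  have "cell s j = (\<Inter>i. {x \<in> space borel. \<lfloor>x $ i / s\<rfloor> = j i})" by (auto simp: cell_def)
  also have "\<dots> \<in> sets borel"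
  proof (intro sets.finite_INT)
    fix i
    have "(\<lambda>x::real^'a. x $ i) \<in> borel_measurable borel"
      by (intro borel_measurable_continuous_onI continuous_intros)
    then have "(\<lambda>x::real^'a. \<lfloor>x $ i / s\<rfloor>) \<in> borel \<rightarrow>\<^sub>M count_space UNIV" by measurable
    then show "{x \<in> space borel. \<lfloor>x $ i / s\<rfloor> = j i} \<in> sets borel" by (rule measurable_sets_Collect) simp
  qed simp_all
  finally show ?thesis .
qed

lemma cell_dist:
  fixes x y :: "real^'d" and s :: real
  assumes "0 < s" "x \<in> cell s j" "y \<in> cell s j"
  shows "dist x y \<le> CARD('d) * s"
proof -
  have "\<bar>(x - y) $ i\<bar> \<le> s" for i
  proof -
    have "\<lfloor>x $ i / s\<rfloor> = j i" "\<lfloor>y $ i / s\<rfloor> = j i" using assms(2,3) by (auto simp: cell_def)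
    then have "\<bar>x $ i / s - y $ i / s\<bar> \<le> 1" by linarith
    then have "\<bar>(x $ i - y $ i) / s\<bar> \<le> 1" by (simp add: diff_divide_distrib)
    then show ?thesis using assms(1) by (simp add: abs_divide field_simps)
  qed
  then have "(\<Sum>i\<in>UNIV. \<bar>(x - y) $ i\<bar>) \<le> (\<Sum>i\<in>(UNIV::'d set). s)" by (intro sum_mono) auto
  then show ?thesis using norm_le_l1_cart[of "x - y"] by (simp add: dist_norm)
qed

lemma cell_norm:
  fixes x :: "real^'d" and s :: real
  assumes "0 < s" "j \<in> cells m" "x \<in> cell s j"
  shows "norm x \<le> real CARD('d) * real m * s"
proof -
  have "\<bar>x $ i\<bar> \<le> m * s" for i
  proof -
    have "j i \<in> {- int m..<int m}" using assms(2) by (auto simp: cells_def)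
    moreover have "\<lfloor>x $ i / s\<rfloor> = j i" using assms(3) by (auto simp: cell_def)
    ultimately have "- int m \<le> \<lfloor>x $ i / s\<rfloor>" "\<lfloor>x $ i / s\<rfloor> < int m" by auto
    then have "- real m \<le> x $ i / s" "x $ i / s \<le> real m" by linarith+
    then show ?thesis using assms(1) by (simp add: abs_le_iff field_simps)
  qed
  then have "(\<Sum>i\<in>UNIV. \<bar>x $ i\<bar>) \<le> (\<Sum>i\<in>(UNIV::'d set). m * s)" by (intro sum_mono) auto
  then show ?thesis using norm_le_l1_cart[of x] by (simp add: mult.assoc)
qed

lemma outside_cells:
  fixes x :: "real^'d" and s :: real
  assumes "0 < s" "x \<in> - (\<Union>j\<in>cells m. cell s j)"
  shows "m * s \<le> norm x"
proof -
  define j where "j i = \<lfloor>x $ i / s\<rfloor>" for i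
  have "x \<in> cell s j" by (simp add: cell_def j_def)
  then have "j \<notin> cells m" using assms(2) by auto
  then obtain i where "\<not> (- int m \<le> j i \<and> j i < int m)"
    unfolding cells_def PiE_UNIV_domain Pi_iff atLeastLessThan_iff by blast
  then have "x $ i / s < - real m \<or> real m \<le> x $ i / s" unfolding j_def
    by linarith
  then have "m * s \<le> \<bar>x $ i\<bar>" using assms(1) by (auto simp: field_simps)
  also have "\<dots> \<le> norm x" by (rule component_le_norm_cart)
  finally show ?thesis .
qed

context mean_field
begin

lemma measure_Psi_empirical:
  assumes N: "1 \<le> N" and U[measurable]: "U \<in> sets borel"
  shows "measure (\<Psi> (empirical N x)) U = (\<Sum>i=1..N. measure (noise N) {e \<in> space (noise N). step N x e i \<in> U}) / N"
proof -
  interpret P: prob_space "noise N" by (rule prob_space_noise)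
  have s: "sets (\<Psi> (empirical N x)) = sets borel" by (simp add: Psi_def)
  have "emeasure (\<Psi> (empirical N x)) U = (\<integral>\<^sup>+y. indicator U y \<partial>\<Psi> (empirical N x))"
    using s by simp
  also have "\<dots> = (\<Sum>i=1..N. ennreal (1 / N) * (\<integral>\<^sup>+e. indicator U (step N x e i) \<partial>noise N))"
    by (rule nn_integral_Psi_empirical[OF N]) measurable
  also have "\<dots> = (\<Sum>i=1..N. ennreal (1 / N * measure (noise N) {e \<in> space (noise N). step N x e i \<in> U}))"
  proof (rule sum.cong[OF refl])
    fix i assume i: "i \<in> {1..N}"
    note [measurable] = step_measurable[OF N i]
    have "(\<integral>\<^sup>+e. indicator U (step N x e i) \<partial>noise N) = (\<integral>\<^sup>+e. indicator {e \<in> space (noise N). step N x e i \<in> U} e \<partial>noise N)"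
      by (intro nn_integral_cong) (auto split: split_indicator)
    also have "\<dots> = ennreal (measure (noise N) {e \<in> space (noise N). step N x e i \<in> U})"
      by (subst nn_integral_indicator) (auto simp: P.emeasure_eq_measure)
    finally show "ennreal (1 / N) * (\<integral>\<^sup>+e. indicator U (step N x e i) \<partial>noise N) = ennreal (1 / N * measure (noise N) {e \<in> space (noise N). step N x e i \<in> U})"
      by (simp add: ennreal_mult[symmetric])
  qed
  also have "\<dots> = ennreal ((\<Sum>i=1..N. measure (noise N) {e \<in> space (noise N). step N x e i \<in> U}) / N)"
    by (subst sum_ennreal) (auto simp: sum_divide_distrib)
  finally show ?thesis unfolding measure_def[of "\<Psi> (empirical N x)"] by (simp add: sum_nonneg)
qed

abbreviation gap :: "nat \<Rightarrow> (nat \<Rightarrow> real^'d) \<Rightarrow> (nat \<Rightarrow> real^'m) \<Rightarrow> (real^'d) set \<Rightarrow> real" where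
  "gap N x e U \<equiv> \<bar>measure (empirical N (step N x e)) U - measure (\<Psi> (empirical N x)) U\<bar>"

text \<open>For frozen \<open>x\<close> the indicators are independent under \<open>noise N\<close>,
  though in general not identically distributed. By \<open>measure_Psi_empirical\<close> their
  expectations sum to \<open>N\<close> times the mass of \<open>U\<close> under
  \<open>\<Psi> (empirical N x)\<close>, so the gap is a centred mean.\<close>

lemma hoeffding_step:
  assumes N: "1 \<le> N" and U[measurable]: "U \<in> sets borel" and t: "0 \<le> t"
  shows "measure (noise N) {e \<in> space (noise N). t < gap N x e U}
     \<le> 2 * exp (- 2 * real N * t\<^sup>2)"
proof -
  interpret P: prob_space "noise N" by (rule prob_space_noise)
  define X where "X i e = indicat_real U (step N x e i)" for i e
  have m: "(\<lambda>e. step N x e i) \<in> borel_measurable (noise N)" if "i \<in> {1..N}" for i by (rule step_measurable[OF N that])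
  have Xm: "X i \<in> borel_measurable (noise N)" if "i \<in> {1..N}" for i unfolding X_def using m[OF that] by measurable
  define \<mu> where "\<mu> = (\<Sum>i\<in>{1..N}. P.expectation (X i))"
  interpret H: Hoeffding_ineq "noise N" "{1..N}" X "\<lambda>_. 0" "\<lambda>_. 1" \<mu>
  proof unfold_locales
    have "P.indep_vars (\<lambda>_. borel) (\<lambda>i e. indicat_real U (jump (x i) (empirical N x) (e i))) {1..N}"
      by (rule P.indep_vars_compose2[OF indep_noise[OF N], where Y="\<lambda>i z. indicat_real U (jump (x i) (empirical N x) z)"])
        (rule measurable_compose[OF f_step_measurable[OF N] borel_measurable_indicator[OF U]])
    moreover have "X = (\<lambda>i e. indicat_real U (jump (x i) (empirical N x) (e i)))"
      unfolding X_def step_def by (rule refl)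
    ultimately show "P.indep_vars (\<lambda>_. borel) X {1..N}" by (simp only:)
    show "AE e in noise N. X i e \<in> {0..1}" for i by (auto simp: X_def split: split_indicator)
  qed (auto simp: \<mu>_def)
  have exp: "P.expectation (X i) = measure (noise N) {e \<in> space (noise N). step N x e i \<in> U}" if i: "i \<in> {1..N}" for i
  proof -
    note [measurable] = m[OF i]
    have "P.expectation (X i) = P.expectation (indicat_real {e \<in> space (noise N). step N x e i \<in> U})"
      unfolding X_def by (intro Bochner_Integration.integral_cong) (auto split: split_indicator)
    then show ?thesis by simp
  qed
  have \<mu>: "\<mu> = N * measure (\<Psi> (empirical N x)) U"
    unfolding measure_Psi_empirical[OF N U] \<mu>_def using N exp by (simp cong: sum.cong_simp)
  have emp: "(\<Sum>i\<in>{1..N}. X i e) = N * measure (empirical N (step N x e)) U" for e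
    unfolding measure_empirical[OF N U] X_def using N by simp
  have "P.prob {e \<in> space (noise N). t < gap N x e U}
    \<le> P.prob {e \<in> space (noise N). N * t \<le> \<bar>(\<Sum>i\<in>{1..N}. X i e) - \<mu>\<bar>}"
  proof (rule P.finite_measure_mono)
    show "{e \<in> space (noise N). N * t \<le> \<bar>(\<Sum>i\<in>{1..N}. X i e) - \<mu>\<bar>} \<in> P.events"
      using Xm by measurable
    show "{e \<in> space (noise N). t < gap N x e U}
      \<subseteq> {e \<in> space (noise N). N * t \<le> \<bar>(\<Sum>i\<in>{1..N}. X i e) - \<mu>\<bar>}"
      unfolding emp \<mu> right_diff_distrib[symmetric] abs_mult by (auto intro!: mult_left_mono)
  qed
  also have "\<dots> \<le> 2 * exp (- 2 * (real N * t)\<^sup>2 / (\<Sum>i\<in>{1..N}. (1 - 0)\<^sup>2))"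
    using N t by (intro H.Hoeffding_ineq_abs_ge) auto
  also have "\<dots> = 2 * exp (- 2 * real N * t\<^sup>2)"
    using N by (simp add: power2_eq_square)
  finally show ?thesis .
qed

text \<open>Off this event \<open>sum_abs_diff_le\<close> bounds the total variation over the cells
  by \<open>2 * t\<close>. There are finitely many unions, so a union bound applies.\<close>

definition bad :: "nat \<Rightarrow> real \<Rightarrow> nat \<Rightarrow> real \<Rightarrow> (nat \<Rightarrow> real^'d) \<Rightarrow> (nat \<Rightarrow> real^'m) \<Rightarrow> bool" where
  "bad N s m t x e \<longleftrightarrow> (\<exists>S\<subseteq>cells m. t < gap N x e (\<Union>j\<in>S. cell s j))"

lemma Un_cells_borel: "S \<subseteq> cells m \<Longrightarrow> (\<Union>j\<in>S. cell s j :: (real^'d) set) \<in> sets borel"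
  using finite_subset[OF _ finite_cells[of m]] by (intro sets.finite_UN) auto

lemma prob_bad:
  assumes N: "1 \<le> N" and t: "0 \<le> t"
  shows "measure (noise N) {e \<in> space (noise N). bad N s m t x e} \<le> 2 * 2 ^ ((2 * m) ^ CARD('d)) * exp (- 2 * real N * t\<^sup>2)"
proof -
  interpret P: prob_space "noise N" by (rule prob_space_noise)
  define B where "B S = {e \<in> space (noise N). t < gap N x e (\<Union>j\<in>S. cell s j)}" for S
  have sets: "B S \<in> P.events" if "S \<subseteq> cells m" for S
  proof -
    have [measurable]: "(\<lambda>e. indicat_real (\<Union>j\<in>S. cell s j) (step N x e i)) \<in> borel_measurable (noise N)" if "i \<in> {1..N}" for i
      using Un_cells_borel[OF \<open>S \<subseteq> cells m\<close>] step_measurable[OF N that] by measurable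
    show ?thesis unfolding B_def measure_empirical[OF N Un_cells_borel[OF that]] by measurable
  qed
  have "measure (noise N) {e \<in> space (noise N). bad N s m t x e} = measure (noise N) (\<Union>S\<in>Pow (cells m). B S)"
    by (rule arg_cong[of _ _ "measure (noise N)"]) (auto simp: bad_def B_def)
  also have "\<dots> \<le> (\<Sum>S\<in>Pow (cells m). measure (noise N) (B S))"
    using sets finite_cells[of m] by (intro P.finite_measure_subadditive_finite) auto
  also have "\<dots> \<le> (\<Sum>S\<in>Pow (cells m :: ('d \<Rightarrow> int) set). 2 * exp (- 2 * real N * t\<^sup>2))"
    unfolding B_def by (intro sum_mono hoeffding_step N t Un_cells_borel) auto
  also have "\<dots> = 2 * 2 ^ ((2 * m) ^ CARD('d)) * exp (- 2 * real N * t\<^sup>2)"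
    by (simp add: card_Pow finite_cells card_cells)
  finally show ?thesis .
qed

text \<open>A pointwise consequence of \<open>W1_le_cells\<close>. The tail terms stay expressed
  through \<open>Z\<close>: one depends on the new state, the other only on the old one, and
  Markov's inequality treats both later.\<close>

lemma W1_step_le:
  fixes s t :: real
  assumes N: "1 \<le> N" and s: "0 < s" and good: "\<not> bad N s m t x e"
  shows "W1 (empirical N (step N x e)) (\<Psi> (empirical N x)) \<le>
    real CARD('d) * s + real CARD('d) * real m * s * (2 * t) + tail_const (m * s) * Z N (step N x e) + tail_const (m * s) * (\<kappa> * Z N x + (1 - \<kappa>) * Cst)"
proof -
  let ?\<mu> = "empirical N (step N x e)" and ?\<nu> = "\<Psi> (empirical N x)"
  let ?U = "- (\<Union>j\<in>cells m. cell s j) :: (real^'d) set"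
  have P: "?\<mu> \<in> P1" "?\<nu> \<in> P1" by (auto intro!: empirical_in_P1 N Psi_in_P1)
  have U: "?U \<subseteq> {x. m * s \<le> norm x}" "?U \<in> sets borel"
    subgoal using outside_cells[OF s] by auto
    subgoal by (intro borel_comp Un_cells_borel[OF order_refl])
    done
  have sum: "(\<Sum>j\<in>cells m. \<bar>measure ?\<mu> (cell s j) - measure ?\<nu> (cell s j)\<bar>) \<le> 2 * t"
  proof (rule sum_abs_diff_le)
    show "\<bar>measure ?\<mu> (\<Union>j\<in>S. cell s j) - measure ?\<nu> (\<Union>j\<in>S. cell s j)\<bar> \<le> t" if "S \<subseteq> cells m" for S :: "('d \<Rightarrow> int) set"
    proof (rule ccontr)
      assume "\<not> \<bar>measure ?\<mu> (\<Union>j\<in>S. cell s j) - measure ?\<nu> (\<Union>j\<in>S. cell s j)\<bar> \<le> t"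
      with that have "bad N s m t x e" unfolding bad_def by (intro exI[of _ S] conjI) (simp_all only: not_le)
      with good show False by contradiction
    qed
    show "finite_measure ?\<mu>" "finite_measure ?\<nu>"
      using P1D(1)[OF P(1)] P1D(1)[OF P(2)] by (auto simp: prob_space.finite_measure)
  qed (simp_all add: finite_cells disjoint_cell P1D(2)[OF P(2)])
  have t0: "0 \<le> t"
    using order_trans[OF sum_nonneg[of "cells m" "\<lambda>j. \<bar>measure ?\<mu> (cell s j) - measure ?\<nu> (cell s j)\<bar>"] sum] by simp
  have Zs: "0 \<le> tail_const (m * s) * Z N (step N x e)" "0 \<le> tail_const (m * s) * (\<kappa> * Z N x + (1 - \<kappa>) * Cst)"
    using tail_const_pos[of "m * s"] \<kappa> by (auto simp: Cst_def intro!: mult_nonneg_nonneg add_nonneg_nonneg)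
  have "ennreal (W1 ?\<mu> ?\<nu>) \<le> ennreal (real CARD('d) * s + real CARD('d) * real m * s * (\<Sum>j\<in>cells m. \<bar>measure ?\<mu> (cell s j) - measure ?\<nu> (cell s j)\<bar>))
      + (\<integral>\<^sup>+x. ennreal (norm x) * indicator ?U x \<partial>?\<mu>) + (\<integral>\<^sup>+x. ennreal (norm x) * indicator ?U x \<partial>?\<nu>)"
    using s by (intro W1_le_cells P) (auto simp: finite_cells disjoint_cell intro: cell_dist cell_norm)
  also have "\<dots> \<le> ennreal (real CARD('d) * s + real CARD('d) * real m * s * (2 * t)) + ennreal (tail_const (m * s) * Z N (step N x e)) + ennreal (tail_const (m * s) * (\<kappa> * Z N x + (1 - \<kappa>) * Cst))"
    using s sum by (intro add_mono ennreal_leI tail_empirical[OF N U] tail_Psi[OF N U] mult_left_mono) auto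
  also have "\<dots> = ennreal (real CARD('d) * s + real CARD('d) * real m * s * (2 * t) + tail_const (m * s) * Z N (step N x e) + tail_const (m * s) * (\<kappa> * Z N x + (1 - \<kappa>) * Cst))"
    using t0 s Zs by (simp add: ennreal_plus[symmetric] del: ennreal_plus)
  finally show ?thesis
    using t0 s Zs by (subst (asm) ennreal_le_iff) auto
qed

end

section \<open>The particle system\<close>

text \<open>The library constant for a pair of independent variables forces both to have the same value type.\<close>
definition indep_pair :: "'w measure \<Rightarrow> 'a measure \<Rightarrow> ('w \<Rightarrow> 'a) \<Rightarrow> 'b measure \<Rightarrow> ('w \<Rightarrow> 'b) \<Rightarrow> bool" where
  "indep_pair M S X T Y \<longleftrightarrow> X \<in> M \<rightarrow>\<^sub>M S \<and> Y \<in> M \<rightarrow>\<^sub>M T \<and>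
     distr M S X \<Otimes>\<^sub>M distr M T Y = distr M (S \<Otimes>\<^sub>M T) (\<lambda>w. (X w, Y w))"

lemma (in prob_space) indep_pair_of_indep_set:
  assumes X[measurable]: "X \<in> M \<rightarrow>\<^sub>M S" and Y[measurable]: "Y \<in> M \<rightarrow>\<^sub>M T"
    and ind: "indep_set (sets (vimage_algebra (space M) X S)) (sets (vimage_algebra (space M) Y T))"
  shows "indep_pair M S X T Y"
proof -
  interpret PX: prob_space "distr M S X" by (rule prob_space_distr) fact
  interpret PY: prob_space "distr M T Y" by (rule prob_space_distr) fact
  have "distr M S X \<Otimes>\<^sub>M distr M T Y = distr M (S \<Otimes>\<^sub>M T) (\<lambda>w. (X w, Y w))"
  proof (rule pair_measure_eqI)
    fix A B assume "A \<in> sets (distr M S X)" "B \<in> sets (distr M T Y)"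
    then have AB[measurable]: "A \<in> sets S" "B \<in> sets T" by auto
    have "prob ((X -` A \<inter> space M) \<inter> (Y -` B \<inter> space M)) = prob (X -` A \<inter> space M) * prob (Y -` B \<inter> space M)"
      using ind AB by (intro indep_setD[OF ind]) (auto simp: sets_vimage_algebra intro!: sigma_sets.Basic)
    moreover have "(\<lambda>w. (X w, Y w)) -` (A \<times> B) \<inter> space M = (X -` A \<inter> space M) \<inter> (Y -` B \<inter> space M)" by auto
    ultimately show "emeasure (distr M S X) A * emeasure (distr M T Y) B = emeasure (distr M (S \<Otimes>\<^sub>M T) (\<lambda>w. (X w, Y w))) (A \<times> B)"
      by (simp add: emeasure_distr emeasure_eq_measure ennreal_mult)
  qed (auto intro: PX.sigma_finite_measure PY.sigma_finite_measure cong: sets_pair_measure_cong)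
  then show ?thesis by (simp add: indep_pair_def X Y)
qed

lemma (in prob_space) indep_pair_compose:
  assumes "indep_pair M S X T Y" and f[measurable]: "f \<in> S \<rightarrow>\<^sub>M S'" and g[measurable]: "g \<in> T \<rightarrow>\<^sub>M T'"
  shows "indep_pair M S' (\<lambda>w. f (X w)) T' (\<lambda>w. g (Y w))"
proof -
  have X[measurable]: "X \<in> M \<rightarrow>\<^sub>M S" and Y[measurable]: "Y \<in> M \<rightarrow>\<^sub>M T"
    and d: "distr M S X \<Otimes>\<^sub>M distr M T Y = distr M (S \<Otimes>\<^sub>M T) (\<lambda>w. (X w, Y w))"
    using assms(1) by (auto simp: indep_pair_def)
  interpret P: prob_space "distr M T' (\<lambda>w. g (Y w))" by (rule prob_space_distr) measurable
  have s: "sigma_finite_measure (distr (distr M T Y) T' g)"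
    by (simp add: distr_distr comp_def P.sigma_finite_measure_axioms)
  have "distr M S' (\<lambda>w. f (X w)) \<Otimes>\<^sub>M distr M T' (\<lambda>w. g (Y w)) = distr (distr M S X) S' f \<Otimes>\<^sub>M distr (distr M T Y) T' g"
    by (simp add: distr_distr comp_def)
  also have "\<dots> = distr (distr M S X \<Otimes>\<^sub>M distr M T Y) (S' \<Otimes>\<^sub>M T') (\<lambda>(x, y). (f x, g y))"
    by (rule pair_measure_distr[OF _ _ s]) auto
  also have "\<dots> = distr M (S' \<Otimes>\<^sub>M T') (\<lambda>w. (f (X w), g (Y w)))"
    unfolding d by (subst distr_distr) (auto simp: comp_def)
  finally show ?thesis by (simp add: indep_pair_def)
qed

text \<open>Both hypotheses together make the law of the triple a product, and Fubini allows the
  brackets to be moved. It is applied to the initial data, the past noises and the next noises, in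
  this order.\<close>

lemma (in prob_space) indep_pair_assoc:
  fixes X :: "'a \<Rightarrow> 'b" and Y :: "'a \<Rightarrow> 'c" and W :: "'a \<Rightarrow> 'd"
  assumes XYW: "indep_pair M S X (T \<Otimes>\<^sub>M U) (\<lambda>w. (Y w, W w))" and YW: "indep_pair M T Y U W"
  shows "indep_pair M (S \<Otimes>\<^sub>M T) (\<lambda>w. (X w, Y w)) U W"
proof -
  have rv[measurable]: "X \<in> M \<rightarrow>\<^sub>M S" "Y \<in> M \<rightarrow>\<^sub>M T" "W \<in> M \<rightarrow>\<^sub>M U"
    using XYW YW by (auto simp: indep_pair_def)
  have XY: "indep_pair M S X T Y"
    using indep_pair_compose[OF XYW, of "\<lambda>x. x" S fst T] by simp
  interpret PX: prob_space "distr M S X" by (rule prob_space_distr) fact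
  interpret PY: prob_space "distr M T Y" by (rule prob_space_distr) fact
  interpret PW: prob_space "distr M U W" by (rule prob_space_distr) fact
  interpret YW: pair_prob_space "distr M T Y" "distr M U W" ..
  interpret XY: pair_prob_space "distr M S X" "distr M T Y" ..
  have dXY: "distr M (S \<Otimes>\<^sub>M T) (\<lambda>w. (X w, Y w)) = distr M S X \<Otimes>\<^sub>M distr M T Y"
    using XY unfolding indep_pair_def by simp
  have dYW: "distr M (T \<Otimes>\<^sub>M U) (\<lambda>w. (Y w, W w)) = distr M T Y \<Otimes>\<^sub>M distr M U W"
    using YW unfolding indep_pair_def by simp
  have dXYW: "distr M (S \<Otimes>\<^sub>M (T \<Otimes>\<^sub>M U)) (\<lambda>w. (X w, (Y w, W w))) = distr M S X \<Otimes>\<^sub>M (distr M T Y \<Otimes>\<^sub>M distr M U W)"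
    using XYW unfolding indep_pair_def by (simp add: dYW)
  have "(distr M S X \<Otimes>\<^sub>M distr M T Y) \<Otimes>\<^sub>M distr M U W = distr M ((S \<Otimes>\<^sub>M T) \<Otimes>\<^sub>M U) (\<lambda>w. ((X w, Y w), W w))"
  proof (rule measure_eqI)
    show "sets ((distr M S X \<Otimes>\<^sub>M distr M T Y) \<Otimes>\<^sub>M distr M U W) = sets (distr M ((S \<Otimes>\<^sub>M T) \<Otimes>\<^sub>M U) (\<lambda>w. ((X w, Y w), W w)))"
      by (simp cong: sets_pair_measure_cong)
    fix C assume "C \<in> sets ((distr M S X \<Otimes>\<^sub>M distr M T Y) \<Otimes>\<^sub>M distr M U W)"
    also have "\<dots> = sets ((S \<Otimes>\<^sub>M T) \<Otimes>\<^sub>M U)" by (simp cong: sets_pair_measure_cong)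
    finally have C[measurable]: "C \<in> sets ((S \<Otimes>\<^sub>M T) \<Otimes>\<^sub>M U)" .
    define h :: "'b \<times> 'c \<times> 'd \<Rightarrow> ennreal" where "h = (\<lambda>(x, y, w). indicator C ((x, y), w))"
    have h[measurable]: "h \<in> borel_measurable (S \<Otimes>\<^sub>M (T \<Otimes>\<^sub>M U))" unfolding h_def split_beta' by measurable
    have "emeasure ((distr M S X \<Otimes>\<^sub>M distr M T Y) \<Otimes>\<^sub>M distr M U W) C = (\<integral>\<^sup>+p. \<integral>\<^sup>+w. indicator C (p, w) \<partial>distr M U W \<partial>(distr M S X \<Otimes>\<^sub>M distr M T Y))"
      by (subst PW.nn_integral_fst) (auto simp: nn_integral_indicator)
    also have "\<dots> = (\<integral>\<^sup>+x. \<integral>\<^sup>+y. \<integral>\<^sup>+w. indicator C ((x, y), w) \<partial>distr M U W \<partial>distr M T Y \<partial>distr M S X)"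
      by (subst PY.nn_integral_fst[symmetric]) auto
    also have "\<dots> = (\<integral>\<^sup>+x. \<integral>\<^sup>+q. h (x, q) \<partial>(distr M T Y \<Otimes>\<^sub>M distr M U W) \<partial>distr M S X)"
    proof (rule nn_integral_cong)
      fix x assume "x \<in> space (distr M S X)"
      then have [measurable]: "x \<in> space S" by simp
      have [measurable]: "(\<lambda>q. h (x, q)) \<in> borel_measurable (T \<Otimes>\<^sub>M U)" by measurable
      show "(\<integral>\<^sup>+y. \<integral>\<^sup>+w. indicator C ((x, y), w) \<partial>distr M U W \<partial>distr M T Y) = (\<integral>\<^sup>+q. h (x, q) \<partial>(distr M T Y \<Otimes>\<^sub>M distr M U W))"
        by (subst PW.nn_integral_fst[symmetric]) (auto simp: h_def)
    qed
    also have "\<dots> = (\<integral>\<^sup>+r. h r \<partial>(distr M S X \<Otimes>\<^sub>M (distr M T Y \<Otimes>\<^sub>M distr M U W)))"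
      by (subst YW.nn_integral_fst) auto
    also have "\<dots> = (\<integral>\<^sup>+w. h (X w, Y w, W w) \<partial>M)"
      unfolding dXYW[symmetric] by (subst nn_integral_distr) auto
    also have "\<dots> = (\<integral>\<^sup>+r. indicator C r \<partial>distr M ((S \<Otimes>\<^sub>M T) \<Otimes>\<^sub>M U) (\<lambda>w. ((X w, Y w), W w)))"
      by (subst nn_integral_distr) (auto simp: h_def)
    also have "\<dots> = emeasure (distr M ((S \<Otimes>\<^sub>M T) \<Otimes>\<^sub>M U) (\<lambda>w. ((X w, Y w), W w))) C" by simp
    finally show "emeasure ((distr M S X \<Otimes>\<^sub>M distr M T Y) \<Otimes>\<^sub>M distr M U W) C = emeasure (distr M ((S \<Otimes>\<^sub>M T) \<Otimes>\<^sub>M U) (\<lambda>w. ((X w, Y w), W w))) C" .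
  qed
  then show ?thesis unfolding indep_pair_def by (simp add: dXY)
qed

locale particle_system = mean_field A \<delta> \<omega> M \<alpha> \<theta> f
  for A :: "real^'d^'d" and \<delta> \<omega> M \<alpha> :: real and \<theta> :: "(real^'m) measure"
    and f :: "real^'d \<Rightarrow> (real^'d) measure \<Rightarrow> real^'m \<Rightarrow> real^'d" +
  fixes \<mu>0 :: "(real^'d) measure" and Pr :: "'w measure"
    and X0 :: "nat \<Rightarrow> nat \<Rightarrow> 'w \<Rightarrow> real^'d"
    and eps :: "nat \<Rightarrow> nat \<Rightarrow> 'w \<Rightarrow> real^'m"
  assumes mu0: "\<mu>0 \<in> P1"
    and mu0_exp: "(\<integral>\<^sup>+ x. ennreal (exp (\<alpha> * norm x)) \<partial>\<mu>0) < \<infinity>"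
    and Pr: "prob_space Pr"
    and X0_law: "\<And>N i. 1 \<le> N \<Longrightarrow> i \<in> {1..N} \<Longrightarrow> distr Pr borel (X0 N i) = \<mu>0"
    and X0_meas: "\<And>N i. X0 N i \<in> borel_measurable Pr"
    and eps_law: "\<And>n i. 1 \<le> n \<Longrightarrow> 1 \<le> i \<Longrightarrow> distr Pr borel (eps n i) = \<theta>"
    and eps_indep: "prob_space.indep_vars Pr (\<lambda>_. borel) (\<lambda>(n, i). eps n i)
                      {(n, i). 1 \<le> n \<and> 1 \<le> i}"
    and eps_meas: "\<And>n i. eps n i \<in> borel_measurable Pr"
    and eps_X0_indep: "prob_space.indep_set Pr
        (sets (vimage_algebra (space Pr)
           (\<lambda>w. \<lambda>k\<in>{(N, i). 1 \<le> N \<and> 1 \<le> i \<and> i \<le> N}. X0 (fst k) (snd k) w)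
           (PiM {(N, i). 1 \<le> N \<and> 1 \<le> i \<and> i \<le> N} (\<lambda>_. borel))))
        (sets (vimage_algebra (space Pr)
           (\<lambda>w. \<lambda>k\<in>{(n, i). 1 \<le> n \<and> 1 \<le> i}. eps (fst k) (snd k) w)
           (PiM {(n, i). 1 \<le> n \<and> 1 \<le> i} (\<lambda>_. borel))))"
begin

sublocale Pr: prob_space Pr by (rule Pr)

declare X0_meas[measurable] eps_meas[measurable]

abbreviation "particles \<equiv> particle A \<delta> f X0 eps"

abbreviation err :: "nat \<Rightarrow> nat \<Rightarrow> 'w \<Rightarrow> real" where
  "err n N w \<equiv> W1 (empirical N (particles n N w)) ((\<Psi> ^^ n) \<mu>0)"

abbreviation err0 :: "nat \<Rightarrow> 'w \<Rightarrow> real" where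
  "err0 N w \<equiv> W1 (empirical N (particles 0 N w)) \<mu>0"

abbreviation states :: "nat \<Rightarrow> (nat \<Rightarrow> real^'d) measure" where
  "states N \<equiv> PiM {1..N} (\<lambda>_. borel)"

abbreviation IX :: "(nat \<times> nat) set" where "IX \<equiv> {(N, i). 1 \<le> N \<and> 1 \<le> i \<and> i \<le> N}"
abbreviation IE :: "(nat \<times> nat) set" where "IE \<equiv> {(n, i). 1 \<le> n \<and> 1 \<le> i}"

section \<open>Independence of the current state and the next noises\<close>

definition X0s :: "'w \<Rightarrow> nat \<times> nat \<Rightarrow> real^'d" where
  "X0s w = (\<lambda>k\<in>IX. X0 (fst k) (snd k) w)"

definition epss :: "(nat \<times> nat) set \<Rightarrow> 'w \<Rightarrow> nat \<times> nat \<Rightarrow> real^'m" where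
  "epss J w = (\<lambda>k\<in>J. eps (fst k) (snd k) w)"

lemma X0s_measurable[measurable]: "X0s \<in> Pr \<rightarrow>\<^sub>M PiM IX (\<lambda>_. borel)"
  unfolding X0s_def by (intro measurable_restrict X0_meas)

lemma epss_measurable[measurable]: "epss J \<in> Pr \<rightarrow>\<^sub>M PiM J (\<lambda>_. borel)"
  unfolding epss_def by (intro measurable_restrict eps_meas)

lemma indep_X0s_epss: "indep_pair Pr (PiM IX (\<lambda>_. borel)) X0s (PiM IE (\<lambda>_. borel)) (epss IE)"
  by (rule Pr.indep_pair_of_indep_set[OF X0s_measurable epss_measurable])
    (use eps_X0_indep in \<open>simp add: X0s_def[abs_def] epss_def[abs_def]\<close>)

lemma indep_epss:
  assumes "J \<subseteq> IE" "B \<subseteq> IE" "J \<inter> B = {}"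
  shows "indep_pair Pr (PiM J (\<lambda>_. borel)) (epss J) (PiM B (\<lambda>_. borel)) (epss B)"
proof -
  have "Pr.indep_var (PiM J (\<lambda>_. borel)) (epss J) (PiM B (\<lambda>_. borel)) (epss B)"
    using Pr.indep_var_restrict[OF eps_indep assms(3,1,2)]
    by (simp add: epss_def[abs_def] split_beta')
  then show ?thesis by (simp add: indep_pair_def Pr.indep_var_distribution_eq)
qed

lemma indep_past_epss:
  assumes "J \<subseteq> IE" "B \<subseteq> IE" "J \<inter> B = {}"
  shows "indep_pair Pr (PiM IX (\<lambda>_. borel) \<Otimes>\<^sub>M PiM J (\<lambda>_. borel)) (\<lambda>w. (X0s w, epss J w)) (PiM B (\<lambda>_. borel)) (epss B)"
proof (rule Pr.indep_pair_assoc[OF _ indep_epss[OF assms]])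
  have r: "(\<lambda>e. restrict e K) \<in> PiM IE (\<lambda>_. borel) \<rightarrow>\<^sub>M PiM K (\<lambda>_. borel :: (real^'m) measure)" if "K \<subseteq> IE" for K
    using that by (rule measurable_restrict_subset)
  have "indep_pair Pr (PiM IX (\<lambda>_. borel)) (\<lambda>w. X0s w) (PiM J (\<lambda>_. borel) \<Otimes>\<^sub>M PiM B (\<lambda>_. borel)) (\<lambda>w. (restrict (epss IE w) J, restrict (epss IE w) B))"
    by (rule Pr.indep_pair_compose[OF indep_X0s_epss _ measurable_Pair[OF r[OF assms(1)] r[OF assms(2)]]]) simp
  moreover have "restrict (epss IE w) K = epss K w" if "K \<subseteq> IE" for K w
    using that by (auto simp: epss_def fun_eq_iff)
  ultimately show "indep_pair Pr (PiM IX (\<lambda>_. borel)) X0s (PiM J (\<lambda>_. borel) \<Otimes>\<^sub>M PiM B (\<lambda>_. borel)) (\<lambda>w. (epss J w, epss B w))"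
    using assms by simp
qed

text \<open>Only the indices up to \<open>N\<close> influence the empirical measure; the restriction
  makes the configuration a point of the product space \<open>states N\<close>.\<close>

definition state :: "nat \<Rightarrow> nat \<Rightarrow> 'w \<Rightarrow> nat \<Rightarrow> real^'d" where
  "state n N w = (\<lambda>i\<in>{1..N}. particles n N w i)"

definition noises :: "nat \<Rightarrow> nat \<Rightarrow> 'w \<Rightarrow> nat \<Rightarrow> real^'m" where
  "noises n N w = (\<lambda>i\<in>{1..N}. eps n i w)"

lemma step_cong:
  assumes "\<And>j. j \<in> {1..N} \<Longrightarrow> x j = y j" "e i = e' i" "i \<in> {1..N}"
  shows "step N x e i = step N y e' i"
  using assms empirical_cong[of N x y] by (simp add: step_def)

lemma particles_Suc_state:
  assumes "i \<in> {1..N}"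
  shows "particles (Suc n) N w i = step N (state n N w) (noises (Suc n) N w) i"
  unfolding particle_Suc_step using assms by (intro step_cong) (auto simp: state_def noises_def)

text \<open>Replays the dynamics from the arrays of initial data and noises alone. This exhibits the
  state at time \<open>n\<close> as a measurable function of the noises up to time \<open>n\<close>,
  to which independence can be applied.\<close>

fun flow :: "nat \<Rightarrow> nat \<Rightarrow> (nat \<times> nat \<Rightarrow> real^'d) \<times> (nat \<times> nat \<Rightarrow> real^'m) \<Rightarrow> nat \<Rightarrow> real^'d" where
  "flow N 0 r = (\<lambda>i\<in>{1..N}. fst r (N, i))"
| "flow N (Suc n) r = (\<lambda>i\<in>{1..N}. step N (flow N n r) (\<lambda>j\<in>{1..N}. snd r (Suc n, j)) i)"

lemma step_measurable_comp:
  assumes "1 \<le> N" "i \<in> {1..N}" "x \<in> K \<rightarrow>\<^sub>M states N" "e \<in> K \<rightarrow>\<^sub>M PiM {1..N} (\<lambda>_. borel)"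
  shows "(\<lambda>w. step N (x w) (e w) i) \<in> borel_measurable K"
proof -
  have "(\<lambda>w. (x w, e w)) \<in> K \<rightarrow>\<^sub>M states N \<Otimes>\<^sub>M noise N"
    using assms(3,4) by (intro measurable_Pair) (auto simp: measurable_cong_sets[OF refl sets_noise])
  from measurable_compose[OF this step_measurable_pair[OF assms(1,2)]] show ?thesis by simp
qed

lemma flow_measurable:
  assumes "1 \<le> N" "k \<le> n"
  shows "flow N k \<in> PiM IX (\<lambda>_. borel) \<Otimes>\<^sub>M PiM ({1..n} \<times> {1..N}) (\<lambda>_. borel) \<rightarrow>\<^sub>M states N"
  using assms(2)
proof (induction k)
  case 0
  show ?case using assms(1) unfolding flow.simps
    by (intro measurable_restrict measurable_compose[OF measurable_fst measurable_component_singleton]) auto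
next
  case (Suc k)
  have "(\<lambda>r. \<lambda>j\<in>{1..N}. snd r (Suc k, j)) \<in> PiM IX (\<lambda>_. borel :: (real^'d) measure) \<Otimes>\<^sub>M PiM ({1..n} \<times> {1..N}) (\<lambda>_. borel) \<rightarrow>\<^sub>M PiM {1..N} (\<lambda>_. borel :: (real^'m) measure)"
    using Suc(2) by (intro measurable_restrict measurable_compose[OF measurable_snd measurable_component_singleton]) auto
  then show ?case using Suc unfolding flow.simps
    by (intro measurable_restrict step_measurable_comp[OF assms(1)]) auto
qed

lemma state_flow:
  assumes "1 \<le> N" "k \<le> n"
  shows "state k N w = flow N k (X0s w, epss ({1..n} \<times> {1..N}) w)"
  using assms(2)
proof (induction k)
  case 0
  show ?case using assms(1) by (auto simp: state_def X0s_def fun_eq_iff)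
next
  case (Suc k)
  then have IH: "state k N w = flow N k (X0s w, epss ({1..n} \<times> {1..N}) w)" by simp
  have ns: "noises (Suc k) N w = (\<lambda>j\<in>{1..N}. epss ({1..n} \<times> {1..N}) w (Suc k, j))"
    using Suc(2) by (auto simp: noises_def epss_def fun_eq_iff)
  then show ?case unfolding flow.simps IH[symmetric] snd_conv ns[symmetric]
    by (auto simp: state_def[of "Suc k"] fun_eq_iff particles_Suc_state simp del: particle.simps)
qed

lemma state_measurable: "1 \<le> N \<Longrightarrow> state n N \<in> Pr \<rightarrow>\<^sub>M states N"
proof -
  assume N: "1 \<le> N"
  have "state n N = (\<lambda>w. flow N n (X0s w, epss ({1..n} \<times> {1..N}) w))"
    by (rule ext) (rule state_flow[OF N order_refl])
  then show ?thesis
    using measurable_compose[OF measurable_Pair[OF X0s_measurable epss_measurable] flow_measurable[OF N order_refl]] by simp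
qed

text \<open>The state at time \<open>n\<close> reads the initial data and the noises at times 1 to
  \<open>n\<close>, a block of indices disjoint from those at time \<open>Suc n\<close>.\<close>

lemma indep_state_noises:
  assumes "1 \<le> N"
  shows "indep_pair Pr (states N) (state n N) (PiM {1..N} (\<lambda>_. borel)) (noises (Suc n) N)"
proof -
  let ?J = "{1..n} \<times> {1..N}" and ?B = "{Suc n} \<times> {1..N}"
  have i: "indep_pair Pr (PiM IX (\<lambda>_. borel) \<Otimes>\<^sub>M PiM ?J (\<lambda>_. borel)) (\<lambda>w. (X0s w, epss ?J w)) (PiM ?B (\<lambda>_. borel)) (epss ?B)"
    by (rule indep_past_epss) auto
  have "indep_pair Pr (states N) (\<lambda>w. flow N n (X0s w, epss ?J w)) (PiM {1..N} (\<lambda>_. borel)) (\<lambda>w. \<lambda>j\<in>{1..N}. epss ?B w (Suc n, j))"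
    by (rule Pr.indep_pair_compose[OF i flow_measurable[OF assms order_refl], where g="\<lambda>e. \<lambda>j\<in>{1..N}. e (Suc n, j)"])
      (intro measurable_restrict measurable_component_singleton, auto)
  moreover have "(\<lambda>w. flow N n (X0s w, epss ?J w)) = state n N"
    by (simp add: fun_eq_iff state_flow[OF assms order_refl])
  moreover have "(\<lambda>w. \<lambda>j\<in>{1..N}. epss ?B w (Suc n, j)) = noises (Suc n) N"
    by (auto simp: fun_eq_iff noises_def epss_def)
  ultimately show ?thesis by simp
qed

lemma noises_law:
  assumes "1 \<le> N"
  shows "distr Pr (PiM {1..N} (\<lambda>_. borel)) (noises (Suc n) N) = noise N"
proof -
  let ?B = "{Suc n} \<times> {1..N}"
  have "Pr.indep_vars (\<lambda>_. borel) (\<lambda>(n, i). eps n i) ?B"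
    by (rule Pr.indep_vars_subset[OF eps_indep]) auto
  then have "distr Pr (PiM ?B (\<lambda>_. borel)) (\<lambda>w. \<lambda>k\<in>?B. (case k of (n, i) \<Rightarrow> eps n i) w) = (\<Pi>\<^sub>M k\<in>?B. distr Pr borel (case k of (n, i) \<Rightarrow> eps n i))"
    using assms by (subst (asm) Pr.indep_vars_iff_distr_eq_PiM') auto
  also have "\<dots> = PiM ?B (\<lambda>_. \<theta>)" by (intro PiM_cong) (auto simp: eps_law)
  finally have B: "distr Pr (PiM ?B (\<lambda>_. borel)) (epss ?B) = PiM ?B (\<lambda>_. \<theta>)"
    by (simp add: epss_def[abs_def] split_beta')
  have "noise N = distr (PiM ?B (\<lambda>_. \<theta>)) (PiM {1..N} (\<lambda>_. \<theta>)) (\<lambda>e. \<lambda>j\<in>{1..N}. e (Suc n, j))"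
    unfolding noise_def by (rule distr_PiM_reindex[symmetric, of ?B "\<lambda>_. \<theta>" "\<lambda>j. (Suc n, j)" "{1..N}"]) (auto simp: theta inj_on_def)
  also have "\<dots> = distr (distr Pr (PiM ?B (\<lambda>_. borel)) (epss ?B)) (PiM {1..N} (\<lambda>_. borel)) (\<lambda>e. \<lambda>j\<in>{1..N}. e (Suc n, j))"
    unfolding B using sets_noise[of N, unfolded noise_def] by (intro distr_cong) auto
  also have "\<dots> = distr Pr (PiM {1..N} (\<lambda>_. borel)) ((\<lambda>e. \<lambda>j\<in>{1..N}. e (Suc n, j)) \<circ> epss ?B)"
    by (rule distr_distr[OF _ epss_measurable]) (intro measurable_restrict measurable_component_singleton, auto)
  also have "(\<lambda>e. \<lambda>j\<in>{1..N}. e (Suc n, j)) \<circ> epss ?B = noises (Suc n) N"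
    by (auto simp: fun_eq_iff noises_def epss_def)
  finally show ?thesis by simp
qed

lemma noises_measurable: "noises n N \<in> Pr \<rightarrow>\<^sub>M PiM {1..N} (\<lambda>_. borel)"
  unfolding noises_def by (intro measurable_restrict eps_meas)

text \<open>The substitute for conditioning on the past: the joint law of state and next noises is a
  product, so the noises may be integrated first with the state held fixed.\<close>

lemma nn_integral_state_noises:
  assumes N: "1 \<le> N" and \<Phi>: "\<Phi> \<in> borel_measurable (states N \<Otimes>\<^sub>M noise N)"
  shows "(\<integral>\<^sup>+w. \<Phi> (state n N w, noises (Suc n) N w) \<partial>Pr) = (\<integral>\<^sup>+w. \<integral>\<^sup>+e. \<Phi> (state n N w, e) \<partial>noise N \<partial>Pr)"
proof -
  interpret P: prob_space "noise N" by (rule prob_space_noise)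
  have s: "sets (states N \<Otimes>\<^sub>M PiM {1..N} (\<lambda>_. borel)) = sets (states N \<Otimes>\<^sub>M noise N)"
    by (intro sets_pair_measure_cong refl sets_noise[symmetric])
  note m = measurable_Pair[OF state_measurable[OF N, of n] noises_measurable[of "Suc n" N]]
  have \<Phi>': "\<Phi> \<in> borel_measurable (states N \<Otimes>\<^sub>M PiM {1..N} (\<lambda>_. borel))"
    by (subst measurable_cong_sets[OF s refl]) (rule \<Phi>)
  have \<Phi>'': "\<Phi> \<in> borel_measurable (distr Pr (states N) (state n N) \<Otimes>\<^sub>M noise N)"
  proof -
    have s': "sets (distr Pr (states N) (state n N) \<Otimes>\<^sub>M noise N) = sets (states N \<Otimes>\<^sub>M noise N)"
      by (rule sets_pair_measure_cong[OF sets_distr refl])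
    show ?thesis by (subst measurable_cong_sets[OF s' refl]) (rule \<Phi>)
  qed
  have "(\<integral>\<^sup>+w. \<Phi> (state n N w, noises (Suc n) N w) \<partial>Pr) = (\<integral>\<^sup>+r. \<Phi> r \<partial>distr Pr (states N \<Otimes>\<^sub>M PiM {1..N} (\<lambda>_. borel)) (\<lambda>w. (state n N w, noises (Suc n) N w)))"
    by (subst nn_integral_distr[OF m]) (simp_all only: measurable_distr_eq1 \<Phi>')
  also have "distr Pr (states N \<Otimes>\<^sub>M PiM {1..N} (\<lambda>_. borel)) (\<lambda>w. (state n N w, noises (Suc n) N w)) = distr Pr (states N) (state n N) \<Otimes>\<^sub>M noise N"
    using indep_state_noises[OF N, of n] unfolding indep_pair_def noises_law[OF N] by simp
  also have "(\<integral>\<^sup>+r. \<Phi> r \<partial>(distr Pr (states N) (state n N) \<Otimes>\<^sub>M noise N)) = (\<integral>\<^sup>+x. \<integral>\<^sup>+e. \<Phi> (x, e) \<partial>noise N \<partial>distr Pr (states N) (state n N))"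
    by (rule P.nn_integral_fst[symmetric, OF \<Phi>''])
  also have "\<dots> = (\<integral>\<^sup>+w. \<integral>\<^sup>+e. \<Phi> (state n N w, e) \<partial>noise N \<partial>Pr)"
    by (subst nn_integral_distr[OF state_measurable[OF N]])
      (simp_all only: measurable_distr_eq1 P.borel_measurable_nn_integral_fst[OF \<Phi>])
  finally show ?thesis .
qed

end

section \<open>Moments uniform in time and deviation of one step\<close>

lemma (in prob_space) prob_markov:
  assumes m[measurable]: "u \<in> borel_measurable M" and u: "\<And>w. 0 \<le> u w" "(\<integral>\<^sup>+w. ennreal (u w) \<partial>M) \<le> ennreal K"
    and "0 < a" "0 \<le> K"
  shows "prob {w \<in> space M. a \<le> u w} \<le> K / a"
proof -
  have "emeasure M {w \<in> space M. 1 \<le> ennreal (1 / a) * ennreal (u w)} \<le> ennreal (1 / a) * (\<integral>\<^sup>+w. ennreal (u w) * indicator (space M) w \<partial>M)"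
    by (rule nn_integral_Markov_inequality) auto
  also have "(\<integral>\<^sup>+w. ennreal (u w) * indicator (space M) w \<partial>M) = (\<integral>\<^sup>+w. ennreal (u w) \<partial>M)"
    by (intro nn_integral_cong) auto
  also have "ennreal (1 / a) * \<dots> \<le> ennreal (1 / a) * ennreal K" using u(2) by (rule mult_left_mono) simp
  also have "\<dots> = ennreal (K / a)" using assms(4,5) by (simp add: ennreal_mult[symmetric])
  also have "{w \<in> space M. 1 \<le> ennreal (1 / a) * ennreal (u w)} = {w \<in> space M. a \<le> u w}"
    using u(1) assms(4) by (auto simp: ennreal_mult[symmetric] ennreal_1[symmetric] field_simps simp del: ennreal_1)
  finally show ?thesis using assms(4,5) by (simp add: emeasure_eq_measure)
qed

context particle_system
begin

lemma empirical_state: "empirical N (particles n N w) = empirical N (state n N w)"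
  by (rule empirical_cong) (simp add: state_def)

lemma empirical_state_Suc:
  "empirical N (particles (Suc n) N w) = empirical N (step N (state n N w) (noises (Suc n) N w))"
  by (rule empirical_cong) (simp only: particles_Suc_state)

lemma Z_cong: "(\<And>i. i \<in> {1..N} \<Longrightarrow> x i = y i) \<Longrightarrow> Z N x = Z N y"
  by (simp add: Z_def)

lemma Z_state_Suc: "Z N (state (Suc n) N w) = Z N (step N (state n N w) (noises (Suc n) N w))"
  by (rule Z_cong) (simp only: state_def restrict_apply' particles_Suc_state[unfolded state_def])

lemma Z_measurable: "Z N \<in> borel_measurable (states N)"
  unfolding Z_def by measurable

lemma Z_step_measurable:
  assumes "1 \<le> N"
  shows "(\<lambda>r. Z N (step N (fst r) (snd r))) \<in> borel_measurable (states N \<Otimes>\<^sub>M noise N)"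
proof -
  note m = step_measurable_pair[OF assms, unfolded split_beta']
  have g: "(\<lambda>y. exp (\<beta> * norm y)) \<in> borel_measurable (borel :: (real^'d) measure)" by measurable
  show ?thesis unfolding Z_def
    by (intro borel_measurable_divide borel_measurable_sum borel_measurable_const measurable_compose[OF m g])
qed

text \<open>The maximum is invariant under the drift:
  \<open>\<kappa> * K + (1 - \<kappa>) * Cst \<le> K\<close>. It bounds the initial moment, hence by
  induction the moment at every time, uniformly in \<open>N\<close> as well.\<close>

definition K :: real where
  "K = max (enn2real (\<integral>\<^sup>+x. ennreal (exp (\<beta> * norm x)) \<partial>\<mu>0)) Cst"

lemma K: "Cst \<le> K" "0 < K"
  by (auto simp: K_def Cst_def less_max_iff_disj)

lemma moment_0: "(\<integral>\<^sup>+x. ennreal (exp (\<beta> * norm x)) \<partial>\<mu>0) \<le> ennreal K"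
proof -
  have "(\<integral>\<^sup>+x. ennreal (exp (\<beta> * norm x)) \<partial>\<mu>0) \<le> (\<integral>\<^sup>+x. ennreal (exp (\<alpha> * norm x)) \<partial>\<mu>0)"
    using \<beta>_le(1) by (intro nn_integral_mono ennreal_leI) (auto intro!: mult_right_mono)
  also have "\<dots> < \<infinity>" by (rule mu0_exp)
  finally have "(\<integral>\<^sup>+x. ennreal (exp (\<beta> * norm x)) \<partial>\<mu>0) = ennreal (enn2real (\<integral>\<^sup>+x. ennreal (exp (\<beta> * norm x)) \<partial>\<mu>0))" by simp
  also have "\<dots> \<le> ennreal K" unfolding K_def by (intro ennreal_leI) simp
  finally show ?thesis .
qed

lemma nn_integral_drift:
  assumes m[measurable]: "u \<in> borel_measurable Pr" and u: "\<And>w. 0 \<le> u w" "(\<integral>\<^sup>+w. ennreal (u w) \<partial>Pr) \<le> ennreal K"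
  shows "(\<integral>\<^sup>+w. ennreal (\<kappa> * u w + (1 - \<kappa>) * Cst) \<partial>Pr) \<le> ennreal K"
proof -
  have c: "0 \<le> (1 - \<kappa>) * Cst" using \<kappa> by (simp add: Cst_def)
  have "(\<integral>\<^sup>+w. ennreal (\<kappa> * u w + (1 - \<kappa>) * Cst) \<partial>Pr) = (\<integral>\<^sup>+w. ennreal \<kappa> * ennreal (u w) + ennreal ((1 - \<kappa>) * Cst) \<partial>Pr)"
    using \<kappa> u(1) c by (intro nn_integral_cong) (simp add: ennreal_mult)
  also have "\<dots> = ennreal \<kappa> * (\<integral>\<^sup>+w. ennreal (u w) \<partial>Pr) + ennreal ((1 - \<kappa>) * Cst)"
    by (simp add: nn_integral_add nn_integral_cmult Pr.emeasure_space_1)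
  also have "\<dots> \<le> ennreal \<kappa> * ennreal K + ennreal ((1 - \<kappa>) * K)"
    using u(2) K \<kappa> by (intro add_mono mult_left_mono ennreal_leI) auto
  also have "\<dots> = ennreal (\<kappa> * K + (1 - \<kappa>) * K)"
    using K \<kappa> by (simp add: ennreal_mult[symmetric] ennreal_plus[symmetric] del: ennreal_plus)
  also have "\<kappa> * K + (1 - \<kappa>) * K = K" by (simp add: algebra_simps)
  finally show ?thesis .
qed

lemma moment:
  assumes N: "1 \<le> N"
  shows "(\<integral>\<^sup>+w. ennreal (Z N (state n N w)) \<partial>Pr) \<le> ennreal K"
proof (induction n)
  case 0
  have "(\<integral>\<^sup>+w. ennreal (Z N (state 0 N w)) \<partial>Pr) = (\<integral>\<^sup>+w. (\<Sum>i\<in>{1..N}. ennreal (1 / N) * ennreal (exp (\<beta> * norm (X0 N i w)))) \<partial>Pr)"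
    unfolding Z_def by (simp add: state_def ennreal_mult[symmetric] sum_divide_distrib)
  also have "\<dots> = (\<Sum>i\<in>{1..N}. ennreal (1 / N) * (\<integral>\<^sup>+w. ennreal (exp (\<beta> * norm (X0 N i w))) \<partial>Pr))"
    by (subst nn_integral_sum) (auto intro!: sum.cong nn_integral_cmult)
  also have "\<dots> = (\<Sum>i\<in>{1..N}. ennreal (1 / N) * (\<integral>\<^sup>+x. ennreal (exp (\<beta> * norm x)) \<partial>\<mu>0))"
  proof (rule sum.cong[OF refl])
    fix i assume i: "i \<in> {1..N}"
    show "ennreal (1 / N) * (\<integral>\<^sup>+w. ennreal (exp (\<beta> * norm (X0 N i w))) \<partial>Pr) = ennreal (1 / N) * (\<integral>\<^sup>+x. ennreal (exp (\<beta> * norm x)) \<partial>\<mu>0)"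
      unfolding X0_law[OF N i, symmetric] by (subst nn_integral_distr) auto
  qed
  also have "\<dots> \<le> (\<Sum>i\<in>{1..N}. ennreal (1 / N) * ennreal K)"
    by (intro sum_mono mult_left_mono moment_0) auto
  also have "\<dots> = ennreal K"
    using N K by (simp add: ennreal_mult[symmetric] ennreal_of_nat_eq_real_of_nat)
  finally show ?case .
next
  case (Suc n)
  have "(\<integral>\<^sup>+w. ennreal (Z N (state (Suc n) N w)) \<partial>Pr) = (\<integral>\<^sup>+w. \<integral>\<^sup>+e. ennreal (Z N (step N (state n N w) e)) \<partial>noise N \<partial>Pr)"
    unfolding Z_state_Suc using nn_integral_state_noises[OF N, of "\<lambda>r. ennreal (Z N (step N (fst r) (snd r)))" n] Z_step_measurable[OF N] by simp
  also have "\<dots> \<le> (\<integral>\<^sup>+w. ennreal (\<kappa> * Z N (state n N w) + (1 - \<kappa>) * Cst) \<partial>Pr)"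
    by (intro nn_integral_mono Z_drift N)
  also have "\<dots> \<le> ennreal K"
    using measurable_compose[OF state_measurable[OF N] Z_measurable] Suc by (intro nn_integral_drift) auto
  finally show ?case .
qed

lemma measure_Psi_measurable:
  assumes N: "1 \<le> N" and U[measurable]: "U \<in> sets borel"
  shows "(\<lambda>x. measure (\<Psi> (empirical N x)) U) \<in> borel_measurable (states N)"
proof -
  interpret P: prob_space "noise N" by (rule prob_space_noise)
  have "(\<lambda>x. measure (noise N) {e \<in> space (noise N). step N x e i \<in> U}) \<in> borel_measurable (states N)" if i: "i \<in> {1..N}" for i
  proof -
    note [measurable] = step_measurable_pair[OF N i, unfolded split_beta']
    let ?Q = "{r \<in> space (states N \<Otimes>\<^sub>M noise N). step N (fst r) (snd r) i \<in> U}"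
    have "?Q \<in> sets (states N \<Otimes>\<^sub>M noise N)" by measurable
    from P.measurable_emeasure_Pair[OF this]
    have "(\<lambda>x. measure (noise N) (Pair x -` ?Q)) \<in> borel_measurable (states N)" unfolding measure_def by measurable
    moreover have "measure (noise N) (Pair x -` ?Q) = measure (noise N) {e \<in> space (noise N). step N x e i \<in> U}" if "x \<in> space (states N)" for x
      using that by (intro arg_cong[of _ _ "measure (noise N)"]) (auto simp: space_pair_measure)
    ultimately show ?thesis by (simp cong: measurable_cong)
  qed
  then show ?thesis unfolding measure_Psi_empirical[OF N U] by (intro borel_measurable_divide borel_measurable_sum) auto
qed

lemma bad_measurable:
  assumes N: "1 \<le> N"
  shows "{r \<in> space (states N \<Otimes>\<^sub>M noise N). bad N s m t (fst r) (snd r)} \<in> sets (states N \<Otimes>\<^sub>M noise N)"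
proof -
  let ?P = "states N \<Otimes>\<^sub>M noise N"
  let ?B = "\<lambda>S. {r \<in> space ?P. t < gap N (fst r) (snd r) (\<Union>j\<in>S. cell s j)}"
  have "?B S \<in> sets ?P" if S: "S \<subseteq> cells m" for S
  proof -
    note U = Un_cells_borel[OF S, of s]
    have "(\<lambda>r. indicat_real (\<Union>j\<in>S. cell s j) (step N (fst r) (snd r) i)) \<in> borel_measurable ?P" if i: "i \<in> {1..N}" for i
      by (rule measurable_compose[OF step_measurable_pair[OF N i, unfolded split_beta'] borel_measurable_indicator[OF U]])
    then have [measurable]: "(\<lambda>r. (\<Sum>i=1..N. indicat_real (\<Union>j\<in>S. cell s j) (step N (fst r) (snd r) i)) / N) \<in> borel_measurable ?P"
      by (intro borel_measurable_divide borel_measurable_sum) auto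
    have [measurable]: "(\<lambda>r. measure (\<Psi> (empirical N (fst r))) (\<Union>j\<in>S. cell s j)) \<in> borel_measurable ?P"
      by (rule measurable_compose[OF measurable_fst measure_Psi_measurable[OF N U]])
    show ?thesis unfolding measure_empirical[OF N U] by measurable
  qed
  then have "(\<Union>S\<in>Pow (cells m). ?B S) \<in> sets ?P" using finite_cells[of m] by (intro sets.finite_UN) auto
  also have "(\<Union>S\<in>Pow (cells m). ?B S) = {r \<in> space ?P. bad N s m t (fst r) (snd r)}" by (auto simp: bad_def)
  finally show ?thesis .
qed

lemma prob_bad_state:
  assumes N: "1 \<le> N" and t: "0 \<le> t"
  shows "{w \<in> space Pr. bad N s m t (state n N w) (noises (Suc n) N w)} \<in> Pr.events" (is "?B \<in> _")
    and "Pr.prob {w \<in> space Pr. bad N s m t (state n N w) (noises (Suc n) N w)} \<le> 2 * 2 ^ ((2 * m) ^ CARD('d)) * exp (- 2 * real N * t\<^sup>2)"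
      (is "_ \<le> ?b")
proof -
  interpret P: prob_space "noise N" by (rule prob_space_noise)
  let ?Q = "{r \<in> space (states N \<Otimes>\<^sub>M noise N). bad N s m t (fst r) (snd r)}"
  note Q = bad_measurable[OF N, of s m t]
  have noises': "noises (Suc n) N \<in> Pr \<rightarrow>\<^sub>M noise N"
    using noises_measurable by (subst measurable_cong_sets[OF refl sets_noise])
  note pm = measurable_Pair[OF state_measurable[OF N, of n] noises']
  have eq: "(\<lambda>w. (state n N w, noises (Suc n) N w)) -` ?Q \<inter> space Pr = ?B"
    using measurable_space[OF pm] by auto
  show ev: "?B \<in> Pr.events" using measurable_sets[OF pm Q] unfolding eq .
  have "emeasure Pr ?B = (\<integral>\<^sup>+w. indicator ?B w \<partial>Pr)" by (rule nn_integral_indicator[OF ev, symmetric])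
  also have "\<dots> = (\<integral>\<^sup>+w. indicator ?Q (state n N w, noises (Suc n) N w) \<partial>Pr)"
  proof (rule nn_integral_cong)
    fix w assume w: "w \<in> space Pr"
    from measurable_space[OF pm w] w
    show "indicator ?B w = (indicator ?Q (state n N w, noises (Suc n) N w) :: ennreal)"
      unfolding indicator_def by simp
  qed
  also have "\<dots> = (\<integral>\<^sup>+w. \<integral>\<^sup>+e. indicator ?Q (state n N w, e) \<partial>noise N \<partial>Pr)"
    by (rule nn_integral_state_noises[OF N borel_measurable_indicator[OF Q]])
  also have "\<dots> \<le> (\<integral>\<^sup>+w. ennreal ?b \<partial>Pr)"
  proof (rule nn_integral_mono)
    fix w assume "w \<in> space Pr"
    then have s: "state n N w \<in> space (states N)" by (rule measurable_space[OF state_measurable[OF N]])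
    have "(\<integral>\<^sup>+e. indicator ?Q (state n N w, e) \<partial>noise N) = (\<integral>\<^sup>+e. indicator (Pair (state n N w) -` ?Q) e \<partial>noise N)"
      by (intro nn_integral_cong) (auto split: split_indicator)
    also have "\<dots> = emeasure (noise N) (Pair (state n N w) -` ?Q)"
      by (rule nn_integral_indicator) (rule sets_Pair1[OF Q])
    also have "Pair (state n N w) -` ?Q = {e \<in> space (noise N). bad N s m t (state n N w) e}"
      using s by (auto simp: space_pair_measure)
    also have "emeasure (noise N) \<dots> \<le> ennreal ?b"
      unfolding P.emeasure_eq_measure by (intro ennreal_leI prob_bad N t)
    finally show "(\<integral>\<^sup>+e. indicator ?Q (state n N w, e) \<partial>noise N) \<le> ennreal ?b" .
  qed
  also have "\<dots> = ennreal ?b" by (simp add: Pr.emeasure_space_1)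
  finally show "Pr.prob ?B \<le> ?b" unfolding Pr.emeasure_eq_measure by (subst (asm) ennreal_le_iff) auto
qed

definition dev :: "nat \<Rightarrow> nat \<Rightarrow> 'w \<Rightarrow> real" where
  "dev n N w = W1 (empirical N (particles (Suc n) N w)) (\<Psi> (empirical N (particles n N w)))"

text \<open>\<open>dev\<close> is never shown to be measurable; its exceedance set is covered by the event \<open>E\<close> instead.\<close>
lemma dev_event:
  assumes N: "1 \<le> N" and s: "0 < s" and t: "0 \<le> t" and a: "0 < a"
  obtains E where "E \<in> Pr.events"
    "{w \<in> space Pr. real CARD('d) * s + real CARD('d) * real m * s * (2 * t) + 2 * a < dev n N w} \<subseteq> E"
    "Pr.prob E \<le> Pr.prob {w \<in> space Pr. bad N s m t (state n N w) (noises (Suc n) N w)} + 2 * tail_const (m * s) * K / a"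
proof -
  define c where "c = tail_const (m * s)"
  have c: "0 < c" by (simp add: c_def tail_const_pos)
  define u1 where "u1 w = Z N (state (Suc n) N w)" for w
  define u2 where "u2 w = \<kappa> * Z N (state n N w) + (1 - \<kappa>) * Cst" for w
  have [measurable]: "(\<lambda>w. Z N (state n N w)) \<in> borel_measurable Pr" for n
    by (rule measurable_compose[OF state_measurable[OF N] Z_measurable])
  have [measurable]: "u1 \<in> borel_measurable Pr" "u2 \<in> borel_measurable Pr" unfolding u1_def u2_def by measurable
  have u0: "0 \<le> u1 w" "0 \<le> u2 w" for w using \<kappa> by (auto simp: u1_def u2_def Cst_def)
  have ui: "(\<integral>\<^sup>+w. ennreal (u1 w) \<partial>Pr) \<le> ennreal K" "(\<integral>\<^sup>+w. ennreal (u2 w) \<partial>Pr) \<le> ennreal K"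
    unfolding u1_def u2_def by (auto intro!: moment N nn_integral_drift)
  define B where "B = {w \<in> space Pr. bad N s m t (state n N w) (noises (Suc n) N w)}"
  define E1 where "E1 = {w \<in> space Pr. a / c \<le> u1 w}"
  define E2 where "E2 = {w \<in> space Pr. a / c \<le> u2 w}"
  have ev: "B \<in> Pr.events" "E1 \<in> Pr.events" "E2 \<in> Pr.events"
    using prob_bad_state(1)[OF N t] by (auto simp: B_def E1_def E2_def)
  \<comment> \<open>Each of the two tail terms is granted the budget \<open>a\<close>, and Markov's
    inequality with the moment bound \<open>K\<close> applies to both. The resulting factor
    \<open>1 / a\<close> is the source of the prefactor \<open>Q / \<epsilon>\<close> at the
    end.\<close>
  have p: "Pr.prob E1 \<le> K / (a / c)" "Pr.prob E2 \<le> K / (a / c)"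
    unfolding E1_def E2_def using u0 ui a c K by (intro Pr.prob_markov; simp)+
  show thesis
  proof (rule that[of "B \<union> (E1 \<union> E2)"])
    show "B \<union> (E1 \<union> E2) \<in> Pr.events" using ev by auto
    show "{w \<in> space Pr. real CARD('d) * s + real CARD('d) * real m * s * (2 * t) + 2 * a < dev n N w} \<subseteq> B \<union> (E1 \<union> E2)"
    proof (rule subsetI, rule ccontr)
      fix w assume w': "w \<in> {w \<in> space Pr. real CARD('d) * s + real CARD('d) * real m * s * (2 * t) + 2 * a < dev n N w}"
        and n: "w \<notin> B \<union> (E1 \<union> E2)"
      then have w: "w \<in> space Pr" "real CARD('d) * s + real CARD('d) * real m * s * (2 * t) + 2 * a < dev n N w" by auto
      have "\<not> bad N s m t (state n N w) (noises (Suc n) N w)" using w n by (simp add: B_def)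
      from W1_step_le[OF N s this]
      have "dev n N w \<le> real CARD('d) * s + real CARD('d) * real m * s * (2 * t) + c * u1 w + c * u2 w"
        unfolding dev_def u1_def u2_def c_def empirical_state_Suc Z_state_Suc unfolding empirical_state .
      moreover have "c * u1 w < a" "c * u2 w < a"
        using n w c by (auto simp: E1_def E2_def field_simps not_le)
      ultimately show False using w(2) by linarith
    qed
    have "Pr.prob (B \<union> (E1 \<union> E2)) \<le> Pr.prob B + (Pr.prob E1 + Pr.prob E2)"
      using ev by (intro order_trans[OF measure_Un_le] add_left_mono measure_Un_le) auto
    also have "\<dots> \<le> Pr.prob B + (K / (a / c) + K / (a / c))" using p by (intro add_left_mono add_mono)
    also have "\<dots> = Pr.prob B + 2 * c * K / a" by simp
    finally show "Pr.prob (B \<union> (E1 \<union> E2)) \<le> Pr.prob {w \<in> space Pr. bad N s m t (state n N w) (noises (Suc n) N w)} + 2 * tail_const (m * s) * K / a"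
      by (simp add: B_def c_def)
  qed
qed

text \<open>The threshold is split into four quarters: cell diameter \<open>d * s\<close>, radius of
  the cube times total variation \<open>d * m * s * (2 * t)\<close>, and the two tails. With
  \<open>t = 1 / (2 * m)\<close> the Hoeffding exponent \<open>2 * N * t\<^sup>2\<close> is free of
  \<open>r\<close>.\<close>

lemma dev_event_fine:
  assumes N: "1 \<le> N" and r: "0 < r" and m: "1 \<le> m"
  obtains E where "E \<in> Pr.events" "{w \<in> space Pr. r < dev n N w} \<subseteq> E"
    "Pr.prob E \<le> 2 * 2 ^ ((2 * m) ^ CARD('d)) * exp (- real N / (2 * (real m)\<^sup>2))
      + 16 * K / (\<beta> * r) * exp (- \<beta> * real m * r / (8 * real CARD('d)))"
proof -
  define d where "d = real CARD('d)"
  have d: "0 < d" by (simp add: d_def)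
  define s where "s = r / (4 * d)"
  define t where "t = 1 / (2 * real m)"
  have st: "0 < s" "0 \<le> t" using r d by (auto simp: s_def t_def)
  have eq: "d * s + d * real m * s * (2 * t) + 2 * (r / 4) = r"
    using d m by (simp add: s_def t_def field_simps)
  obtain E where E: "E \<in> Pr.events"
    "{w \<in> space Pr. d * s + d * real m * s * (2 * t) + 2 * (r / 4) < dev n N w} \<subseteq> E"
    "Pr.prob E \<le> Pr.prob {w \<in> space Pr. bad N s m t (state n N w) (noises (Suc n) N w)} + 2 * tail_const (m * s) * K / (r / 4)"
    using dev_event[OF N st, of "r / 4" m n] r unfolding d_def by auto
  show thesis
  proof (rule that[OF E(1)])
    show "{w \<in> space Pr. r < dev n N w} \<subseteq> E" using E(2) unfolding eq .
    have "Pr.prob {w \<in> space Pr. bad N s m t (state n N w) (noises (Suc n) N w)} \<le> 2 * 2 ^ ((2 * m) ^ CARD('d)) * exp (- 2 * real N * t\<^sup>2)"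
      by (rule prob_bad_state(2)[OF N st(2)])
    also have "- 2 * real N * t\<^sup>2 = - real N / (2 * (real m)\<^sup>2)"
      using m by (simp add: t_def power2_eq_square field_simps)
    finally have "Pr.prob {w \<in> space Pr. bad N s m t (state n N w) (noises (Suc n) N w)} \<le> 2 * 2 ^ ((2 * m) ^ CARD('d)) * exp (- real N / (2 * (real m)\<^sup>2))" .
    moreover have "2 * tail_const (m * s) * K / (r / 4) = 16 * K / (\<beta> * r) * exp (- \<beta> * real m * r / (8 * real CARD('d)))"
      using d r \<beta>_pos by (simp add: tail_const_def s_def field_simps flip: d_def)
    ultimately show "Pr.prob E \<le> 2 * 2 ^ ((2 * m) ^ CARD('d)) * exp (- real N / (2 * (real m)\<^sup>2))
      + 16 * K / (\<beta> * r) * exp (- \<beta> * real m * r / (8 * real CARD('d)))"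
      using E(3) by linarith
  qed
qed

text \<open>With \<open>t = 1\<close> the discrepancy event is empty, so large thresholds need no counting of cells.\<close>
lemma dev_event_coarse:
  assumes N: "1 \<le> N" and r: "0 < r"
  obtains E where "E \<in> Pr.events" "{w \<in> space Pr. r < dev n N w} \<subseteq> E"
    "Pr.prob E \<le> 16 * K / (\<beta> * r) * exp (- \<beta> * r / (12 * real CARD('d)))"
proof -
  define d where "d = real CARD('d)"
  have d: "0 < d" by (simp add: d_def)
  define s where "s = r / (6 * d)"
  \<comment> \<open>With \<open>t = 1\<close> and \<open>m = 1\<close> the diameter and total
    variation terms are \<open>r / 6\<close> and \<open>r / 3\<close>, which leaves
    \<open>r / 4\<close> for each tail.\<close>
  have s: "0 < s" using r d by (auto simp: s_def)
  have eq: "d * s + d * real 1 * s * (2 * 1) + 2 * (r / 4) = r"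
    using d by (simp add: s_def field_simps)
  have nobad: "\<not> bad N s 1 1 x e" for x e
  proof -
    have "gap N x e U \<le> 1" for U
      using prob_space.prob_le_1[OF prob_space_empirical[OF N], of "step N x e" U] measure_nonneg[of "empirical N (step N x e)" U]
        prob_space.prob_le_1[OF P1D(1)[OF Psi_in_P1[OF empirical_in_P1[OF N]]], of x U] measure_nonneg[of "\<Psi> (empirical N x)" U]
      by linarith
    then show ?thesis unfolding bad_def by (auto simp: not_less)
  qed
  have empty: "{w \<in> space Pr. bad N s 1 1 (state n N w) (noises (Suc n) N w)} = {}" using nobad by auto
  obtain E where E: "E \<in> Pr.events"
    "{w \<in> space Pr. d * s + d * real 1 * s * (2 * 1) + 2 * (r / 4) < dev n N w} \<subseteq> E"
    "Pr.prob E \<le> Pr.prob {w \<in> space Pr. bad N s 1 1 (state n N w) (noises (Suc n) N w)} + 2 * tail_const (1 * s) * K / (r / 4)"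
    using dev_event[OF N s, of 1 "r / 4" 1 n] r unfolding d_def by auto
  show thesis
  proof (rule that[OF E(1)])
    show "{w \<in> space Pr. r < dev n N w} \<subseteq> E" using E(2) unfolding eq .
    have "2 * tail_const (1 * s) * K / (r / 4) = 16 * K / (\<beta> * r) * exp (- \<beta> * r / (12 * real CARD('d)))"
      using d r \<beta>_pos by (simp add: tail_const_def s_def field_simps flip: d_def)
    then show "Pr.prob E \<le> 16 * K / (\<beta> * r) * exp (- \<beta> * r / (12 * real CARD('d)))"
      using E(3) unfolding empty by simp
  qed
qed

end

section \<open>Thresholds growing with the lag and summation of the errors\<close>

context particle_system
begin

text \<open>At lag \<open>k\<close> the grid is coarsened by \<open>R = sqrt y ^ k\<close>. If
  \<open>L * a \<ge> R\<close>, then \<open>m = \<lfloor>L * a / R\<rfloor>\<close> multiplies the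
  Hoeffding exponent by \<open>y ^ k\<close> without raising the entropy. Otherwise no cell is left,
  and \<open>dev_event_coarse\<close> takes over: now
  \<open>y ^ k = R\<^sup>2 \<ge> R * (L * a)\<close> produces the same exponent in
  \<open>r * a\<close>.\<close>

lemma dev_tail:
  fixes c L y r :: real
  assumes N: "1 \<le> N" and r: "0 < r" and c: "0 < c" and L: "0 < L" "L \<le> 1/2" and y: "1 < y"
  defines "a \<equiv> real N powr (1 / real (CARD('d) + 2))"
  obtains E where "E \<in> Pr.events" "{w \<in> space Pr. c * y ^ k * r < dev n N w} \<subseteq> E"
    "Pr.prob E \<le> 2 * exp (a ^ CARD('d) - a ^ CARD('d) * (1 / (2 * L\<^sup>2)) * y ^ k)
      + 16 * K / (\<beta> * c * r) * (1 / y) ^ k * exp (- (\<beta> * L * c / (16 * real CARD('d))) * (r * a))"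
proof -
  define d where "d = CARD('d)"
  have d: "1 \<le> d" by (simp add: d_def)
  have a1: "1 \<le> a" using N by (simp add: a_def ge_one_powr_ge_zero)
  have aN: "a ^ (d + 2) = real N"
  proof -
    have "a ^ (d + 2) = real N powr (real (d + 2) * (1 / real (d + 2)))"
      unfolding a_def d_def using N by (intro powr_power) simp
    then show ?thesis by simp
  qed
  \<comment> \<open>The threshold grows like \<open>R\<^sup>2\<close> and \<open>m\<close> shrinks
    like \<open>1 / R\<close>, so the tail exponent, proportional to their product, still grows like
    \<open>R\<close>. Only \<open>R \<ge> 1\<close> is used of this, in \<open>ra\<close>.\<close>
  define R where "R = sqrt y ^ k"
  have R1: "1 \<le> R" unfolding R_def using y by (intro one_le_power) simp
  have R2: "R\<^sup>2 = y ^ k" unfolding R_def using y by (simp add: power2_eq_square flip: power_mult_distrib)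
  have yk: "1 \<le> y ^ k" using y by (intro one_le_power) simp
  define q where "q = c * y ^ k * r"
  have q: "0 < q" using c y r by (simp add: q_def)
  define b where "b = \<beta> * L * c / (16 * real d)"
  have b: "0 < b" using \<beta>_pos L c d by (simp add: b_def)
  \<comment> \<open>The tail exponent is bounded uniformly in \<open>k\<close>; summability over the
    lags comes from this factor \<open>(1 / y) ^ k\<close>, that is, from Markov's inequality at a
    growing threshold.\<close>
  have pref: "16 * K / (\<beta> * q) = 16 * K / (\<beta> * c * r) * (1 / y) ^ k"
    using y by (simp add: q_def field_simps power_divide)
  have pref0: "0 \<le> 16 * K / (\<beta> * q)" using K \<beta>_pos q by simp
  have ra: "b * (r * a) \<le> b * (r * a * R)" using b r a1 R1 by (intro mult_left_mono) auto
  show thesis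
  proof (cases "1 \<le> L * a / R")
    case True
    define m where "m = nat \<lfloor>L * a / R\<rfloor>"
    have m1: "1 \<le> m" using True unfolding m_def by linarith
    have mu: "real m \<le> L * a / R" using True unfolding m_def by linarith
    \<comment> \<open>Since \<open>m \<ge> 1\<close>, rounding down loses at most a factor 2, which
      turns the 8 of \<open>dev_event_fine\<close> into 16.\<close>
    have ml: "L * a / R \<le> 2 * real m" using True m1 unfolding m_def by linarith
    obtain E where E: "E \<in> Pr.events" "{w \<in> space Pr. q < dev n N w} \<subseteq> E"
      "Pr.prob E \<le> 2 * 2 ^ ((2 * m) ^ d) * exp (- real N / (2 * (real m)\<^sup>2))
      + 16 * K / (\<beta> * q) * exp (- \<beta> * real m * q / (8 * real d))"
      unfolding d_def by (rule dev_event_fine[OF N q m1, of n])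
    have "2 * real m \<le> a"
    proof -
      have "L * a / R \<le> L * a" using L a1 R1 by (simp add: field_simps mult_left_le)
      also have "\<dots> \<le> 1/2 * a" using L a1 by (intro mult_right_mono) auto
      finally show ?thesis using mu by linarith
    qed
    then have pw: "(2 * real m) ^ d \<le> a ^ d" by (intro power_mono) auto
    have ee: "2 ^ ((2 * m) ^ d) \<le> exp ((2 * real m) ^ d)"
    proof -
      have "(2::real) ^ ((2 * m) ^ d) \<le> exp 1 ^ ((2 * m) ^ d)"
        using exp_ge_add_one_self[of "1::real"] by (intro power_mono) auto
      also have "\<dots> = exp ((2 * real m) ^ d)" by (simp add: exp_of_nat_mult[symmetric])
      finally show ?thesis .
    qed
    have A1: "2 ^ ((2 * m) ^ d) \<le> exp (a ^ d)" by (rule order_trans[OF ee]) (simp only: exp_le_cancel_iff pw)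
    have "(real m)\<^sup>2 \<le> (L * a / R)\<^sup>2" using mu by (intro power_mono) auto
    then have "real N / (2 * (L * a / R)\<^sup>2) \<le> real N / (2 * (real m)\<^sup>2)"
      using m1 by (intro divide_left_mono mult_pos_pos) auto
    moreover have "real N / (2 * (L * a / R)\<^sup>2) = a ^ d * (1 / (2 * L\<^sup>2)) * y ^ k"
      unfolding aN[symmetric] R2[symmetric] using L a1 R1 by (simp add: power_add power2_eq_square field_simps)
    ultimately have "a ^ d * (1 / (2 * L\<^sup>2)) * y ^ k \<le> real N / (2 * (real m)\<^sup>2)" by (simp only:)
    then have A2: "exp (- real N / (2 * (real m)\<^sup>2)) \<le> exp (- (a ^ d * (1 / (2 * L\<^sup>2)) * y ^ k))"
      by (simp only: exp_le_cancel_iff minus_divide_left[symmetric] neg_le_iff_le)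
    have "2 * 2 ^ ((2 * m) ^ d) * exp (- real N / (2 * (real m)\<^sup>2)) \<le> 2 * exp (a ^ d) * exp (- (a ^ d * (1 / (2 * L\<^sup>2)) * y ^ k))"
      using A1 A2 by (intro mult_mono) auto
    also have "\<dots> = 2 * exp (a ^ d - a ^ d * (1 / (2 * L\<^sup>2)) * y ^ k)" by (simp add: exp_diff exp_minus field_simps)
    finally have A: "2 * 2 ^ ((2 * m) ^ d) * exp (- real N / (2 * (real m)\<^sup>2)) \<le> 2 * exp (a ^ d - a ^ d * (1 / (2 * L\<^sup>2)) * y ^ k)" .
    have "b * (r * a * R) = \<beta> * (L * a / R) * q / (16 * real d)"
      using R1 by (simp add: b_def q_def R2[symmetric] power2_eq_square field_simps)
    also have "\<dots> \<le> \<beta> * (2 * real m) * q / (16 * real d)"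
      using ml \<beta>_pos q by (intro divide_right_mono mult_right_mono mult_left_mono) auto
    also have "\<dots> = \<beta> * real m * q / (8 * real d)" by simp
    finally have "exp (- \<beta> * real m * q / (8 * real d)) \<le> exp (- b * (r * a))" using ra by simp
    then have B: "16 * K / (\<beta> * q) * exp (- \<beta> * real m * q / (8 * real d)) \<le> 16 * K / (\<beta> * q) * exp (- b * (r * a))"
      using pref0 by (rule mult_left_mono)
    have F: "Pr.prob E \<le> 2 * exp (a ^ d - a ^ d * (1 / (2 * L\<^sup>2)) * y ^ k) + 16 * K / (\<beta> * q) * exp (- b * (r * a))"
      using E(3) A B by linarith
    show thesis
    proof (rule that[OF E(1)])
      show "{w \<in> space Pr. c * y ^ k * r < dev n N w} \<subseteq> E" using E(2) unfolding q_def .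
      show "Pr.prob E \<le> 2 * exp (a ^ CARD('d) - a ^ CARD('d) * (1 / (2 * L\<^sup>2)) * y ^ k)
        + 16 * K / (\<beta> * c * r) * (1 / y) ^ k * exp (- (\<beta> * L * c / (16 * real CARD('d))) * (r * a))"
        using F unfolding pref b_def d_def .
    qed
  next
    case False
    obtain E where E: "E \<in> Pr.events" "{w \<in> space Pr. q < dev n N w} \<subseteq> E"
      "Pr.prob E \<le> 16 * K / (\<beta> * q) * exp (- \<beta> * q / (12 * real d))"
      unfolding d_def by (rule dev_event_coarse[OF N q, of n])
    have "b * (r * a * R) \<le> \<beta> * q / (12 * real d)"
    proof -
      have "L * a \<le> R" using False R1 by (simp add: field_simps)
      then have "\<beta> * c * r * R * (L * a) / (16 * real d) \<le> \<beta> * c * r * R * R / (16 * real d)"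
        using \<beta>_pos c r R1 by (intro divide_right_mono mult_left_mono) auto
      also have "\<dots> = \<beta> * q / (16 * real d)" by (simp add: q_def R2[symmetric] power2_eq_square)
      also have "\<dots> \<le> \<beta> * q / (12 * real d)" using \<beta>_pos q d by (intro divide_left_mono) auto
      finally show ?thesis by (simp add: b_def mult_ac)
    qed
    then have "exp (- \<beta> * q / (12 * real d)) \<le> exp (- b * (r * a))" using ra by simp
    then have B: "16 * K / (\<beta> * q) * exp (- \<beta> * q / (12 * real d)) \<le> 16 * K / (\<beta> * q) * exp (- b * (r * a))"
      using pref0 by (rule mult_left_mono)
    have "0 \<le> 2 * exp (a ^ d - a ^ d * (1 / (2 * L\<^sup>2)) * y ^ k)" by simp
    then have F: "Pr.prob E \<le> 2 * exp (a ^ d - a ^ d * (1 / (2 * L\<^sup>2)) * y ^ k) + 16 * K / (\<beta> * q) * exp (- b * (r * a))"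
      using E(3) B by linarith
    show thesis
    proof (rule that[OF E(1)])
      show "{w \<in> space Pr. c * y ^ k * r < dev n N w} \<subseteq> E" using E(2) unfolding q_def .
      show "Pr.prob E \<le> 2 * exp (a ^ CARD('d) - a ^ CARD('d) * (1 / (2 * L\<^sup>2)) * y ^ k)
        + 16 * K / (\<beta> * c * r) * (1 / y) ^ k * exp (- (\<beta> * L * c / (16 * real CARD('d))) * (r * a))"
        using F unfolding pref b_def d_def .
    qed
  qed
qed

text \<open>The image of the current empirical measure is inserted between the two laws at time
  \<open>Suc n\<close>; one part is \<open>dev n N w\<close>, the other is contracted by
  \<open>Psi_lipschitz\<close>. In the sum \<open>k\<close> is the lag, so the newest deviation has
  weight 1.\<close>

lemma W1_decomposition:
  fixes n N w
  assumes N: "1 \<le> N"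
  defines "\<xi> \<equiv> exp (- \<omega>) + 2 * \<delta> * \<sigma>"
  shows "err n N w
    \<le> (\<Sum>k<n. \<xi> ^ k * dev (n - 1 - k) N w) + \<xi> ^ n * err0 N w"
proof (induction n)
  case (Suc n)
  have \<xi>: "0 \<le> \<xi>" using delta_nonneg sigma_nonneg by (simp add: \<xi>_def)
  let ?e = "empirical N (particles n N w)"
  note P = empirical_in_P1[OF N]
  have "W1 (empirical N (particles (Suc n) N w)) ((\<Psi> ^^ Suc n) \<mu>0)
    \<le> dev n N w + W1 (\<Psi> ?e) (\<Psi> ((\<Psi> ^^ n) \<mu>0))"
    unfolding dev_def funpow.simps comp_def
    by (intro W1_triangle P Psi_in_P1 Psi_iterate_in_P1 mu0)
  also have "W1 (\<Psi> ?e) (\<Psi> ((\<Psi> ^^ n) \<mu>0)) \<le> \<xi> * W1 ?e ((\<Psi> ^^ n) \<mu>0)"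
    unfolding \<xi>_def by (intro Psi_lipschitz P Psi_iterate_in_P1 mu0)
  also have "\<dots> \<le> \<xi> * ((\<Sum>k<n. \<xi> ^ k * dev (n - 1 - k) N w) + \<xi> ^ n * err0 N w)"
    by (intro mult_left_mono Suc \<xi>)
  also have "dev n N w + \<dots> = (\<Sum>k<Suc n. \<xi> ^ k * dev (Suc n - 1 - k) N w) + \<xi> ^ Suc n * err0 N w"
    unfolding sum.lessThan_Suc_shift by (simp add: sum_distrib_left distrib_left mult_ac del: particle.simps)
  finally show ?case by simp
qed simp

text \<open>If no deviation exceeds its threshold and the initial error is small, the weighted sum
  in \<open>W1_decomposition\<close> is at most \<open>r\<close> by the choice of \<open>c\<close>
  and \<open>q\<close> in \<open>weights\<close>. The event is thus covered by the initial event and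
  one exceptional event per lag. The constants \<open>b\<close> and \<open>Q\<close> depend neither
  on \<open>N\<close>, \<open>n\<close> nor on \<open>r\<close>.\<close>

lemma concentration:
  assumes \<gamma>: "0 < \<gamma>" "2 * \<sigma> * (\<gamma> + \<delta>) < 1 - exp (- \<omega>)"
  obtains b Q where "0 < b" "0 < Q"
    "\<And>N n r. 1 \<le> N \<Longrightarrow> 0 < r \<Longrightarrow>
      Pr.prob {w \<in> space Pr. r < err n N w}
      \<le> Pr.prob {w \<in> space Pr. 2 * \<sigma> * \<gamma> * ((1 - 2 * \<sigma> * \<gamma>) / (exp (- \<omega>) + 2 * \<delta> * \<sigma>)) ^ n * r
           < err0 N w}
        + (exp (- ((real N powr (1 / real (CARD('d) + 2))) ^ CARD('d))) / 2
           + Q / r * exp (- b * (r * real N powr (1 / real (CARD('d) + 2)))))"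
proof -
  define \<xi> where "\<xi> = exp (- \<omega>) + 2 * \<delta> * \<sigma>"
  define p where "p = 2 * \<sigma> * \<gamma>"
  have \<xi>: "0 < \<xi>" using delta_nonneg sigma_nonneg by (auto simp: \<xi>_def intro!: add_pos_nonneg)
  \<comment> \<open>The second assumption on \<gamma> says exactly \<open>\<xi> < 1 - p\<close>;
    this gap is what lets the thresholds grow.\<close>
  have p: "0 \<le> p" "\<xi> < 1 - p" using \<gamma> sigma_nonneg by (auto simp: p_def \<xi>_def algebra_simps)
  obtain c q where cq: "0 < c" "\<xi> < q" "q < 1" "\<And>n. c * (\<Sum>k<n. q ^ k) + p * (1 - p) ^ n \<le> 1"
    using weights[OF p \<xi>] by blast
  \<comment> \<open>With this ratio the discounted threshold
    \<open>\<xi> ^ k * (c * y ^ k * r)\<close> becomes \<open>c * q ^ k * r\<close>, which is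
    summable. In the same way \<open>\<xi> ^ n\<close> times the initial threshold becomes
    \<open>p * (1 - p) ^ n * r\<close>.\<close>
  define y where "y = q / \<xi>"
  have y: "1 < y" using cq \<xi> by (simp add: y_def)
  obtain L where L: "0 < L" "L \<le> 1/2"
    "\<And>B n. 1 \<le> B \<Longrightarrow> (\<Sum>k<n. 2 * exp (B - B * (1 / (2 * L\<^sup>2)) * y ^ k)) \<le> exp (- B) / 2"
    using exp_sum_le[OF y] by blast
  define b where "b = \<beta> * L * c / (16 * real CARD('d))"
  have b: "0 < b" using \<beta>_pos L cq by (simp add: b_def)
  \<comment> \<open>The last factor bounds the geometric series in \<open>1 / y\<close> for every
    \<open>n\<close>.\<close>
  define Q where "Q = 16 * K / (\<beta> * c) * (y / (y - 1))"
  have Q: "0 < Q" using K \<beta>_pos cq y by (simp add: Q_def)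
  show thesis
  proof (rule that[OF b Q])
    fix N n :: nat and r :: real assume N: "1 \<le> N" and r: "0 < r"
    define a where "a = real N powr (1 / real (CARD('d) + 2))"
    have a1: "1 \<le> a" using N by (simp add: a_def ge_one_powr_ge_zero)
    have "\<forall>k. \<exists>E. E \<in> Pr.events \<and> {w \<in> space Pr. c * y ^ k * r < dev (n - 1 - k) N w} \<subseteq> E \<and>
      Pr.prob E \<le> 2 * exp (a ^ CARD('d) - a ^ CARD('d) * (1 / (2 * L\<^sup>2)) * y ^ k)
      + 16 * K / (\<beta> * c * r) * (1 / y) ^ k * exp (- b * (r * a))"
      (is "\<forall>k. \<exists>E. ?P k E")
    proof
      fix k
      obtain E where "E \<in> Pr.events" "{w \<in> space Pr. c * y ^ k * r < dev (n - 1 - k) N w} \<subseteq> E"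
        "Pr.prob E \<le> 2 * exp (a ^ CARD('d) - a ^ CARD('d) * (1 / (2 * L\<^sup>2)) * y ^ k)
          + 16 * K / (\<beta> * c * r) * (1 / y) ^ k * exp (- b * (r * a))"
        unfolding a_def b_def by (rule dev_tail[OF N r cq(1) L(1,2) y, of k "n - 1 - k"])
      then show "\<exists>E. ?P k E" by (intro exI[of _ E] conjI)
    qed
    from choice[OF this] obtain E where E': "\<forall>k. ?P k (E k)" ..
    have E: "\<And>k. E k \<in> Pr.events" "\<And>k. {w \<in> space Pr. c * y ^ k * r < dev (n - 1 - k) N w} \<subseteq> E k"
      "\<And>k. Pr.prob (E k) \<le> 2 * exp (a ^ CARD('d) - a ^ CARD('d) * (1 / (2 * L\<^sup>2)) * y ^ k)
      + 16 * K / (\<beta> * c * r) * (1 / y) ^ k * exp (- b * (r * a))"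
      using E' by simp_all
    define I where "I = {w \<in> space Pr. p * ((1 - p) / \<xi>) ^ n * r < err0 N w}"
    have "(\<lambda>w. W1 (empirical N (\<lambda>i. X0 N i w)) \<mu>0) \<in> borel_measurable Pr"
      by (rule W1_empirical_measurable[OF N mu0 X0_meas])
    then have I: "I \<in> Pr.events" unfolding I_def by simp
    have sub: "{w \<in> space Pr. r < err n N w} \<subseteq> I \<union> (\<Union>k<n. E k)"
    proof (rule subsetI, rule ccontr)
      fix w assume w: "w \<in> {w \<in> space Pr. r < err n N w}"
        and nw: "w \<notin> I \<union> (\<Union>k<n. E k)"
      have nI: "err0 N w \<le> p * ((1 - p) / \<xi>) ^ n * r"
        and nE: "\<And>k. k < n \<Longrightarrow> dev (n - 1 - k) N w \<le> c * y ^ k * r"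
        subgoal using w nw unfolding I_def by auto
        subgoal for k using E(2)[of k] w nw by (intro leI notI) auto
        done
      have "err n N w
        \<le> (\<Sum>k<n. \<xi> ^ k * dev (n - 1 - k) N w) + \<xi> ^ n * err0 N w"
        unfolding \<xi>_def by (rule W1_decomposition[OF N])
      also have "\<dots> \<le> (\<Sum>k<n. \<xi> ^ k * (c * y ^ k * r)) + \<xi> ^ n * (p * ((1 - p) / \<xi>) ^ n * r)"
        using \<xi> nI nE by (intro add_mono sum_mono mult_left_mono) auto
      also have "\<dots> = (c * (\<Sum>k<n. q ^ k) + p * (1 - p) ^ n) * r"
      proof -
        have "\<xi> ^ k * (c * y ^ k * r) = c * q ^ k * r" for k
          using \<xi> by (simp add: y_def power_divide)
        moreover have "\<xi> ^ n * (p * ((1 - p) / \<xi>) ^ n * r) = p * (1 - p) ^ n * r"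
          using \<xi> by (simp add: power_divide)
        ultimately show ?thesis by (simp only: distrib_right sum_distrib_left sum_distrib_right)
      qed
      also have "\<dots> \<le> 1 * r" using cq(4) r by (intro mult_right_mono) auto
      finally show False using w by simp
    qed
    have geo: "(\<Sum>k<n. (1 / y) ^ k) \<le> y / (y - 1)"
    proof -
      have "(1 - 1 / y) * (\<Sum>k<n. (1 / y) ^ k) = 1 - (1 / y) ^ n" by (rule one_diff_power_eq[symmetric])
      then have "(1 - 1 / y) * (\<Sum>k<n. (1 / y) ^ k) \<le> 1" using y by simp
      then show ?thesis using y by (simp add: field_simps)
    qed
    have "Pr.prob {w \<in> space Pr. r < err n N w} \<le> Pr.prob (I \<union> (\<Union>k<n. E k))"
      using I E(1) by (intro Pr.finite_measure_mono[OF sub]) auto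
    also have "\<dots> \<le> Pr.prob I + Pr.prob (\<Union>k<n. E k)" using I E(1) by (intro measure_Un_le) auto
    also have "Pr.prob (\<Union>k<n. E k) \<le> (\<Sum>k<n. Pr.prob (E k))"
      using E(1) by (intro Pr.finite_measure_subadditive_finite) auto
    also have "\<dots> \<le> (\<Sum>k<n. 2 * exp (a ^ CARD('d) - a ^ CARD('d) * (1 / (2 * L\<^sup>2)) * y ^ k)
      + 16 * K / (\<beta> * c * r) * (1 / y) ^ k * exp (- b * (r * a)))"
      by (rule sum_mono) (rule E(3))
    also have "\<dots> = (\<Sum>k<n. 2 * exp (a ^ CARD('d) - a ^ CARD('d) * (1 / (2 * L\<^sup>2)) * y ^ k))
      + 16 * K / (\<beta> * c * r) * exp (- b * (r * a)) * (\<Sum>k<n. (1 / y) ^ k)"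
      unfolding sum.distrib sum_distrib_left
      by (rule arg_cong2[where f="(+)"], rule refl, rule sum.cong[OF refl]) (simp add: mult_ac)
    also have "\<dots> \<le> exp (- (a ^ CARD('d))) / 2 + 16 * K / (\<beta> * c * r) * exp (- b * (r * a)) * (y / (y - 1))"
      using K \<beta>_pos cq r a1 geo by (intro add_mono L(3) mult_left_mono) auto
    also have "16 * K / (\<beta> * c * r) * exp (- b * (r * a)) * (y / (y - 1)) = Q / r * exp (- b * (r * a))"
      by (simp add: Q_def mult_ac)
    finally show "Pr.prob {w \<in> space Pr. r < err n N w}
      \<le> Pr.prob {w \<in> space Pr. 2 * \<sigma> * \<gamma> * ((1 - 2 * \<sigma> * \<gamma>) / (exp (- \<omega>) + 2 * \<delta> * \<sigma>)) ^ n * r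
           < err0 N w}
        + (exp (- ((real N powr (1 / real (CARD('d) + 2))) ^ CARD('d))) / 2
           + Q / r * exp (- b * (r * real N powr (1 / real (CARD('d) + 2)))))"
      unfolding I_def p_def[symmetric] \<xi>_def[symmetric] a_def by (simp add: add_left_mono)
  qed
qed

end

theorem theorem3p8:
  fixes A :: "real^'d^'d" and \<delta> \<omega> M \<alpha> \<gamma>0 :: real
    and \<theta> :: "(real^'m) measure" and \<mu>0 :: "(real^'d) measure"
    and f :: "real^'d \<Rightarrow> (real^'d) measure \<Rightarrow> real^'m \<Rightarrow> real^'d"
    and Pr :: "'w measure"
    and X0 :: "nat \<Rightarrow> nat \<Rightarrow> 'w \<Rightarrow> real^'d"
    and eps :: "nat \<Rightarrow> nat \<Rightarrow> 'w \<Rightarrow> real^'m"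
  assumes theta: "prob_space \<theta>" "sets \<theta> = sets (borel :: (real^'m) measure)"
    and mu0: "\<mu>0 \<in> P1"
    and f_meas: "(\<lambda>(x, \<mu>, z). f x \<mu> z) \<in>
        borel \<Otimes>\<^sub>M (restrict_space (subprob_algebra borel) P1 \<Otimes>\<^sub>M borel) \<rightarrow>\<^sub>M borel"
    and delta_nonneg: "0 \<le> \<delta>"
    \<comment> \<open>probability space carrying the particle system\<close>
    and Pr: "prob_space Pr"
    and X0_law: "\<And>N i. 1 \<le> N \<Longrightarrow> i \<in> {1..N} \<Longrightarrow> distr Pr borel (X0 N i) = \<mu>0"
    and X0_meas: "\<And>N i. X0 N i \<in> borel_measurable Pr"
    and exch: "\<And>N p. 1 \<le> N \<Longrightarrow> p permutes {1..N} \<Longrightarrow>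
        distr Pr (PiM {1..N} (\<lambda>_. borel)) (\<lambda>w. \<lambda>i\<in>{1..N}. X0 N (p i) w)
      = distr Pr (PiM {1..N} (\<lambda>_. borel)) (\<lambda>w. \<lambda>i\<in>{1..N}. X0 N i w)"
    and eps_law: "\<And>n i. 1 \<le> n \<Longrightarrow> 1 \<le> i \<Longrightarrow> distr Pr borel (eps n i) = \<theta>"
    and eps_indep: "prob_space.indep_vars Pr (\<lambda>_. borel) (\<lambda>(n, i). eps n i)
                      {(n, i). 1 \<le> n \<and> 1 \<le> i}"
    and eps_meas: "\<And>n i. eps n i \<in> borel_measurable Pr"
    and eps_X0_indep: "prob_space.indep_set Pr
        (sets (vimage_algebra (space Pr)
           (\<lambda>w. \<lambda>k\<in>{(N, i). 1 \<le> N \<and> 1 \<le> i \<and> i \<le> N}. X0 (fst k) (snd k) w)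
           (PiM {(N, i). 1 \<le> N \<and> 1 \<le> i \<and> i \<le> N} (\<lambda>_. borel))))
        (sets (vimage_algebra (space Pr)
           (\<lambda>w. \<lambda>k\<in>{(n, i). 1 \<le> n \<and> 1 \<le> i}. eps (fst k) (snd k) w)
           (PiM {(n, i). 1 \<le> n \<and> 1 \<le> i} (\<lambda>_. borel))))"
    \<comment> \<open>(A3)\<close>
    and A3: "0 < \<omega>" "onorm (\<lambda>x. A *v x) \<le> exp (- \<omega>)"
    \<comment> \<open>(A6)\<close>
    and A6i: "1 < M" "AE z in \<theta>. Dlip f z \<le> ennreal M"
    and A6ii: "0 < \<alpha>" "(\<integral>\<^sup>+ x. ennreal (exp (\<alpha> * norm x)) \<partial>\<mu>0) < \<infinity>"
              "(\<integral>\<^sup>+ z. ennreal (exp (\<alpha> * D1 f z)) \<partial>\<theta>) < \<infinity>"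
    \<comment> \<open>gamma0 in (0, a0), delta < a0 - gamma0, with a0 = (1 - e^{-omega}) / (2 sigma)
        (multiplied out; a0 = \<infinity> when sigma = 0)\<close>
    and gamma0: "0 < \<gamma>0" "2 * sigma f \<theta> * \<gamma>0 < 1 - exp (- \<omega>)"
    and delta_small: "2 * sigma f \<theta> * (\<gamma>0 + \<delta>) < 1 - exp (- \<omega>)"
                     "\<delta> < (1 - exp (- \<omega>)) / (2 * M)"
  shows "\<exists>N0::nat. \<exists>C1>0. \<forall>\<epsilon>>0. \<forall>n N::nat.
    (let d = CARD('d);
         rate = (1 - 2 * sigma f \<theta> * \<gamma>0) / (exp (- \<omega>) + 2 * \<delta> * sigma f \<theta>);
         lhs = measure Pr {w \<in> space Pr.
                 W1 (empirical N (particle A \<delta> f X0 eps n N w)) ((Psi A \<delta> f \<theta> ^^ n) \<mu>0) > \<epsilon>};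
         init = measure Pr {w \<in> space Pr.
                 W1 (empirical N (particle A \<delta> f X0 eps 0 N w)) \<mu>0
                   > 2 * sigma f \<theta> * \<gamma>0 * rate ^ n * \<epsilon>}
     in (1 < d \<longrightarrow> 1 \<le> N \<longrightarrow>
           real N \<ge> real N0 * max ((1 / \<epsilon> * logp (1 / \<epsilon>)) ^ (d + 2))
                                  (\<epsilon> powr (real (d + 2) / real (d - 1))) \<longrightarrow>
           lhs \<le> init + exp (- C1 * \<epsilon> * real N powr (1 / real (d + 2))))
      \<and> (d = 1 \<longrightarrow> 1 \<le> N \<longrightarrow>
           real N \<ge> real N0 * max ((1 / \<epsilon> * logp (1 / \<epsilon>)) ^ (d + 2)) 1 \<longrightarrow>
           lhs \<le> init + exp (- C1 * min \<epsilon> 1 * real N powr (1 / real (d + 2)))))"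
proof -
  note delta_gap = delta_small(1)
  interpret particle_system A \<delta> \<omega> M \<alpha> \<theta> f \<mu>0 Pr X0 eps
    by (intro particle_system.intro mean_field.intro particle_system_axioms.intro) (fact+)
  obtain b Q where bQ: "0 < b" "0 < Q" and conc: "\<And>N n r. 1 \<le> N \<Longrightarrow> 0 < r \<Longrightarrow>
      Pr.prob {w \<in> space Pr. r < err n N w}
      \<le> Pr.prob {w \<in> space Pr. 2 * \<sigma> * \<gamma>0 * ((1 - 2 * \<sigma> * \<gamma>0) / (exp (- \<omega>) + 2 * \<delta> * \<sigma>)) ^ n * r < err0 N w}
        + (exp (- ((real N powr (1 / real (CARD('d) + 2))) ^ CARD('d))) / 2
           + Q / r * exp (- b * (r * real N powr (1 / real (CARD('d) + 2)))))"
    using concentration[OF gamma0(1) delta_gap] by blast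
  \<comment> \<open>\<open>N0\<close> and \<open>C1\<close> are chosen from \<open>b\<close>,
    \<open>Q\<close> and the dimension alone, hence they serve all \<epsilon>, \<open>n\<close> and
    \<open>N\<close> at once.\<close>
  obtain N0 :: nat and C1 :: real where C1: "0 < C1" and
    R1: "\<forall>e>0. \<forall>N\<ge>1. 1 < CARD('d) \<longrightarrow>
       real N \<ge> real N0 * max ((1 / e * logp (1 / e)) ^ (CARD('d) + 2)) (e powr (real (CARD('d) + 2) / real (CARD('d) - 1))) \<longrightarrow>
       exp (- ((real N powr (1 / real (CARD('d) + 2))) ^ CARD('d))) / 2 + Q / e * exp (- b * (e * real N powr (1 / real (CARD('d) + 2))))
         \<le> exp (- C1 * e * real N powr (1 / real (CARD('d) + 2)))" and
    R2: "\<forall>e>0. \<forall>N\<ge>1. CARD('d) = 1 \<longrightarrow>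
       real N \<ge> real N0 * max ((1 / e * logp (1 / e)) ^ (CARD('d) + 2)) 1 \<longrightarrow>
       exp (- ((real N powr (1 / real (CARD('d) + 2))) ^ CARD('d))) / 2 + Q / e * exp (- b * (e * real N powr (1 / real (CARD('d) + 2))))
         \<le> exp (- C1 * min e 1 * real N powr (1 / real (CARD('d) + 2)))"
    by (rule rate_choice[OF bQ])
  show ?thesis
    unfolding Let_def
    apply (intro exI[of _ N0] exI[of _ C1] conjI allI impI C1)
    subgoal premises prems for e n N
      using conc[OF prems(3,1), of n] R1[rule_format, OF prems(1,3,2,4)] by linarith
    subgoal premises prems for e n N
      using conc[OF prems(3,1), of n] R2[rule_format, OF prems(1,3,2,4)] by linarith
    done
qed

end
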